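(* Suppose $p\in[2,\infty)$, $q\in\{\infty\}\cup[1,2)$, and $Y$ is a Banach space which contains copies of $\ell_q^n$ uniformly. Then $Y$ contains a subspace $X$ such that $\overline{i}(\mathrm{FBL}^{(p)}[X])$ is not a regular sublattice of $\mathrm{FBL}^{(p)}[Y]$, where $i:X\to Y$ is the canonical embedding.
   Context: All Banach spaces are real; subspaces (of Banach spaces) are closed. $Y$ contains copies of $\ell_q^n$ uniformly if there is a constant $C$ such that for every $n\in\mathbb N$, $Y$ has an $n$-dimensional subspace that is $C$-isomorphic to $\ell_q^n$. Let $1/p+1/p'=1$. For $z_1,\dots,z_n$ in a Banach space, $\|(z_i)_{i=1}^n\|_{p,\mathrm{weak}}=\sup\{\|\sum_i\alpha_i z_i\| : \|(\alpha_i)_i\|_{\ell_{p'}}\le 1\}$. For a Banach space $X$, $H_{w^*}[X]$ is the vector lattice (pointwise operations and order) of positively homogeneous functions $f:X^*\to\mathbb R$ that are weak$^*$-continuous on bounded sets. For $f\in H_{w^*}[X]$, $\|f\|_p$ is the infimum of all $C\ge 0$ such that $(\sum_{i=1}^n|f(x_i^* )|^p)^{1/p}\le C\|(x_i^* )_{i=1}^n\|_{p,\mathrm{weak}}$ for all $n$ and all $x_1^*,\dots,x_n^*\in X^*$. $H_{w^*}^p[X]=\{f\in H_{w^*}[X]:\|f\|_p<\infty\}$, normed by $\|\cdot\|_p$. For $x\in X$, $\delta_x(x^* )=\langle x^*,x\rangle$. $\mathrm{FVL}[X]$ is the vector sublattice of $H_{w^*}[X]$ generated by $\{\delta_x:x\in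 X\}$; $\mathrm{FBL}^{(p)}[X]$ is the closure of $\mathrm{FVL}[X]$ in $H_{w^*}^p[X]$. For a bounded operator $i:X\to Y$, $\overline{i}:H_{w^*}^p[X]\to H_{w^*}^p[Y]$ is the lattice homomorphism $[\overline{i}f](y^* )=f(i^*y^* )$; it maps $\mathrm{FBL}^{(p)}[X]$ into $\mathrm{FBL}^{(p)}[Y]$, and is injective when $i$ is. For an injective lattice homomorphism $j:E\to F$ of vector lattices, $j(E)$ is a regular sublattice of $F$ if for every set $A\subset E$ having a supremum $a$ in $E$, $ja$ is the supremum of $j(A)$ in $F$. *)

theory Defs
  imports "HOL-Analysis.Analysis" "HOL-Library.Lub_Glb"
begin

text \<open>
  A Banach space is represented by a closed linear subspace \<open>S\<close> of a type of class \<^class>\<open>banach\<close>,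
  with the whole space \<open>Y\<close> given by \<open>UNIV\<close>, because the subspace \<open>X\<close> depends on \<open>Y\<close> and hence
  cannot be a type.  Functions on a carrier are total functions that vanish off the carrier,
  so that pointwise operations and the order of the function type are those of the carrier.
\<close>

definition closed_subspace :: "'a::real_normed_vector set \<Rightarrow> bool" where
  "closed_subspace S \<longleftrightarrow> subspace S \<and> closed S"

definition bounded_op_on :: "'v set \<Rightarrow> ('v \<Rightarrow> real) \<Rightarrow> ('w \<Rightarrow> real) \<Rightarrow> ('v \<Rightarrow> 'w) \<Rightarrow> bool" where
  "bounded_op_on V N M T \<longleftrightarrow> (\<exists>K. \<forall>v\<in>V. M (T v) \<le> K * N v)"

definition op_norm :: "'v set \<Rightarrow> ('v \<Rightarrow> real) \<Rightarrow> ('w \<Rightarrow> real) \<Rightarrow> ('v \<Rightarrow> 'w) \<Rightarrow> real" where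
  "op_norm V N M T = (SUP v\<in>{v\<in>V. N v \<le> 1}. M (T v))"

subsection \<open>The spaces $\ell_q^n$\<close>

definition lq_norm :: "ereal \<Rightarrow> nat \<Rightarrow> (nat \<Rightarrow> real) \<Rightarrow> real" where
  "lq_norm q n a =
     (if q = \<infinity> then Max (insert 0 ((\<lambda>i. \<bar>a i\<bar>) ` {..<n}))
      else (\<Sum>i<n. \<bar>a i\<bar> powr real_of_ereal q) powr (1 / real_of_ereal q))"

definition seq_space :: "nat \<Rightarrow> (nat \<Rightarrow> real) set" where
  "seq_space n = {a. \<forall>i\<ge>n. a i = 0}"

definition C_isomorphic_lq :: "real \<Rightarrow> ereal \<Rightarrow> nat \<Rightarrow> 'a::real_normed_vector set \<Rightarrow> bool" where
  "C_isomorphic_lq C q n Z \<longleftrightarrow>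
     (\<exists>T. bij_betw T (seq_space n) Z \<and>
          (\<forall>a\<in>seq_space n. \<forall>b\<in>seq_space n. T (\<lambda>i. a i + b i) = T a + T b) \<and>
          (\<forall>a\<in>seq_space n. \<forall>c. T (\<lambda>i. c * a i) = c *\<^sub>R T a) \<and>
          bounded_op_on (seq_space n) (lq_norm q n) norm T \<and>
          bounded_op_on Z norm (lq_norm q n) (inv_into (seq_space n) T) \<and>
          op_norm (seq_space n) (lq_norm q n) norm T
            * op_norm Z norm (lq_norm q n) (inv_into (seq_space n) T) \<le> C)"

definition contains_lq_uniformly :: "'a::real_normed_vector set \<Rightarrow> ereal \<Rightarrow> bool" where
  "contains_lq_uniformly Y q \<longleftrightarrow>
     (\<exists>C. \<forall>n. \<exists>Z\<subseteq>Y. closed_subspace Z \<and> dim Z = n \<and> C_isomorphic_lq C q n Z)"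

subsection \<open>The dual space and the weak $p$-norm\<close>

definition dual :: "'a::real_normed_vector set \<Rightarrow> ('a \<Rightarrow> real) set" where
  "dual S = {\<phi>. (\<forall>x\<in>S. \<forall>y\<in>S. \<phi> (x + y) = \<phi> x + \<phi> y) \<and>
                (\<forall>x\<in>S. \<forall>c. \<phi> (c *\<^sub>R x) = c * \<phi> x) \<and>
                bounded_op_on S norm abs \<phi> \<and>
                (\<forall>x. x \<notin> S \<longrightarrow> \<phi> x = 0)}"

abbreviation dual_norm :: "'a::real_normed_vector set \<Rightarrow> ('a \<Rightarrow> real) \<Rightarrow> real" where
  "dual_norm S \<equiv> op_norm S norm abs"

definition conjugate_exponent :: "real \<Rightarrow> ereal" where
  "conjugate_exponent p = (if p = 1 then \<infinity> else ereal (p / (p - 1)))"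

definition weak_p_norm ::
    "'a::real_normed_vector set \<Rightarrow> real \<Rightarrow> nat \<Rightarrow> (nat \<Rightarrow> 'a \<Rightarrow> real) \<Rightarrow> real" where
  "weak_p_norm S p n \<phi> =
     (SUP a\<in>{a. lq_norm (conjugate_exponent p) n a \<le> 1}. dual_norm S (\<lambda>x. \<Sum>i<n. a i * \<phi> i x))"

subsection \<open>Free Banach lattices\<close>

text \<open>
  The topology on the function type used by \<^const>\<open>continuous_on\<close> is the product topology, i.e.
  the topology of pointwise convergence; on \<open>dual S\<close> it is the weak* topology.
\<close>

definition H_wstar :: "'a::real_normed_vector set \<Rightarrow> (('a \<Rightarrow> real) \<Rightarrow> real) set" where
  "H_wstar S =
     {f. (\<forall>\<phi>\<in>dual S. \<forall>c\<ge>0. f (\<lambda>x. c * \<phi> x) = c * f \<phi>) \<and>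
         (\<forall>B\<subseteq>dual S. (\<exists>r. \<forall>\<phi>\<in>B. dual_norm S \<phi> \<le> r) \<longrightarrow> continuous_on B f) \<and>
         (\<forall>\<phi>. \<phi> \<notin> dual S \<longrightarrow> f \<phi> = 0)}"

definition p_norm :: "'a::real_normed_vector set \<Rightarrow> real \<Rightarrow> (('a \<Rightarrow> real) \<Rightarrow> real) \<Rightarrow> ereal" where
  "p_norm S p f =
     Inf {ereal C | C. C \<ge> 0 \<and>
       (\<forall>n \<phi>. (\<forall>i<n. \<phi> i \<in> dual S) \<longrightarrow>
          lq_norm (ereal p) n (\<lambda>i. f (\<phi> i)) \<le> C * weak_p_norm S p n \<phi>)}"

definition H_wstar_p :: "'a::real_normed_vector set \<Rightarrow> real \<Rightarrow> (('a \<Rightarrow> real) \<Rightarrow> real) set" where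
  "H_wstar_p S p = {f \<in> H_wstar S. p_norm S p f < \<infinity>}"

definition delta :: "'a::real_normed_vector set \<Rightarrow> 'a \<Rightarrow> ('a \<Rightarrow> real) \<Rightarrow> real" where
  "delta S x = (\<lambda>\<phi>. if \<phi> \<in> dual S then \<phi> x else 0)"

definition vector_sublattice :: "('b \<Rightarrow> real) set \<Rightarrow> bool" where
  "vector_sublattice L \<longleftrightarrow>
     (\<lambda>_. 0) \<in> L \<and>
     (\<forall>f\<in>L. \<forall>g\<in>L. (\<lambda>t. f t + g t) \<in> L) \<and>
     (\<forall>f\<in>L. \<forall>c. (\<lambda>t. c * f t) \<in> L) \<and>
     (\<forall>f\<in>L. \<forall>g\<in>L. (\<lambda>t. max (f t) (g t)) \<in> L) \<and>
     (\<forall>f\<in>L. \<forall>g\<in>L. (\<lambda>t. min (f t) (g t)) \<in> L)"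

definition FVL :: "'a::real_normed_vector set \<Rightarrow> (('a \<Rightarrow> real) \<Rightarrow> real) set" where
  "FVL S = (\<lambda>L. vector_sublattice L \<and> L \<subseteq> H_wstar S) hull (delta S ` S)"

definition FBL :: "'a::real_normed_vector set \<Rightarrow> real \<Rightarrow> (('a \<Rightarrow> real) \<Rightarrow> real) set" where
  "FBL S p = {f \<in> H_wstar_p S p. \<forall>e>0. \<exists>g\<in>FVL S. p_norm S p (\<lambda>\<phi>. f \<phi> - g \<phi>) < ereal e}"

subsection \<open>Induced homomorphisms and regular sublattices\<close>

definition adjoint_on ::
    "'a::real_normed_vector set \<Rightarrow> ('a \<Rightarrow> 'b::real_normed_vector) \<Rightarrow> ('b \<Rightarrow> real) \<Rightarrow> 'a \<Rightarrow> real" where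
  "adjoint_on S i \<psi> = (\<lambda>x. if x \<in> S then \<psi> (i x) else 0)"

text \<open>The map $\overline{i}$ induced by an operator \<open>i\<close> from \<open>S\<close> to \<open>T\<close>.\<close>

definition induced_hom ::
    "'a::real_normed_vector set \<Rightarrow> 'b::real_normed_vector set \<Rightarrow> ('a \<Rightarrow> 'b) \<Rightarrow>
     (('a \<Rightarrow> real) \<Rightarrow> real) \<Rightarrow> ('b \<Rightarrow> real) \<Rightarrow> real" where
  "induced_hom S T i f = (\<lambda>\<psi>. if \<psi> \<in> dual T then f (adjoint_on S i \<psi>) else 0)"

text \<open>
  Regularity of the image of \<open>E\<close> in \<open>F\<close> under an injective lattice homomorphism \<open>j\<close>.  Suprema are
  taken relative to \<open>E\<close> and \<open>F\<close>.  Only nonempty sets are considered: the empty set has a supremum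
  only in the zero lattice, whose image would otherwise fail to be regular in any nonzero \<open>F\<close>.
\<close>

definition regular_image :: "'e::ord set \<Rightarrow> 'f::ord set \<Rightarrow> ('e \<Rightarrow> 'f) \<Rightarrow> bool" where
  "regular_image E F j \<longleftrightarrow>
     (\<forall>A a. A \<noteq> {} \<longrightarrow> A \<subseteq> E \<longrightarrow> isLub E A a \<longrightarrow> isLub F (j ` A) (j a))"

end

(*
  For a finite family x_1, ..., x_m in Y whose span norm dominates the l_2 norm of the coefficients,
  Khinchine's inequality makes the normalized tuple of all 2^m sign functionals weakly p-summable on the
  span, and each of them has average modulus 1 on the family. If the x_i are suitably chosen in a copy of
  l_q^n, then tuples of functionals on all of Y behave differently: the average (1/m) sum |y*(x_i)|
  has small p-norm in H[Y]. For q = infinity this follows from the cotype p inequality; for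
  q < 2 it follows from a Bessel inequality for a subspace of l_q^n that is uniformly close to being
  flat, obtained as a tensor power of the mean zero subspace of l_q^n.

  Let X be the closed span of a vector x_0 and of a sequence of such families, chosen one after the other
  as in Mazur's construction of basic sequences, so that their coordinate functionals live on X. Let G_k
  be large multiples of the averages whose p-norms in H[Y] are still summable. In FBL[X] the supremum
  of the min(|delta_{x_0}|, G_k) is |delta_{x_0}|: functions in FVL[X] depend on finitely many vectors only
  and hence do not notice perturbations of a functional by the sign functionals of a late family, on which
  G_k is large. In FBL[Y] the sum of the G_k is another upper bound, and it vanishes at a functional
  that annihilates all the families but not x_0.
*)
theory Submission
  imports Defs
begin

section \<open>Finite \<open>\<ell>\<^sub>p\<close> sums\<close>

text \<open>At a functional of norm K the average over the k-th family is at most 4^(-k) * K, so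
  even after multiplication by 2^k it tends to 0: the supremum in FBL[X] is far from a pointwise
  one. By the same estimate the sign functionals of the k-th family have norm at least 4^k, so weak*
  continuity on bounded sets says nothing about them. The p-norm does control them: the 2^m
  perturbations of one functional, scaled to a p-normalized tuple, have a weak p-norm on X that is
  bounded independently of k, and FBL[X] is a closure in exactly this norm.

  For q = infinity the norm on the span of a family can be designed freely, since spaces with
  polyhedral balls embed into l_infinity^n. For q < 2 there is no such freedom. Passing from m + 1
  coordinates to the m-dimensional space of mean zero vectors gains a factor 1 + const * m^(-q/2) in
  the q-th power of the norm and costs only a factor 1 - O(1/m) through the lost dimension. Tensor
  powers amplify this small gain.\<close>

definition lp_sum :: "real \<Rightarrow> 'i set \<Rightarrow> ('i \<Rightarrow> real) \<Rightarrow> real" where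
  "lp_sum p I b = (\<Sum>i\<in>I. \<bar>b i\<bar> powr p) powr (1 / p)"

lemma lp_sum_nonneg [simp]: "0 \<le> lp_sum p I b"
  by (simp add: lp_sum_def)

lemma lp_sum_powr:
  assumes "p > 0"
  shows "lp_sum p I b powr p = (\<Sum>i\<in>I. \<bar>b i\<bar> powr p)"
  using assms by (simp add: lp_sum_def powr_powr sum_nonneg)

lemma lp_sum_le_iff:
  assumes "p > 0" "B \<ge> 0"
  shows "lp_sum p I b \<le> B \<longleftrightarrow> (\<Sum>i\<in>I. \<bar>b i\<bar> powr p) \<le> B powr p"
proof
  assume "lp_sum p I b \<le> B"
  then have "lp_sum p I b powr p \<le> B powr p"
    using assms by (intro powr_mono2) auto
  then show "(\<Sum>i\<in>I. \<bar>b i\<bar> powr p) \<le> B powr p"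
    using assms by (simp add: lp_sum_powr)
next
  assume "(\<Sum>i\<in>I. \<bar>b i\<bar> powr p) \<le> B powr p"
  then have "lp_sum p I b \<le> (B powr p) powr (1 / p)"
    unfolding lp_sum_def using assms by (intro powr_mono2) (auto intro: sum_nonneg)
  then show "lp_sum p I b \<le> B"
    using assms by (simp add: powr_powr)
qed

lemma lp_sum_mono:
  assumes "p > 0" "\<And>i. i \<in> I \<Longrightarrow> \<bar>a i\<bar> \<le> \<bar>b i\<bar>"
  shows "lp_sum p I a \<le> lp_sum p I b"
  unfolding lp_sum_def using assms
  by (intro powr_mono2 sum_mono) (auto intro: sum_nonneg)

lemma lp_sum_cmult:
  assumes "p > 0"
  shows "lp_sum p I (\<lambda>i. c * b i) = \<bar>c\<bar> * lp_sum p I b"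
proof -
  have "(\<Sum>i\<in>I. \<bar>c * b i\<bar> powr p) = \<bar>c\<bar> powr p * (\<Sum>i\<in>I. \<bar>b i\<bar> powr p)"
    by (simp add: abs_mult powr_mult sum_distrib_left)
  then show ?thesis
    using assms by (simp add: lp_sum_def powr_mult powr_powr sum_nonneg)
qed

lemma lp_sum_eq_0_iff:
  assumes "p > 0" "finite I"
  shows "lp_sum p I b = 0 \<longleftrightarrow> (\<forall>i\<in>I. b i = 0)"
  using assms by (simp add: lp_sum_def sum_nonneg_eq_0_iff)

lemma abs_le_lp_sum:
  assumes "p > 0" "finite I" "i \<in> I"
  shows "\<bar>b i\<bar> \<le> lp_sum p I b"
proof -
  have "\<bar>b i\<bar> powr p \<le> lp_sum p I b powr p"
    using assms by (auto simp: lp_sum_powr intro!: member_le_sum)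
  then show ?thesis
    using assms powr_less_mono2[of p "lp_sum p I b" "\<bar>b i\<bar>"] by force
qed

section \<open>Hoelder's and Minkowski's inequalities\<close>

lemma holder_sum:
  fixes a b :: "'i \<Rightarrow> real"
  assumes "finite I" "p > 1" "q > 1" "1 / p + 1 / q = 1"
  shows "\<bar>\<Sum>i\<in>I. a i * b i\<bar> \<le> lp_sum q I a * lp_sum p I b"
proof (cases "lp_sum q I a = 0 \<or> lp_sum p I b = 0")
  case True
  then have "\<forall>i\<in>I. a i * b i = 0"
    using assms lp_sum_eq_0_iff[of q I a] lp_sum_eq_0_iff[of p I b] by auto
  then have "(\<Sum>i\<in>I. a i * b i) = 0"
    by (intro sum.neutral)
  then show ?thesis
    by simp
next
  case False
  define A where "A = lp_sum q I a"
  define B where "B = lp_sum p I b"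
  have pos: "A > 0" "B > 0"
    using False lp_sum_nonneg[of q I a] lp_sum_nonneg[of p I b] unfolding A_def B_def by linarith+
  have "\<bar>a i * b i\<bar> / (A * B) \<le> \<bar>a i\<bar> powr q / A powr q / q + \<bar>b i\<bar> powr p / B powr p / p" for i
    using Youngs_inequality[of q p "\<bar>a i\<bar> / A" "\<bar>b i\<bar> / B"] assms pos
    by (simp add: powr_divide abs_mult add.commute)
  then have "(\<Sum>i\<in>I. \<bar>a i * b i\<bar> / (A * B))
      \<le> (\<Sum>i\<in>I. \<bar>a i\<bar> powr q / A powr q / q + \<bar>b i\<bar> powr p / B powr p / p)"
    by (intro sum_mono) auto
  also have "\<dots> = (\<Sum>i\<in>I. \<bar>a i\<bar> powr q) / A powr q / q + (\<Sum>i\<in>I. \<bar>b i\<bar> powr p) / B powr p / p"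
    by (simp add: sum.distrib sum_divide_distrib)
  also have "\<dots> = A powr q / A powr q / q + B powr p / B powr p / p"
    using assms unfolding A_def B_def by (simp only: lp_sum_powr)
  also have "\<dots> = 1"
    using assms pos by (simp add: add.commute)
  finally have "(\<Sum>i\<in>I. \<bar>a i * b i\<bar>) \<le> A * B"
    using pos by (simp add: sum_divide_distrib[symmetric] divide_simps)
  then show ?thesis
    unfolding A_def B_def using sum_abs[of "\<lambda>i. a i * b i" I] by linarith
qed

text \<open>Equality case of Hoelder's inequality. It yields Minkowski's inequality by duality and
  lets the weak p-norm, which is defined through the conjugate exponent, be computed from l_p
  sums.\<close>

lemma holder_sum_attained:
  fixes b :: "'i \<Rightarrow> real"
  assumes "finite I" "p > 1" "q > 1" "1 / p + 1 / q = 1"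
  obtains a where "lp_sum q I a \<le> 1" "(\<Sum>i\<in>I. a i * b i) = lp_sum p I b"
proof (cases "lp_sum p I b = 0")
  case True
  have "lp_sum q I (\<lambda>_. 0) \<le> 1"
    using assms by (simp add: lp_sum_def)
  then show ?thesis
    using True that[of "\<lambda>_. 0"] by simp
next
  case False
  define B where "B = lp_sum p I b"
  have B: "B > 0"
    using False lp_sum_nonneg[of p I b] unfolding B_def by linarith
  have q: "(p - 1) * q = p"
    using assms by (simp add: field_simps)
  define a where "a i = sgn (b i) * (\<bar>b i\<bar> / B) powr (p - 1)" for i
  have "\<bar>a i\<bar> powr q = \<bar>b i\<bar> powr p / B powr p" for i
  proof -
    have "\<bar>a i\<bar> = (\<bar>b i\<bar> / B) powr (p - 1)"
      unfolding a_def by (cases "b i = 0") (auto simp: abs_mult abs_sgn_eq)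
    then show ?thesis
      using q B by (simp add: powr_powr powr_divide)
  qed
  then have "(\<Sum>i\<in>I. \<bar>a i\<bar> powr q) = (\<Sum>i\<in>I. \<bar>b i\<bar> powr p) / B powr p"
    by (simp only: sum_divide_distrib)
  also have "\<dots> = B powr p / B powr p"
    using assms unfolding B_def by (simp only: lp_sum_powr)
  finally have "(\<Sum>i\<in>I. \<bar>a i\<bar> powr q) = 1"
    using B by simp
  then have le1: "lp_sum q I a \<le> 1"
    by (simp add: lp_sum_def)
  have "a i * b i = \<bar>b i\<bar> powr p / B powr (p - 1)" for i
  proof -
    have "a i * b i = (\<bar>b i\<bar> / B) powr (p - 1) * \<bar>b i\<bar>"
      unfolding a_def by (simp add: abs_sgn mult_ac)
    also have "\<dots> = \<bar>b i\<bar> powr (p - 1) * \<bar>b i\<bar> / B powr (p - 1)"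
      using B by (simp add: powr_divide)
    also have "\<bar>b i\<bar> powr (p - 1) * \<bar>b i\<bar> = \<bar>b i\<bar> powr p"
      by (cases "b i = 0") (auto simp: powr_diff)
    finally show ?thesis .
  qed
  then have "(\<Sum>i\<in>I. a i * b i) = (\<Sum>i\<in>I. \<bar>b i\<bar> powr p) / B powr (p - 1)"
    by (simp only: sum_divide_distrib)
  also have "\<dots> = B powr p / B powr (p - 1)"
    using assms unfolding B_def by (simp only: lp_sum_powr)
  finally have "(\<Sum>i\<in>I. a i * b i) = lp_sum p I b"
    using B by (simp only: powr_diff[symmetric] B_def[symmetric]) simp
  with le1 show ?thesis
    by (rule that)
qed

lemma conjugate_real:
  fixes p :: real
  assumes "p > 1"
  shows "p / (p - 1) > 1" "1 / p + 1 / (p / (p - 1)) = 1"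
  using assms by (auto simp: field_simps)

lemma minkowski_sum:
  fixes a b :: "'i \<Rightarrow> real"
  assumes "finite I" "p > 1"
  shows "lp_sum p I (\<lambda>i. a i + b i) \<le> lp_sum p I a + lp_sum p I b"
proof -
  define q where "q = p / (p - 1)"
  have q: "q > 1" "1 / p + 1 / q = 1"
    using conjugate_real[OF assms(2)] unfolding q_def by auto
  obtain c where c: "lp_sum q I c \<le> 1" "(\<Sum>i\<in>I. c i * (a i + b i)) = lp_sum p I (\<lambda>i. a i + b i)"
    by (rule holder_sum_attained[OF assms(1,2) q])
  have le: "(\<Sum>i\<in>I. c i * d i) \<le> lp_sum p I d" for d
  proof -
    have "(\<Sum>i\<in>I. c i * d i) \<le> lp_sum q I c * lp_sum p I d"
      using holder_sum[OF assms q, of c d] by linarith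
    also have "\<dots> \<le> 1 * lp_sum p I d"
      using c by (intro mult_right_mono) auto
    finally show ?thesis
      by simp
  qed
  show ?thesis
    using c(2) le[of a] le[of b] by (simp add: distrib_left sum.distrib)
qed

lemma minkowski_sum_sum:
  assumes "finite I" "p > 1" "finite K"
  shows "lp_sum p I (\<lambda>i. \<Sum>k\<in>K. a k i) \<le> (\<Sum>k\<in>K. lp_sum p I (a k))"
  using assms(3)
proof (induction K rule: finite_induct)
  case empty
  then show ?case
    using assms by (simp add: lp_sum_def)
next
  case (insert k K)
  then show ?case
    using minkowski_sum[OF assms(1,2), of "a k" "\<lambda>i. \<Sum>k\<in>K. a k i"] by simp
qed

text \<open>Hoelder against the constant 1; p = 1 is split off because its conjugate exponent is
  infinite.\<close>

lemma jensen_powr: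
  assumes "finite I" "p \<ge> 1"
  shows "\<bar>\<Sum>i\<in>I. x i\<bar> powr p \<le> real (card I) powr (p - 1) * (\<Sum>i\<in>I. \<bar>x i\<bar> powr p)"
proof (cases "p = 1 \<or> I = {}")
  case True
  then show ?thesis
  proof
    assume "p = 1"
    then show ?thesis
      by (cases "card I = 0") (use assms in \<open>auto intro: sum_abs\<close>)
  qed auto
next
  case False
  then have p: "p > 1"
    using assms by auto
  define q where "q = p / (p - 1)"
  have q: "q > 1" "1 / p + 1 / q = 1"
    using conjugate_real[OF p] unfolding q_def by auto
  have "\<bar>\<Sum>i\<in>I. x i\<bar> \<le> lp_sum q I (\<lambda>_. 1) * lp_sum p I x"
    using holder_sum[OF assms(1) p q, of "\<lambda>_. 1" x] by simp
  then have "\<bar>\<Sum>i\<in>I. x i\<bar> powr p \<le> (lp_sum q I (\<lambda>_. 1) * lp_sum p I x) powr p"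
    using p by (intro powr_mono2) auto
  also have "\<dots> = real (card I) powr (p - 1) * (\<Sum>i\<in>I. \<bar>x i\<bar> powr p)"
    using p q by (simp add: powr_mult lp_sum_powr) (simp add: lp_sum_def powr_powr q_def)
  finally show ?thesis .
qed

section \<open>Sign averages\<close>

text \<open>A choice of signs is encoded by the set on which it is +1, so that averages over signs
  become sums over \<open>Pow I\<close> and can be treated by induction on \<open>I\<close>.\<close>

definition sign_of :: "'i set \<Rightarrow> 'i \<Rightarrow> real" where
  "sign_of S i = (if i \<in> S then 1 else - 1)"

lemma abs_sign_of [simp]: "\<bar>sign_of S i\<bar> = 1"
  by (simp add: sign_of_def)

lemma sum_Pow_insert:
  fixes g :: "'i set \<Rightarrow> real"
  assumes "finite I" "i \<notin> I"
  shows "(\<Sum>S\<in>Pow (insert i I). g S) = (\<Sum>S\<in>Pow I. g S + g (insert i S))"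
proof -
  have inj: "inj_on (insert i) (Pow I)"
    using assms by (auto simp: inj_on_def)
  have "(\<Sum>S\<in>Pow (insert i I). g S) = (\<Sum>S\<in>Pow I. g S) + (\<Sum>S\<in>insert i ` Pow I. g S)"
    unfolding Pow_insert using assms by (intro sum.union_disjoint) auto
  then show ?thesis
    using inj by (simp add: sum.reindex sum.distrib)
qed

lemma sign_of_sum_insert:
  assumes "finite I" "i \<notin> I" "S \<in> Pow I"
  shows "(\<Sum>j\<in>insert i I. sign_of S j * b j) = - b i + (\<Sum>j\<in>I. sign_of S j * b j)"
    and "(\<Sum>j\<in>insert i I. sign_of (insert i S) j * b j) = b i + (\<Sum>j\<in>I. sign_of S j * b j)"
proof -
  have "(\<Sum>j\<in>I. sign_of (insert i S) j * b j) = (\<Sum>j\<in>I. sign_of S j * b j)"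
    using assms by (intro sum.cong) (auto simp: sign_of_def)
  then show "(\<Sum>j\<in>insert i I. sign_of (insert i S) j * b j) = b i + (\<Sum>j\<in>I. sign_of S j * b j)"
    using assms by (simp add: sign_of_def)
  show "(\<Sum>j\<in>insert i I. sign_of S j * b j) = - b i + (\<Sum>j\<in>I. sign_of S j * b j)"
    using assms by (auto simp: sign_of_def)
qed

text \<open>Orthogonality of the signs; adding one index to \<open>I\<close> is the parallelogram
  law.\<close>

lemma sum_signs_square:
  assumes "finite I"
  shows "(\<Sum>S\<in>Pow I. (\<Sum>i\<in>I. sign_of S i * b i)\<^sup>2) = 2 ^ card I * (\<Sum>i\<in>I. (b i)\<^sup>2)"
  using assms
proof (induction I rule: finite_induct)
  case (insert i I)
  have "(\<Sum>S\<in>Pow (insert i I). (\<Sum>j\<in>insert i I. sign_of S j * b j)\<^sup>2)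
     = (\<Sum>S\<in>Pow I. (- b i + (\<Sum>j\<in>I. sign_of S j * b j))\<^sup>2 + (b i + (\<Sum>j\<in>I. sign_of S j * b j))\<^sup>2)"
    by (simp only: sum_Pow_insert[OF insert.hyps])
      (intro sum.cong refl, simp only: sign_of_sum_insert[OF insert.hyps])
  also have "\<dots> = (\<Sum>S\<in>Pow I. 2 * (b i)\<^sup>2 + 2 * (\<Sum>j\<in>I. sign_of S j * b j)\<^sup>2)"
    by (intro sum.cong refl) (simp add: power2_eq_square algebra_simps)
  also have "\<dots> = 2 ^ card I * (2 * (b i)\<^sup>2) + 2 * (2 ^ card I * (\<Sum>i\<in>I. (b i)\<^sup>2))"
    by (simp add: sum.distrib card_Pow insert.hyps sum_distrib_left[symmetric] insert.IH)
  finally show ?case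
    using insert.hyps by (simp add: algebra_simps)
qed simp

lemma power2_powr_half:
  fixes v p :: real
  shows "(v\<^sup>2) powr (p / 2) = \<bar>v\<bar> powr p"
proof (cases "v = 0")
  case False
  then have "\<bar>v\<bar> powr p = (\<bar>v\<bar> powr 2) powr (p / 2)"
    by (simp only: powr_powr) simp
  with False show ?thesis
    by simp
qed simp

lemma sum_powr_le_powr_sum_squares:
  fixes b :: "'i \<Rightarrow> real"
  assumes "finite I" "p \<ge> 2"
  shows "(\<Sum>i\<in>I. \<bar>b i\<bar> powr p) \<le> (\<Sum>i\<in>I. (b i)\<^sup>2) powr (p / 2)"
proof -
  define s where "s = (\<Sum>i\<in>I. (b i)\<^sup>2)"
  have s: "s \<ge> 0"
    by (simp add: s_def sum_nonneg)
  have "\<bar>b i\<bar> powr p \<le> (b i)\<^sup>2 * s powr (p / 2 - 1)" if "i \<in> I" for i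
  proof (cases "b i = 0")
    case False
    have "\<bar>b i\<bar> powr p = ((b i)\<^sup>2) powr (p / 2)"
      by (rule power2_powr_half[symmetric])
    also have "((b i)\<^sup>2) powr (p / 2) = (b i)\<^sup>2 * (b i)\<^sup>2 powr (p / 2 - 1)"
      using False by (simp add: powr_mult_base)
    also have "\<dots> \<le> (b i)\<^sup>2 * s powr (p / 2 - 1)"
      using assms that unfolding s_def
      by (intro mult_left_mono powr_mono2 member_le_sum) auto
    finally show ?thesis .
  qed auto
  then have "(\<Sum>i\<in>I. \<bar>b i\<bar> powr p) \<le> (\<Sum>i\<in>I. (b i)\<^sup>2 * s powr (p / 2 - 1))"
    by (rule sum_mono)
  also have "\<dots> = s * s powr (p / 2 - 1)"
    unfolding s_def by (simp add: sum_distrib_right)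
  also have "\<dots> = s powr (p / 2)"
    using s by (simp add: powr_mult_base)
  finally show ?thesis
    unfolding s_def .
qed

text \<open>The elementary half of Khinchine's inequality: for p \<ge> 2, Jensen with exponent p/2
  compares the p-th moment with the second one, and the l_2 norm dominates the l_p norm. It says
  that the real line has cotype p with constant one, and it enters the case q = infinity.\<close>

lemma sum_powr_le_sum_signs:
  fixes b :: "'i \<Rightarrow> real"
  assumes "finite I" "p \<ge> 2"
  shows "2 ^ card I * (\<Sum>i\<in>I. \<bar>b i\<bar> powr p)
    \<le> (\<Sum>S\<in>Pow I. \<bar>\<Sum>i\<in>I. sign_of S i * b i\<bar> powr p)"
proof -
  define X where "X S = (\<Sum>i\<in>I. sign_of S i * b i)" for S
  define N :: real where "N = 2 ^ card I"
  have N: "N > 0" "real (card (Pow I)) = N"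
    using assms by (auto simp: N_def card_Pow)
  have sq: "\<bar>(X S)\<^sup>2\<bar> powr (p / 2) = \<bar>X S\<bar> powr p" for S
    by (simp add: power2_powr_half)
  have "\<bar>\<Sum>S\<in>Pow I. (X S)\<^sup>2\<bar> powr (p / 2)
      \<le> real (card (Pow I)) powr (p / 2 - 1) * (\<Sum>S\<in>Pow I. \<bar>(X S)\<^sup>2\<bar> powr (p / 2))"
    using assms by (intro jensen_powr) auto
  then have "(N * (\<Sum>i\<in>I. (b i)\<^sup>2)) powr (p / 2) \<le> N powr (p / 2 - 1) * (\<Sum>S\<in>Pow I. \<bar>X S\<bar> powr p)"
    unfolding sq N using sum_signs_square[OF assms(1), of b]
    by (simp add: X_def N_def sum_nonneg)
  then have "N powr (p / 2 - 1) * (N * (\<Sum>i\<in>I. (b i)\<^sup>2) powr (p / 2))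
      \<le> N powr (p / 2 - 1) * (\<Sum>S\<in>Pow I. \<bar>X S\<bar> powr p)"
    using N by (simp add: powr_mult sum_nonneg powr_diff)
  then have "N * (\<Sum>i\<in>I. (b i)\<^sup>2) powr (p / 2) \<le> (\<Sum>S\<in>Pow I. \<bar>X S\<bar> powr p)"
    using N by simp
  moreover have "N * (\<Sum>i\<in>I. \<bar>b i\<bar> powr p) \<le> N * (\<Sum>i\<in>I. (b i)\<^sup>2) powr (p / 2)"
    using N sum_powr_le_powr_sum_squares[OF assms, of b] by (intro mult_left_mono) auto
  ultimately show ?thesis
    unfolding N_def X_def by linarith
qed

section \<open>Exponential moments and the upper half of Khinchine's inequality\<close>

lemma sum_signs_exp:
  assumes "finite I"
  shows "(\<Sum>S\<in>Pow I. exp (\<Sum>i\<in>I. sign_of S i * b i)) = (\<Prod>i\<in>I. exp (b i) + exp (- b i :: real))"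
  using assms
proof (induction I rule: finite_induct)
  case (insert i I)
  have "(\<Sum>S\<in>Pow (insert i I). exp (\<Sum>j\<in>insert i I. sign_of S j * b j))
     = (\<Sum>S\<in>Pow I. exp (- b i + (\<Sum>j\<in>I. sign_of S j * b j)) + exp (b i + (\<Sum>j\<in>I. sign_of S j * b j)))"
    by (simp only: sum_Pow_insert[OF insert.hyps])
      (intro sum.cong refl, simp only: sign_of_sum_insert[OF insert.hyps])
  also have "\<dots> = (\<Sum>S\<in>Pow I. (exp (b i) + exp (- b i)) * exp (\<Sum>j\<in>I. sign_of S j * b j))"
    by (intro sum.cong refl) (simp only: exp_add distrib_right add.commute)
  finally show ?case
    using insert.hyps by (simp add: sum_distrib_left[symmetric] insert.IH)
qed simp

text \<open>The subgaussian estimate for a single sign, \<open>cosh x \<le> exp (x^2)\<close>. The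
  interval [-1, 1] contains every coefficient of a vector of l_2 norm one, which is where the
  estimate is applied.\<close>

lemma exp_add_exp_minus_le:
  fixes x :: real
  assumes "\<bar>x\<bar> \<le> 1"
  shows "exp x + exp (- x) \<le> 2 * exp (x\<^sup>2)"
proof -
  have *: "exp y + exp (- y) \<le> 2 * exp (y\<^sup>2)" if "0 \<le> y" "y \<le> 1" for y :: real
  proof -
    have 1: "exp y \<le> 1 + y + y\<^sup>2"
      using that by (rule exp_bound)
    have "(1 + y) * exp (- y) \<le> exp y * exp (- y)"
      using exp_ge_add_one_self[of y] by (intro mult_right_mono) auto
    then have "(1 + y) * exp (- y) \<le> 1"
      by (simp add: exp_minus)
    \<comment> \<open>The product equals 1 + y^3; cancelling 1 + y gives the quadratic bound for
      \<open>exp (- y)\<close>.\<close>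
    also have "1 \<le> (1 + y) * (1 - y + y\<^sup>2)"
      using that by (simp add: algebra_simps power2_eq_square)
    finally have 2: "exp (- y) \<le> 1 - y + y\<^sup>2"
      using that by (simp add: mult_le_cancel_left)
    have 3: "1 + y\<^sup>2 \<le> exp (y\<^sup>2)"
      by (rule exp_ge_add_one_self)
    show ?thesis
      using 1 2 3 by linarith
  qed
  show ?thesis
    using *[of x] *[of "- x"] assms by (cases "x \<ge> 0") auto
qed

lemma abs_powr_le_exp:
  fixes x p :: real
  assumes "p > 0"
  shows "\<bar>x\<bar> powr p \<le> p powr p * (exp x + exp (- x))"
proof -
  have "\<bar>x\<bar> / p \<le> exp (\<bar>x\<bar> / p)"
    using exp_ge_add_one_self[of "\<bar>x\<bar> / p"] by linarith
  then have "(\<bar>x\<bar> / p) powr p \<le> exp (\<bar>x\<bar> / p) powr p"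
    using assms by (intro powr_mono2) auto
  also have "\<dots> = exp \<bar>x\<bar>"
    using assms by (simp add: powr_def)
  also have "\<dots> \<le> exp x + exp (- x)"
    by (cases "x \<ge> 0") auto
  finally have "p powr p * (\<bar>x\<bar> / p) powr p \<le> p powr p * (exp x + exp (- x))"
    by (intro mult_left_mono) auto
  then show ?thesis
    using assms by (simp add: powr_divide)
qed

text \<open>The moments are compared with the moment generating function.\<close>

lemma khinchine_upper:
  fixes p :: real
  assumes "p > 0"
  obtains C where "C > 0"
    "\<And>(I :: 'i set) b. finite I \<Longrightarrow>
      (\<Sum>S\<in>Pow I. \<bar>\<Sum>i\<in>I. sign_of S i * b i\<bar> powr p) \<le> 2 ^ card I * (C * L2_set b I) powr p"
proof -
  \<comment> \<open>For coefficients of l_2 norm one: p^p comes from comparing the power with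
    exponentials, the 2 from the two signs of the exponent, and \<open>exp 1\<close> is the product
    of the bounds \<open>exp ((b i)^2)\<close>.\<close>
  define D where "D = 2 * exp 1 * p powr p"
  have D: "D > 0"
    using assms by (simp add: D_def)
  define C where "C = D powr (1 / p)"
  have C: "C > 0" "C powr p = D"
    using D assms by (auto simp: C_def powr_powr)
  have unit: "(\<Sum>S\<in>Pow I. \<bar>\<Sum>i\<in>I. sign_of S i * b i\<bar> powr p) \<le> 2 ^ card I * D"
    if I: "finite I" and b: "(\<Sum>i\<in>I. (b i)\<^sup>2) = 1" for I :: "'i set" and b
  proof -
    have b1: "\<bar>b i\<bar> \<le> 1" if "i \<in> I" for i
      using member_le_sum[of i I "\<lambda>i. (b i)\<^sup>2"] I b that by (simp add: abs_square_le_1)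
    have prod: "(\<Prod>i\<in>I. exp (b i) + exp (- b i)) \<le> 2 ^ card I * exp 1"
    proof -
      have "(\<Prod>i\<in>I. exp (b i) + exp (- b i)) \<le> (\<Prod>i\<in>I. 2 * exp ((b i)\<^sup>2))"
        using b1 by (intro prod_mono conjI exp_add_exp_minus_le) (auto intro: add_nonneg_nonneg)
      also have "\<dots> = 2 ^ card I * exp 1"
        using I b by (simp add: prod.distrib exp_sum[symmetric])
      finally show ?thesis .
    qed
    have "(\<Sum>S\<in>Pow I. \<bar>\<Sum>i\<in>I. sign_of S i * b i\<bar> powr p)
      \<le> (\<Sum>S\<in>Pow I. p powr p * (exp (\<Sum>i\<in>I. sign_of S i * b i) + exp (\<Sum>i\<in>I. sign_of S i * - b i)))"
      using abs_powr_le_exp[OF assms] by (intro sum_mono) (auto simp: sum_negf)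
    also have "\<dots> = p powr p * (2 * (\<Prod>i\<in>I. exp (b i) + exp (- b i)))"
      using sum_signs_exp[OF I, of b] sum_signs_exp[OF I, of "\<lambda>i. - b i"]
      by (simp only: sum_distrib_left[symmetric] sum.distrib) (simp add: add.commute)
    also have "\<dots> \<le> p powr p * (2 * (2 ^ card I * exp 1))"
      using prod by (intro mult_left_mono) auto
    finally show ?thesis
      by (simp add: D_def mult_ac)
  qed
  have "(\<Sum>S\<in>Pow I. \<bar>\<Sum>i\<in>I. sign_of S i * b i\<bar> powr p) \<le> 2 ^ card I * (C * L2_set b I) powr p"
    if I: "finite I" for I :: "'i set" and b
  proof (cases "L2_set b I = 0")
    case True
    then have "\<forall>i\<in>I. b i = 0"
      using I by (simp add: L2_set_eq_0_iff)
    then show ?thesis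
      using True by simp
  next
    case False
    define s where "s = L2_set b I"
    have s: "s > 0"
      using False L2_set_nonneg[of b I] unfolding s_def by linarith
    have "(\<Sum>i\<in>I. (b i / s)\<^sup>2) = (\<Sum>i\<in>I. (b i)\<^sup>2) / s\<^sup>2"
      by (simp add: power_divide sum_divide_distrib)
    also have "(\<Sum>i\<in>I. (b i)\<^sup>2) = s\<^sup>2"
      by (simp add: s_def L2_set_def sum_nonneg)
    finally have "(\<Sum>i\<in>I. (b i / s)\<^sup>2) = 1"
      using s by simp
    note unit[OF I this]
    moreover have "\<bar>\<Sum>i\<in>I. sign_of S i * (b i / s)\<bar> powr p = \<bar>\<Sum>i\<in>I. sign_of S i * b i\<bar> powr p / s powr p" for S
      using s by (simp add: sum_divide_distrib[symmetric] powr_divide)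
    ultimately have "(\<Sum>S\<in>Pow I. \<bar>\<Sum>i\<in>I. sign_of S i * b i\<bar> powr p) / s powr p \<le> 2 ^ card I * D"
      by (simp add: sum_divide_distrib)
    then show ?thesis
      using s C by (simp add: powr_mult divide_simps mult_ac s_def)
  qed
  with C(1) show ?thesis
    using that by blast
qed

section \<open>Hahn--Banach extensions and norming functionals\<close>

lemma dual_UNIV: "dual UNIV = {\<phi> :: 'a::real_normed_vector \<Rightarrow> real. bounded_linear \<phi>}"
proof (intro set_eqI iffI)
  fix \<phi> :: "'a \<Rightarrow> real"
  assume "\<phi> \<in> dual UNIV"
  then obtain K where "\<And>x y. \<phi> (x + y) = \<phi> x + \<phi> y" "\<And>c x. \<phi> (c *\<^sub>R x) = c * \<phi> x"
    "\<And>v. \<bar>\<phi> v\<bar> \<le> K * norm v"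
    by (auto simp: dual_def bounded_op_on_def)
  then have "bounded_linear \<phi>"
    by (intro bounded_linear_intro[where K = K]) (auto simp: mult.commute)
  then show "\<phi> \<in> {\<phi>. bounded_linear \<phi>}"
    by simp
next
  fix \<phi> :: "'a \<Rightarrow> real"
  assume "\<phi> \<in> {\<phi>. bounded_linear \<phi>}"
  then interpret bounded_linear \<phi>
    by simp
  obtain K where "\<And>x. norm (\<phi> x) \<le> norm x * K"
    using bounded by blast
  then show "\<phi> \<in> dual UNIV"
    by (auto simp: dual_def bounded_op_on_def add scaleR mult.commute intro!: exI[of _ K])
qed

text \<open>
  A linear functional on a subspace is given by its graph, so that extending it and checking that
  it is well defined are the same thing: the bound on the graph forces it to be single valued.
\<close>

lemma hahn_banach_graph:
  fixes G :: "('a::real_normed_vector \<times> real) set"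
  assumes "subspace G" "K \<ge> 0" "\<And>x c. (x, c) \<in> G \<Longrightarrow> c \<le> K * norm x"
  obtains f where "bounded_linear f" "\<And>x c. (x, c) \<in> G \<Longrightarrow> f x = c" "\<And>x. \<bar>f x\<bar> \<le> K * norm x"
proof -
  define \<A> where "\<A> = {H. G \<subseteq> H \<and> subspace H \<and> (\<forall>x c. (x, c) \<in> H \<longrightarrow> c \<le> K * norm x)}"
  have "G \<in> \<A>"
    using assms by (auto simp: \<A>_def)
  have "\<exists>M\<in>\<A>. \<forall>X\<in>\<A>. M \<subseteq> X \<longrightarrow> X = M"
  proof (rule subset_Zorn_nonempty)
    fix \<C>
    assume ne: "\<C> \<noteq> {}" and ch: "subset.chain \<A> \<C>"
    then have sub: "\<C> \<subseteq> \<A>" and cmp: "\<And>X Y. X \<in> \<C> \<Longrightarrow> Y \<in> \<C> \<Longrightarrow> X \<subseteq> Y \<or> Y \<subseteq> X"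
      by (auto simp: subset_chain_def)
    have "subspace (\<Union>\<C>)"
    proof (rule subspaceI)
      show "0 \<in> \<Union>\<C>"
        using ne sub by (fastforce simp: \<A>_def dest: subspace_0)
      fix x y c
      assume x: "x \<in> \<Union>\<C>"
      then show "c *\<^sub>R x \<in> \<Union>\<C>"
        using sub by (auto simp: \<A>_def intro: subspace_scale)
      assume "y \<in> \<Union>\<C>"
      with x obtain X Y where XY: "X \<in> \<C>" "Y \<in> \<C>" "x \<in> X" "y \<in> Y"
        by blast
      then obtain Z where "Z \<in> \<C>" "x \<in> Z" "y \<in> Z"
        using cmp[of X Y] by blast
      then show "x + y \<in> \<Union>\<C>"
        using sub by (auto simp: \<A>_def intro: subspace_add)
    qed
    moreover obtain X where "X \<in> \<C>"
      using ne by blast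
    moreover have "G \<subseteq> \<Union>\<C>"
      using \<open>X \<in> \<C>\<close> sub unfolding \<A>_def by blast
    moreover have "c \<le> K * norm x" if "(x, c) \<in> \<Union>\<C>" for x c
      using that sub unfolding \<A>_def by blast
    ultimately show "\<Union>\<C> \<in> \<A>"
      unfolding \<A>_def by blast
  qed (use \<open>G \<in> \<A>\<close> in blast)
  then obtain M where M: "M \<in> \<A>" and max: "\<And>X. X \<in> \<A> \<Longrightarrow> M \<subseteq> X \<Longrightarrow> X = M"
    by blast
  have sub: "subspace M" and bd: "\<And>x c. (x, c) \<in> M \<Longrightarrow> c \<le> K * norm x" and GM: "G \<subseteq> M"
    using M by (auto simp: \<A>_def)
  have total: "\<exists>c. (y, c) \<in> M" for y
  proof -
    \<comment> \<open>The value to be assigned to \<open>y\<close>. Each term is a lower bound that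
      this value must respect, and \<open>key\<close> puts all of them below all upper bounds. No
      distinction is made as to whether \<open>y\<close> already lies in the domain.\<close>
    define r where "r = (SUP (x, c)\<in>M. c - K * norm (x - y))"
    have key: "c - K * norm (x - y) \<le> K * norm (x' + y) - c'" if "(x, c) \<in> M" "(x', c') \<in> M" for x c x' c'
    proof -
      have "c + c' \<le> K * norm (x + x')"
        using subspace_add[OF sub that] bd by simp
      also have "\<dots> \<le> K * (norm (x - y) + norm (x' + y))"
        using norm_triangle_ineq[of "x - y" "x' + y"] assms(2) by (intro mult_left_mono) auto
      finally show ?thesis
        by (simp add: algebra_simps)
    qed
    have "(0, 0) \<in> M"
      using subspace_0[OF sub] by (simp add: zero_prod_def)
    have bdd: "bdd_above ((\<lambda>(x, c). c - K * norm (x - y)) ` M)"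
      using key[OF _ \<open>(0, 0) \<in> M\<close>] by (auto simp: bdd_above_def intro!: exI[of _ "K * norm y"])
    have lo: "c - K * norm (x - y) \<le> r" if "(x, c) \<in> M" for x c
      unfolding r_def using cSUP_upper[OF that bdd] by simp
    have hi: "r \<le> K * norm (x' + y) - c'" if "(x', c') \<in> M" for x' c'
      unfolding r_def using \<open>(0, 0) \<in> M\<close> key[OF _ that] by (intro cSUP_least) auto
    define M' where "M' = {m + s |m s. m \<in> M \<and> s \<in> span {(y, r)}}"
    have "subspace M'"
      unfolding M'_def by (intro subspace_sums sub subspace_span)
    moreover have "M \<subseteq> M'"
    proof
      fix m assume "m \<in> M"
      then have "m + 0 \<in> M'"
        unfolding M'_def by (intro CollectI exI[of _ m] exI[of _ 0] conjI) (auto simp: span_0)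
      then show "m \<in> M'" by simp
    qed
    moreover have "d \<le> K * norm z" if zd: "(z, d) \<in> M'" for z d
    proof -
      obtain x c t where xc: "(x, c) \<in> M" "z = x + t *\<^sub>R y" "d = c + t * r"
      proof -
        obtain m s where ms: "m \<in> M" "s \<in> span {(y, r)}" "(z, d) = m + s"
          using zd unfolding M'_def by blast
        then obtain t where "s = t *\<^sub>R (y, r)"
          by (auto simp: span_singleton)
        with ms show ?thesis
          by (intro that[of "fst m" "snd m" t]) (auto simp: prod_eq_iff)
      qed
      show ?thesis
      proof (cases "t = 0")
        case True
        then show ?thesis using xc bd by simp
      next
        case False
        define e where "e = sgn t"
        have e: "t = \<bar>t\<bar> * e" "e = 1 \<or> e = - 1"
          using False by (auto simp: e_def sgn_if)
        have "((1 / \<bar>t\<bar>) *\<^sub>R x, c / \<bar>t\<bar>) \<in> M"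
          using subspace_scale[OF sub xc(1), of "1 / \<bar>t\<bar>"] by simp
        then have "c / \<bar>t\<bar> + e * r \<le> K * norm ((1 / \<bar>t\<bar>) *\<^sub>R x + e *\<^sub>R y)"
          using lo hi e(2) by force
        then have "\<bar>t\<bar> * (c / \<bar>t\<bar> + e * r) \<le> \<bar>t\<bar> * (K * norm ((1 / \<bar>t\<bar>) *\<^sub>R x + e *\<^sub>R y))"
          by (rule mult_left_mono) simp
        also have "\<dots> = K * norm (\<bar>t\<bar> *\<^sub>R ((1 / \<bar>t\<bar>) *\<^sub>R x + e *\<^sub>R y))"
          by (simp only: norm_scaleR) simp
        also have "\<bar>t\<bar> *\<^sub>R ((1 / \<bar>t\<bar>) *\<^sub>R x + e *\<^sub>R y) = z"
          using False xc e(1) by (simp add: scaleR_add_right)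
        also have "\<bar>t\<bar> * (c / \<bar>t\<bar> + e * r) = d"
          using False xc e(1) by (simp add: distrib_left mult.assoc[symmetric])
        finally show ?thesis .
      qed
    qed
    ultimately have "M' = M"
      using GM by (intro max) (auto simp: \<A>_def)
    moreover have "(0, 0) + (y, r) \<in> M'"
      unfolding M'_def using \<open>(0, 0) \<in> M\<close> by (blast intro: span_base)
    ultimately show ?thesis
      by auto
  qed
  have uniq: "c = d" if "(x, c) \<in> M" "(x, d) \<in> M" for x c d
    using subspace_diff[OF sub that] subspace_diff[OF sub that(2,1)] bd[of 0 "c - d"] bd[of 0 "d - c"] by simp
  define f where "f x = (THE c. (x, c) \<in> M)" for x
  have f: "(x, f x) \<in> M" for x
    unfolding f_def using total uniq by (metis theI')
  have feq: "f x = c" if "(x, c) \<in> M" for x c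
    using uniq f that by blast
  have add: "f (x + y) = f x + f y" for x y
    using subspace_add[OF sub f[of x] f[of y]] by (intro feq) simp
  have scale: "f (c *\<^sub>R x) = c *\<^sub>R f x" for c x
    using subspace_scale[OF sub f[of x], of c] by (intro feq) simp
  have le: "\<bar>f x\<bar> \<le> K * norm x" for x
    using bd[OF f[of x]] bd[OF f[of "- x"]] scale[of "- 1" x] by (simp add: abs_le_iff)
  show ?thesis
  proof
    show "bounded_linear f"
      using le add scale by (intro bounded_linear_intro[where K = K]) (auto simp: mult.commute)
    show "f x = c" if "(x, c) \<in> G" for x c
      using that GM feq by blast
    show "\<bar>f x\<bar> \<le> K * norm x" for x
      by (rule le)
  qed
qed

lemma norming_functional:
  fixes x :: "'a::real_normed_vector"
  obtains f where "bounded_linear f" "f x = norm x" "\<And>y. \<bar>f y\<bar> \<le> norm y"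
proof -
  have "\<bar>t\<bar> * norm x \<ge> t * norm x" for t :: real
    by (intro mult_right_mono) auto
  then have "c \<le> 1 * norm z" if "(z, c) \<in> span {(x, norm x)}" for z c
    using that by (auto simp: span_singleton)
  then obtain f where "bounded_linear f" "\<And>z c. (z, c) \<in> span {(x, norm x)} \<Longrightarrow> f z = c"
    "\<And>z. \<bar>f z\<bar> \<le> 1 * norm z"
    using hahn_banach_graph[OF subspace_span, of 1 "{(x, norm x)}"] by (metis zero_le_one)
  then show ?thesis
    using that[of f] by (auto intro: span_base)
qed

text \<open>The two claims need each other in the induction: closedness of the smaller span makes
  its distance d from b positive, which bounds the coefficient of b by r / d in the ball of radius
  r; compactness of the balls then gives closedness of the larger span.\<close>

lemma finite_dimensional_compact:
  fixes B :: "'a::real_normed_vector set"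
  assumes "finite B"
  shows "closed (span B) \<and> (\<forall>r. compact (span B \<inter> cball 0 r))"
  using assms
proof (induction B rule: finite_induct)
  case empty
  then show ?case
    by (auto intro: finite_imp_compact)
next
  case (insert b B)
  show ?case
  proof (cases "b \<in> span B")
    case True
    then show ?thesis
      using insert.IH by (simp add: span_redundant)
  next
    case False
    define d where "d = infdist b (span B)"
    have d: "d > 0"
      unfolding d_def using False insert.IH span_0[of B]
      by (intro infdist_pos_not_in_closed) auto
    have comp: "compact (span (insert b B) \<inter> cball 0 r)" for r
    proof -
      define R where "R = r + r / d * norm b"
      define P where "P = (\<lambda>(e, c). e + c *\<^sub>R b) ` ((span B \<inter> cball 0 R) \<times> cball 0 (r / d))"
      have "compact P"
        unfolding P_def using insert.IH
        by (intro compact_continuous_image compact_Times)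
          (auto simp: case_prod_beta intro!: continuous_intros)
      have "span (insert b B) \<inter> cball 0 r = P \<inter> cball 0 r"
      proof (intro equalityI subsetI)
        fix u assume u: "u \<in> span (insert b B) \<inter> cball 0 r"
        then obtain c where c: "u - c *\<^sub>R b \<in> span B"
          by (auto simp: span_insert)
        define e where "e = u - c *\<^sub>R b"
        have "\<bar>c\<bar> * d \<le> norm u"
        proof (cases "c = 0")
          case False
          have "(- 1 / c) *\<^sub>R e \<in> span B"
            using c unfolding e_def by (intro span_scale)
          then have "d \<le> dist b ((- 1 / c) *\<^sub>R e)"
            unfolding d_def by (rule infdist_le)
          then have "\<bar>c\<bar> * d \<le> \<bar>c\<bar> * norm (b + (1 / c) *\<^sub>R e)"
            by (intro mult_left_mono) (auto simp: dist_norm)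
          also have "\<dots> = norm (c *\<^sub>R (b + (1 / c) *\<^sub>R e))"
            by simp
          also have "c *\<^sub>R (b + (1 / c) *\<^sub>R e) = u"
            using False by (simp add: scaleR_add_right e_def)
          finally show ?thesis .
        qed auto
        then have cr: "\<bar>c\<bar> \<le> r / d"
          using u d by (simp add: pos_le_divide_eq)
        have "norm e \<le> norm u + \<bar>c\<bar> * norm b"
          unfolding e_def using norm_triangle_ineq4[of u "c *\<^sub>R b"] by simp
        also have "\<dots> \<le> R"
          unfolding R_def using u cr by (intro add_mono mult_right_mono) auto
        finally have "(\<lambda>(e, c). e + c *\<^sub>R b) (e, c) \<in> P"
          unfolding P_def using c cr by (intro imageI) (auto simp: e_def)
        then show "u \<in> P \<inter> cball 0 r"
          using u by (simp add: e_def)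
      next
        fix u assume u: "u \<in> P \<inter> cball 0 r"
        then obtain e c where "e \<in> span B" "u = e + c *\<^sub>R b"
          unfolding P_def by auto
        then have "u \<in> span (insert b B)"
          by (auto simp: span_insert intro!: exI[of _ c])
        with u show "u \<in> span (insert b B) \<inter> cball 0 r"
          by blast
      qed
      then show ?thesis
        using \<open>compact P\<close> by (simp add: compact_Int_closed)
    qed
    moreover have "closed (span (insert b B))"
      unfolding closed_sequential_limits
    proof (intro allI impI)
      fix x l
      assume x: "(\<forall>n. x n \<in> span (insert b B)) \<and> x \<longlonglongrightarrow> l"
      then have "Bseq x"
        by (meson convergentI convergent_imp_Bseq)
      then obtain r where r: "\<And>n. norm (x n) \<le> r"
        by (rule BseqE) blast
      have "closed (span (insert b B) \<inter> cball 0 r)"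
        by (intro compact_imp_closed comp)
      then have "l \<in> span (insert b B) \<inter> cball 0 r"
        by (rule closed_sequentially[of _ x]) (use x r in auto)
      then show "l \<in> span (insert b B)"
        by blast
    qed
    ultimately show ?thesis
      by blast
  qed
qed

text \<open>
  In Mazur's construction of a basic sequence, all later vectors are chosen in the kernel of \<open>\<Phi>\<close>.
\<close>

lemma finite_norming_set:
  fixes B :: "'a::real_normed_vector set"
  assumes "finite B"
  obtains \<Phi> where "finite \<Phi>" "\<Phi> \<subseteq> Collect bounded_linear"
    "\<And>u z. u \<in> span B \<Longrightarrow> (\<And>\<phi>. \<phi> \<in> \<Phi> \<Longrightarrow> \<phi> z = (0::real)) \<Longrightarrow> norm u \<le> 2 * norm (u + z)"
proof -
  define K where "K = span B \<inter> sphere 0 1"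
  have "compact K"
  proof -
    have "compact (span B \<inter> cball 0 1)"
      using finite_dimensional_compact[OF assms] by blast
    then have "compact (span B \<inter> cball 0 1 - ball 0 1)"
      by (rule compact_diff) (rule open_ball)
    moreover have "K = span B \<inter> cball 0 1 - ball 0 1"
      by (auto simp: K_def)
    ultimately show ?thesis
      by simp
  qed
  \<comment> \<open>A 1/4-net suffices: the functional norming the net point next to a unit vector v
    is at least 3/4 at v, hence at least 1/2, which is the source of the factor 2.\<close>
  moreover have "K \<subseteq> (\<Union>x\<in>K. ball x (1 / 4))"
    by (auto intro!: bexI)
  ultimately obtain k where k: "k \<subseteq> K" "finite k" "K \<subseteq> (\<Union>x\<in>k. ball x (1 / 4))"
    using compactE_image[of K K "\<lambda>x. ball x (1 / 4)"] open_ball by metis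
  have "\<exists>f. bounded_linear f \<and> f x = norm x \<and> (\<forall>y. \<bar>f y\<bar> \<le> norm y)" for x :: 'a
    by (metis norming_functional)
  then obtain F where F: "\<And>x :: 'a. bounded_linear (F x)" "\<And>x. F x x = norm x" "\<And>x y. \<bar>F x y\<bar> \<le> norm y"
    by metis
  show ?thesis
  proof
    show "finite (F ` k)" "F ` k \<subseteq> Collect bounded_linear"
      using k F by auto
    fix u z
    assume u: "u \<in> span B" and z: "\<And>\<phi>. \<phi> \<in> F ` k \<Longrightarrow> \<phi> z = 0"
    show "norm u \<le> 2 * norm (u + z)"
    proof (cases "u = 0")
      case False
      define v where "v = (1 / norm u) *\<^sub>R u"
      have "v \<in> K"
        using u False by (simp add: K_def v_def span_scale)
      then obtain x where x: "x \<in> k" "dist x v < 1 / 4"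
        using k by force
      then have "norm x = 1"
        using k by (auto simp: K_def)
      interpret Fx: bounded_linear "F x"
        by (rule F)
      have "F x (x - v) \<le> 1 / 4"
        using F(3)[of x "x - v"] x by (simp add: dist_norm)
      then have "F x v \<ge> 1 / 2"
        using F(2)[of x] \<open>norm x = 1\<close> by (simp add: Fx.diff)
      then have "norm u / 2 \<le> F x u"
        using False by (simp add: v_def Fx.scaleR field_simps)
      also have "\<dots> = F x (u + z)"
        using z x by (simp add: Fx.add)
      also have "\<dots> \<le> norm (u + z)"
        using F(3)[of x "u + z"] by linarith
      finally show ?thesis
        by simp
    qed simp
  qed
qed

section \<open>Copies of \<open>\<ell>\<^sub>q\<^sup>n\<close>\<close>

lemma exponent_cases:
  assumes "q \<in> {\<infinity>} \<union> {1..<2 :: ereal}"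
  obtains "q = \<infinity>" | r where "q = ereal r" "1 \<le> r" "r < 2"
proof (cases q)
  case (real r)
  then have "ereal 1 \<le> ereal r" "ereal r < ereal 2"
    using assms by (auto simp: one_ereal_def)
  then show ?thesis
    using real that by auto
qed (use assms that in auto)

lemma lq_norm_ereal: "lq_norm (ereal r) n a = lp_sum r {..<n} a"
  by (simp add: lq_norm_def lp_sum_def)

lemma lq_norm_infinity_le_iff: "lq_norm \<infinity> n a \<le> B \<longleftrightarrow> 0 \<le> B \<and> (\<forall>i<n. \<bar>a i\<bar> \<le> B)"
  unfolding lq_norm_def by (auto simp: Max_le_iff)

lemma lq_norm_infinity_eqI:
  assumes "\<And>B. B \<ge> 0 \<Longrightarrow> (\<forall>i<m. \<bar>a i\<bar> \<le> B) \<longleftrightarrow> (\<forall>i<n. \<bar>b i\<bar> \<le> B)"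
  shows "lq_norm \<infinity> m a = lq_norm \<infinity> n b"
proof (rule antisym)
  show "lq_norm \<infinity> m a \<le> lq_norm \<infinity> n b"
    using assms[of "lq_norm \<infinity> n b"] lq_norm_infinity_le_iff[of n b "lq_norm \<infinity> n b"]
    unfolding lq_norm_infinity_le_iff[of m a] by simp
  show "lq_norm \<infinity> n b \<le> lq_norm \<infinity> m a"
    using assms[of "lq_norm \<infinity> m a"] lq_norm_infinity_le_iff[of m a "lq_norm \<infinity> m a"]
    unfolding lq_norm_infinity_le_iff[of n b] by simp
qed

lemma abs_le_lq_norm:
  assumes "q \<in> {\<infinity>} \<union> {1..<2}" "i < n"
  shows "\<bar>a i\<bar> \<le> lq_norm q n a"
  using assms(1)
proof (cases rule: exponent_cases)
  case 1
  then show ?thesis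
    using assms(2) lq_norm_infinity_le_iff[of n a "lq_norm \<infinity> n a"] by simp
next
  case (2 r)
  then show ?thesis
    using assms(2) by (auto simp: lq_norm_ereal intro!: abs_le_lp_sum)
qed

lemma lq_norm_nonneg: "0 \<le> lq_norm q n a"
  by (auto simp: lq_norm_def)

lemma lq_norm_cmult:
  assumes "q \<in> {\<infinity>} \<union> {1..<2}"
  shows "lq_norm q n (\<lambda>i. c * a i) = \<bar>c\<bar> * lq_norm q n a"
  using assms
proof (cases rule: exponent_cases)
  case 1
  have *: "lq_norm \<infinity> n (\<lambda>i. c * a i) \<le> \<bar>c\<bar> * lq_norm \<infinity> n a" for c and a :: "nat \<Rightarrow> real"
    using abs_le_lq_norm[of \<infinity> _ n a]
    by (auto simp: lq_norm_infinity_le_iff abs_mult lq_norm_nonneg intro!: mult_left_mono)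
  show ?thesis
  proof (cases "c = 0")
    case True
    then show ?thesis
      using *[of 0 a] lq_norm_nonneg[of \<infinity> n "\<lambda>i. 0 * a i"] 1 by simp
  next
    case False
    have "lq_norm \<infinity> n a \<le> \<bar>1 / c\<bar> * lq_norm \<infinity> n (\<lambda>i. c * a i)"
      using *[of "1 / c" "\<lambda>i. c * a i"] False by simp
    then have "\<bar>c\<bar> * lq_norm \<infinity> n a \<le> lq_norm \<infinity> n (\<lambda>i. c * a i)"
      using False by (simp add: field_simps)
    then show ?thesis
      using *[of c a] 1 by simp
  qed
next
  case (2 r)
  then show ?thesis
    by (simp add: lq_norm_ereal lp_sum_cmult)
qed

lemma lq_norm_cong:
  assumes "\<And>i. i < n \<Longrightarrow> a i = b i"
  shows "lq_norm q n a = lq_norm q n b"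
proof -
  have "(\<lambda>i. \<bar>a i\<bar>) ` {..<n} = (\<lambda>i. \<bar>b i\<bar>) ` {..<n}"
    using assms by (intro image_cong) auto
  then show ?thesis
    using assms by (auto simp: lq_norm_def)
qed

text \<open>A basis of the copy takes the place of the isomorphism and is scaled so that the whole
  distortion sits in the upper estimate.\<close>

definition lq_system :: "ereal \<Rightarrow> real \<Rightarrow> nat \<Rightarrow> (nat \<Rightarrow> 'a::real_normed_vector) \<Rightarrow> bool" where
  "lq_system q C n y \<longleftrightarrow>
    (\<forall>a. lq_norm q n a \<le> norm (\<Sum>j<n. a j *\<^sub>R y j) \<and>
         norm (\<Sum>j<n. a j *\<^sub>R y j) \<le> C * lq_norm q n a)"

lemma op_norm_upper:
  assumes "bounded_op_on V N M T" "v \<in> V" "N v \<le> 1" "\<And>v. v \<in> V \<Longrightarrow> N v \<ge> 0"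
  shows "M (T v) \<le> op_norm V N M T"
proof -
  obtain K where K: "\<And>v. v \<in> V \<Longrightarrow> M (T v) \<le> K * N v"
    using assms(1) by (auto simp: bounded_op_on_def)
  have "M (T v) \<le> \<bar>K\<bar>" if "v \<in> V" "N v \<le> 1" for v
  proof -
    have "K * N v \<le> \<bar>K\<bar> * 1"
      using that assms(4) by (intro mult_mono) auto
    then show ?thesis
      using K[OF that(1)] by simp
  qed
  then have "bdd_above ((\<lambda>v. M (T v)) ` {v \<in> V. N v \<le> 1})"
    by (auto simp: bdd_above_def)
  then show ?thesis
    unfolding op_norm_def using assms(2,3) by (intro cSUP_upper) auto
qed

lemma lq_system_of_isomorphic:
  fixes Z :: "'a::real_normed_vector set"
  assumes q: "q \<in> {\<infinity>} \<union> {1..<2}" and iso: "C_isomorphic_lq C q n Z" and Z: "subspace Z"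
  obtains y where "lq_system q C n (y :: nat \<Rightarrow> 'a)"
proof -
  obtain T where bij: "bij_betw T (seq_space n) Z"
    and add: "\<And>a b. a \<in> seq_space n \<Longrightarrow> b \<in> seq_space n \<Longrightarrow> T (\<lambda>i. a i + b i) = T a + T b"
    and scale: "\<And>a c. a \<in> seq_space n \<Longrightarrow> T (\<lambda>i. c * a i) = c *\<^sub>R T a"
    and bd: "bounded_op_on (seq_space n) (lq_norm q n) norm T"
    and bd': "bounded_op_on Z norm (lq_norm q n) (inv_into (seq_space n) T)"
    and C: "op_norm (seq_space n) (lq_norm q n) norm T * op_norm Z norm (lq_norm q n) (inv_into (seq_space n) T) \<le> C"
    using iso unfolding C_isomorphic_lq_def by blast
  define A where "A = op_norm (seq_space n) (lq_norm q n) norm T"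
  define A' where "A' = op_norm Z norm (lq_norm q n) (inv_into (seq_space n) T)"
  have inv: "inv_into (seq_space n) T (T a) = a" if "a \<in> seq_space n" for a
    using bij that by (simp add: bij_betw_def)
  have TZ: "T a \<in> Z" if "a \<in> seq_space n" for a
    using bij that by (auto simp: bij_betw_def)
  have zero: "(\<lambda>_. 0) \<in> seq_space n" "T (\<lambda>_. 0) = 0"
    using scale[of "\<lambda>_. 0" 0] by (auto simp: seq_space_def)
  have "A' \<ge> 0"
  proof -
    have "lq_norm q n (inv_into (seq_space n) T 0) \<le> A'"
      unfolding A'_def using Z by (intro op_norm_upper[OF bd']) (auto simp: subspace_0)
    then show ?thesis
      using lq_norm_nonneg[of q n "inv_into (seq_space n) T 0"] by linarith
  qed
  have upper: "norm (T a) \<le> A * lq_norm q n a" if a: "a \<in> seq_space n" for a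
  proof (cases "lq_norm q n a = 0")
    case True
    then have "a = (\<lambda>_. 0)"
      using abs_le_lq_norm[OF q, of _ n a] a by (auto simp: seq_space_def not_less[symmetric])
    then show ?thesis
      using True zero by simp
  next
    case False
    define s where "s = lq_norm q n a"
    have s: "s > 0"
      using False lq_norm_nonneg[of q n a] by (simp add: s_def)
    have "norm (T (\<lambda>i. 1 / s * a i)) \<le> A"
      unfolding A_def using a s lq_norm_cmult[OF q, of n "1 / s" a]
      by (intro op_norm_upper[OF bd]) (auto simp: seq_space_def lq_norm_nonneg s_def[symmetric])
    then show ?thesis
      using s scale[OF a, of "1 / s"] by (simp add: s_def[symmetric] field_simps)
  qed
  have lower: "lq_norm q n a \<le> A' * norm (T a)" if a: "a \<in> seq_space n" for a
  proof (cases "T a = 0")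
    case True
    then have "a = (\<lambda>_. 0)"
      using inv[OF a] inv[OF zero(1)] zero(2) by metis
    then show ?thesis
      using zero(2) lq_norm_cmult[OF q, of n 0 a] by simp
  next
    case False
    define s where "s = norm (T a)"
    have s: "s > 0"
      using False by (simp add: s_def)
    have a': "(\<lambda>i. 1 / s * a i) \<in> seq_space n"
      using a by (auto simp: seq_space_def)
    have "lq_norm q n (inv_into (seq_space n) T (T (\<lambda>i. 1 / s * a i))) \<le> A'"
      unfolding A'_def using TZ[OF a'] s scale[OF a, of "1 / s"]
      by (intro op_norm_upper[OF bd']) (auto simp: s_def[symmetric])
    then have "lq_norm q n a / s \<le> A'"
      using s lq_norm_cmult[OF q, of n "1 / s" a] by (simp only: inv[OF a']) simp
    then show ?thesis
      using s by (simp add: s_def[symmetric] field_simps)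
  qed
  define e where "e j = (\<lambda>i. if i = j then 1 else 0 :: real)" for j :: nat
  have expand: "T (\<lambda>i. if i < k then a i else 0) = (\<Sum>j<k. a j *\<^sub>R T (e j))" if "k \<le> n" for k a
    using that
  proof (induction k)
    case 0
    then show ?case
      using zero by simp
  next
    case (Suc k)
    have mem: "e k \<in> seq_space n" "(\<lambda>i. a k * e k i) \<in> seq_space n"
      "(\<lambda>i. if i < k then a i else 0) \<in> seq_space n"
      using Suc.prems by (auto simp: seq_space_def e_def)
    have "(\<lambda>i. if i < Suc k then a i else 0) = (\<lambda>i. (if i < k then a i else 0) + a k * e k i)"
      by (auto simp: e_def less_Suc_eq)
    then have "T (\<lambda>i. if i < Suc k then a i else 0) = T (\<lambda>i. if i < k then a i else 0) + a k *\<^sub>R T (e k)"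
      using add[OF mem(3,2)] scale[OF mem(1), of "a k"] by simp
    then show ?case
      using Suc by simp
  qed
  \<comment> \<open>Scaling by the norm \<open>A'\<close> of the inverse makes the lower constant 1
    and the upper one \<open>A * A'\<close>, which is at most \<open>C\<close>.\<close>
  have "lq_system q C n (\<lambda>j. A' *\<^sub>R T (e j))"
    unfolding lq_system_def
  proof (intro allI conjI)
    fix a :: "nat \<Rightarrow> real"
    define b where "b i = (if i < n then a i else 0)" for i
    have b: "b \<in> seq_space n"
      by (auto simp: b_def seq_space_def)
    have ab: "lq_norm q n a = lq_norm q n b"
      by (intro lq_norm_cong) (simp add: b_def)
    have "(\<Sum>j<n. a j *\<^sub>R A' *\<^sub>R T (e j)) = A' *\<^sub>R (\<Sum>j<n. a j *\<^sub>R T (e j))"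
      by (simp add: scaleR_sum_right mult.commute)
    also have "(\<Sum>j<n. a j *\<^sub>R T (e j)) = T b"
      using expand[of n a] by (simp add: b_def[abs_def])
    finally have eq: "norm (\<Sum>j<n. a j *\<^sub>R A' *\<^sub>R T (e j)) = A' * norm (T b)"
      using \<open>A' \<ge> 0\<close> by simp
    show "lq_norm q n a \<le> norm (\<Sum>j<n. a j *\<^sub>R A' *\<^sub>R T (e j))"
      unfolding eq ab by (rule lower[OF b])
    have "A' * norm (T b) \<le> A' * (A * lq_norm q n b)"
      using upper[OF b] \<open>A' \<ge> 0\<close> by (rule mult_left_mono)
    also have "\<dots> = (A * A') * lq_norm q n b"
      by simp
    also have "\<dots> \<le> C * lq_norm q n b"
      using C lq_norm_nonneg unfolding A_def A'_def by (intro mult_right_mono) auto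
    finally show "norm (\<Sum>j<n. a j *\<^sub>R A' *\<^sub>R T (e j)) \<le> C * lq_norm q n a"
      unfolding eq ab .
  qed
  then show ?thesis
    by (rule that)
qed

section \<open>Block bases inside the kernels of finitely many functionals\<close>

lemma sum_pairs:
  fixes f :: "nat \<Rightarrow> 'b::comm_monoid_add"
  shows "(\<Sum>j<2 * n. f j) = (\<Sum>j<n. f (2 * j) + f (2 * j + 1))"
  by (induction n) (auto simp: add.assoc)

lemma all_less_double: "(\<forall>j<2 * n. P j) \<longleftrightarrow> (\<forall>j<n. P (2 * j) \<and> P (2 * j + 1 :: nat))"
proof (intro iffI allI impI)
  fix j assume *: "\<forall>j<n. P (2 * j) \<and> P (2 * j + 1)" "j < 2 * n"
  then have "P (2 * (j div 2)) \<and> P (2 * (j div 2) + 1)"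
    by (intro *(1)[rule_format]) auto
  then show "P j"
    by (cases "even j") auto
qed auto

definition lq_unit_pair :: "ereal \<Rightarrow> real \<Rightarrow> real \<Rightarrow> bool" where
  "lq_unit_pair q \<alpha> \<beta> \<longleftrightarrow>
    (if q = \<infinity> then max \<bar>\<alpha>\<bar> \<bar>\<beta>\<bar> = 1 else \<bar>\<alpha>\<bar> powr real_of_ereal q + \<bar>\<beta>\<bar> powr real_of_ereal q = 1)"

lemma lq_unit_pair_orthogonal:
  assumes "q \<in> {\<infinity>} \<union> {1..<2}"
  obtains \<alpha> \<beta> where "lq_unit_pair q \<alpha> \<beta>" "\<alpha> * s + \<beta> * t = 0"
proof (cases "s = 0 \<and> t = 0")
  case True
  then show ?thesis
    by (intro that[of 1 0]) (auto simp: lq_unit_pair_def)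
next
  case False
  from assms show ?thesis
  proof (cases rule: exponent_cases)
    case 1
    define m where "m = max \<bar>s\<bar> \<bar>t\<bar>"
    have "m > 0"
      using False by (auto simp: m_def)
    then have "max \<bar>t / m\<bar> \<bar>- s / m\<bar> = max \<bar>s\<bar> \<bar>t\<bar> / m"
      by (simp add: max_def divide_le_cancel)
    then show ?thesis
      using 1 \<open>m > 0\<close> by (intro that[of "t / m" "- s / m"]) (auto simp: lq_unit_pair_def m_def[symmetric])
  next
    case (2 r)
    define m where "m = (\<bar>s\<bar> powr r + \<bar>t\<bar> powr r) powr (1 / r)"
    have pos: "\<bar>s\<bar> powr r + \<bar>t\<bar> powr r > 0"
      using False by (cases "s = 0") (auto intro: add_pos_nonneg)
    then have "m > 0" "m powr r = \<bar>s\<bar> powr r + \<bar>t\<bar> powr r"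
      using 2 by (auto simp: m_def powr_powr)
    then have "\<bar>t / m\<bar> powr r + \<bar>- s / m\<bar> powr r = 1"
      using pos by (simp add: powr_divide add_divide_distrib[symmetric] add.commute)
    then show ?thesis
      using 2 by (intro that[of "t / m" "- s / m"]) (auto simp: lq_unit_pair_def)
  qed
qed

text \<open>Disjoint blocks of norm one span an isometric copy of l_q; here every block lives on two
  neighbouring coordinates.\<close>

lemma lq_norm_blocks:
  assumes "q \<in> {\<infinity>} \<union> {1..<2}" "\<And>j. lq_unit_pair q (\<alpha> j) (\<beta> j)"
  shows "lq_norm q (2 * n) (\<lambda>j. a (j div 2) * (if even j then \<alpha> (j div 2) else \<beta> (j div 2))) = lq_norm q n a"
  using assms(1)
proof (cases rule: exponent_cases)
  case 1
  have "\<bar>a j * \<alpha> j\<bar> \<le> B \<and> \<bar>a j * \<beta> j\<bar> \<le> B \<longleftrightarrow> \<bar>a j\<bar> \<le> B" for j B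
  proof -
    have m: "max \<bar>\<alpha> j\<bar> \<bar>\<beta> j\<bar> = 1"
      using assms(2)[of j] 1 by (simp add: lq_unit_pair_def)
    have "\<bar>a j\<bar> * max \<bar>\<alpha> j\<bar> \<bar>\<beta> j\<bar> = max \<bar>a j * \<alpha> j\<bar> \<bar>a j * \<beta> j\<bar>"
      by (simp add: abs_mult max_mult_distrib_left)
    then have "\<bar>a j\<bar> = max \<bar>a j * \<alpha> j\<bar> \<bar>a j * \<beta> j\<bar>"
      using m by simp
    then show ?thesis
      by simp
  qed
  then show ?thesis
    unfolding 1 by (intro lq_norm_infinity_eqI) (unfold all_less_double, simp)
next
  case (2 r)
  have "\<bar>a j * \<alpha> j\<bar> powr r + \<bar>a j * \<beta> j\<bar> powr r = \<bar>a j\<bar> powr r" for j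
    using assms(2)[of j] 2 by (simp add: lq_unit_pair_def abs_mult powr_mult distrib_left[symmetric])
  then show ?thesis
    using 2 by (simp add: lq_norm_ereal lp_sum_def sum_pairs)
qed

text \<open>The span of two neighbouring basis vectors contains a normalized combination annihilated
  by one further functional. Each functional halves the dimension but leaves \<open>C\<close>
  unchanged, so the induction draws on copies of all dimensions with the same constant.\<close>

lemma lq_system_in_kernel:
  fixes \<Phi> :: "('a::real_normed_vector \<Rightarrow> real) set"
  assumes "q \<in> {\<infinity>} \<union> {1..<2}" "\<And>n. \<exists>y :: nat \<Rightarrow> 'a. lq_system q C n y"
    and "finite \<Phi>" "\<Phi> \<subseteq> Collect bounded_linear"
  shows "\<exists>y :: nat \<Rightarrow> 'a. lq_system q C n y \<and> (\<forall>\<phi>\<in>\<Phi>. \<forall>j. \<phi> (y j) = 0)"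
  using assms(3,4)
proof (induction \<Phi> arbitrary: n rule: finite_induct)
  case empty
  then show ?case
    using assms by auto
next
  case (insert \<phi> \<Phi>)
  then obtain y where y: "lq_system q C (2 * n) y" "\<And>\<psi> j. \<psi> \<in> \<Phi> \<Longrightarrow> \<psi> (y j) = 0"
    by blast
  have "\<exists>\<alpha> \<beta>. lq_unit_pair q \<alpha> \<beta> \<and> \<alpha> * \<phi> (y (2 * j)) + \<beta> * \<phi> (y (2 * j + 1)) = 0" for j
    by (rule lq_unit_pair_orthogonal[OF assms(1), of "\<phi> (y (2 * j))" "\<phi> (y (2 * j + 1))"]) blast
  then obtain \<alpha> \<beta> where \<alpha>\<beta>: "\<And>j. lq_unit_pair q (\<alpha> j) (\<beta> j)"
    "\<And>j. \<alpha> j * \<phi> (y (2 * j)) + \<beta> j * \<phi> (y (2 * j + 1)) = 0"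
    by metis
  define z where "z j = \<alpha> j *\<^sub>R y (2 * j) + \<beta> j *\<^sub>R y (2 * j + 1)" for j
  have \<psi>z: "\<psi> (z j) = \<alpha> j * \<psi> (y (2 * j)) + \<beta> j * \<psi> (y (2 * j + 1))" if "bounded_linear \<psi>" for \<psi> j
  proof -
    interpret bounded_linear \<psi> by fact
    show ?thesis
      by (simp add: z_def add scaleR)
  qed
  have "lq_system q C n z"
    unfolding lq_system_def
  proof
    fix a :: "nat \<Rightarrow> real"
    define b where "b j = a (j div 2) * (if even j then \<alpha> (j div 2) else \<beta> (j div 2))" for j :: nat
    have "(\<Sum>j<n. a j *\<^sub>R z j) = (\<Sum>j<2 * n. b j *\<^sub>R y j)"
      unfolding sum_pairs by (simp add: b_def z_def scaleR_add_right)
    moreover have "lq_norm q (2 * n) b = lq_norm q n a"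
      unfolding b_def by (rule lq_norm_blocks[OF assms(1) \<alpha>\<beta>(1)])
    ultimately show "lq_norm q n a \<le> norm (\<Sum>j<n. a j *\<^sub>R z j) \<and>
        norm (\<Sum>j<n. a j *\<^sub>R z j) \<le> C * lq_norm q n a"
      using y(1) by (metis lq_system_def)
  qed
  moreover have "\<psi> (z j) = 0" if "\<psi> \<in> insert \<phi> \<Phi>" for \<psi> j
  proof -
    have "bounded_linear \<psi>"
      using that insert.prems by blast
    moreover have "\<psi> = \<phi> \<or> \<psi> \<in> \<Phi>"
      using that by blast
    ultimately show ?thesis
      using \<psi>z[of \<psi> j] \<alpha>\<beta>(2)[of j] y(2)[of \<psi> "2 * j"] y(2)[of \<psi> "2 * j + 1"] by (elim disjE) simp_all
  qed
  ultimately show ?case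
    by blast
qed

section \<open>Spread families in \<open>\<ell>\<^sub>\<infinity>\<^sup>n\<close>\<close>

text \<open>
  By Khinchine's inequality, the lower bound makes the normalized tuple of all sign functionals weakly
  \<open>p\<close>-summable on the span of the family, and each of them has average modulus one on it. The second
  condition, with small \<open>\<eta>\<close>, says that no tuple defined on the whole space behaves like this.
\<close>

definition spread_family :: "real \<Rightarrow> real \<Rightarrow> 'i set \<Rightarrow> ('i \<Rightarrow> 'a::real_normed_vector) \<Rightarrow> bool" where
  "spread_family p \<eta> I x \<longleftrightarrow> finite I \<and> I \<noteq> {} \<and>
    (\<forall>a. L2_set a I \<le> norm (\<Sum>k\<in>I. a k *\<^sub>R x k)) \<and>
    (\<forall>(N::nat) \<psi> B. B \<ge> 0 \<longrightarrow> (\<forall>i<N. bounded_linear (\<psi> i)) \<longrightarrow>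
       (\<forall>y. lp_sum p {..<N} (\<lambda>i. \<psi> i y) \<le> B * norm y) \<longrightarrow>
       lp_sum p {..<N} (\<lambda>i. (\<Sum>k\<in>I. \<bar>\<psi> i (x k)\<bar>) / real (card I)) \<le> \<eta> * B)"

lemma spread_family_reindex:
  assumes "spread_family p \<eta> I x" "bij_betw h J I"
  shows "spread_family p \<eta> J (x \<circ> h)"
proof -
  have J: "finite J" "J \<noteq> {}" "card J = card I"
    using assms bij_betw_finite[OF assms(2)] bij_betw_same_card[OF assms(2)]
    by (auto simp: spread_family_def bij_betw_def)
  have sum_h: "(\<Sum>k\<in>I. f k) = (\<Sum>j\<in>J. f (h j))" for f :: "'a \<Rightarrow> 'z::comm_monoid_add"
    using assms(2) by (simp add: sum.reindex_bij_betw)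
  have "L2_set a J \<le> norm (\<Sum>j\<in>J. a j *\<^sub>R (x \<circ> h) j)" for a
  proof -
    define b where "b k = a (inv_into J h k)" for k
    have b: "b (h j) = a j" if "j \<in> J" for j
      using assms(2) that by (simp add: b_def bij_betw_def)
    have "L2_set a J = L2_set b I"
      unfolding L2_set_def sum_h using b by (intro arg_cong[of _ _ sqrt] sum.cong) auto
    also have "\<dots> \<le> norm (\<Sum>k\<in>I. b k *\<^sub>R x k)"
      using assms(1) by (simp add: spread_family_def)
    also have "(\<Sum>k\<in>I. b k *\<^sub>R x k) = (\<Sum>j\<in>J. a j *\<^sub>R (x \<circ> h) j)"
      unfolding sum_h using b by (intro sum.cong) auto
    finally show ?thesis .
  qed
  then show ?thesis
    using assms(1) J unfolding spread_family_def sum_h by simp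
qed

text \<open>A norming set for the sum of the row maxima: the dual of this norm is l_infinity of l_1,
  and the extreme points of its ball have a single entry of modulus 1 in each row. The value 0 off
  the grid keeps the set finite.\<close>

definition row_selections :: "nat \<Rightarrow> (nat \<times> nat \<Rightarrow> real) set" where
  "row_selections r = {\<omega>. (\<forall>k. (k \<in> {..<r} \<times> {..<r} \<longrightarrow> \<omega> k \<in> {-1, 0, 1}) \<and> (k \<notin> {..<r} \<times> {..<r} \<longrightarrow> \<omega> k = 0)) \<and>
    (\<forall>u v v'. \<omega> (u, v) \<noteq> 0 \<longrightarrow> \<omega> (u, v') \<noteq> 0 \<longrightarrow> v = v')}"

lemma finite_row_selections: "finite (row_selections r)"
proof -
  have "finite {\<omega> :: nat \<times> nat \<Rightarrow> real. \<forall>k. (k \<in> {..<r} \<times> {..<r} \<longrightarrow> \<omega> k \<in> {-1, 0, 1}) \<and>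
      (k \<notin> {..<r} \<times> {..<r} \<longrightarrow> \<omega> k = 0)}"
    by (rule finite_set_of_finite_funs) auto
  then show ?thesis
    by (rule rev_finite_subset) (unfold row_selections_def, blast)
qed

text \<open>At most one term of the sum survives. Hence every signed sum over a row has all its
  coordinates in [-1, 1], which is the upper l_infinity estimate for a row.\<close>

lemma row_selection_signs:
  assumes "\<omega> \<in> row_selections r"
  shows "\<bar>\<Sum>v<r. sign_of S v * \<omega> (u, v)\<bar> \<le> 1"
proof (cases "\<exists>v0<r. \<omega> (u, v0) \<noteq> 0")
  case True
  then obtain v0 where v0: "v0 < r" "\<omega> (u, v0) \<noteq> 0"
    by blast
  then have "\<omega> (u, v) = 0" if "v \<noteq> v0" for v
    using assms that unfolding row_selections_def by blast
  then have "(\<Sum>v<r. sign_of S v * \<omega> (u, v)) = (\<Sum>v\<in>{v0}. sign_of S v * \<omega> (u, v))"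
    using v0 by (intro sum.mono_neutral_right) auto
  moreover have "\<bar>\<omega> (u, v0)\<bar> \<le> 1"
  proof (cases "(u, v0) \<in> {..<r} \<times> {..<r}")
    case True
    then have "\<omega> (u, v0) \<in> {-1, 0, 1}"
      using assms unfolding row_selections_def by blast
    then show ?thesis
      by auto
  next
    case False
    then have "\<omega> (u, v0) = 0"
      using assms unfolding row_selections_def by blast
    then show ?thesis
      by simp
  qed
  ultimately show ?thesis
    by (simp add: abs_mult)
next
  case False
  then show ?thesis
    by simp
qed

lemma row_selection_maxima:
  fixes a :: "nat \<times> nat \<Rightarrow> real"
  assumes "r > 0"
  obtains \<omega> \<alpha> where "\<omega> \<in> row_selections r" "\<And>u. \<alpha> u \<ge> 0" "\<And>u v. u < r \<Longrightarrow> v < r \<Longrightarrow> \<bar>a (u, v)\<bar> \<le> \<alpha> u"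
    "(\<Sum>k\<in>{..<r} \<times> {..<r}. a k * \<omega> k) = (\<Sum>u<r. \<alpha> u)"
proof -
  have "\<exists>v<r. \<forall>v'<r. \<bar>a (u, v')\<bar> \<le> \<bar>a (u, v)\<bar>" for u
  proof -
    have fin: "finite ((\<lambda>v. \<bar>a (u, v)\<bar>) ` {..<r})" "(\<lambda>v. \<bar>a (u, v)\<bar>) ` {..<r} \<noteq> {}"
      using assms by auto
    obtain v where "v < r" "\<bar>a (u, v)\<bar> = Max ((\<lambda>v. \<bar>a (u, v)\<bar>) ` {..<r})"
      using Max_in[OF fin] by auto
    then show ?thesis
      using Max_ge[OF fin(1)] by auto
  qed
  then obtain g where g: "\<And>u. g u < r" "\<And>u v. v < r \<Longrightarrow> \<bar>a (u, v)\<bar> \<le> \<bar>a (u, g u)\<bar>"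
    by metis
  \<comment> \<open>\<open>sgn\<close> is 0 when a row vanishes identically; this is why a selection
    is allowed to skip rows.\<close>
  define \<omega> where "\<omega> = (\<lambda>(u, v). if u < r \<and> v = g u then sgn (a (u, v)) else 0)"
  have "\<omega> \<in> row_selections r"
    using g(1) by (auto simp: row_selections_def \<omega>_def sgn_if split: if_splits)
  moreover have "(\<Sum>k\<in>{..<r} \<times> {..<r}. a k * \<omega> k) = (\<Sum>u<r. \<bar>a (u, g u)\<bar>)"
  proof -
    have "(\<Sum>k\<in>{..<r} \<times> {..<r}. a k * \<omega> k) = (\<Sum>u<r. \<Sum>v<r. a (u, v) * \<omega> (u, v))"
      by (simp add: sum.cartesian_product)
    also have "\<dots> = (\<Sum>u<r. \<Sum>v<r. if v = g u then \<bar>a (u, v)\<bar> else 0)"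
      by (intro sum.cong refl) (auto simp: \<omega>_def abs_sgn)
    also have "\<dots> = (\<Sum>u<r. \<bar>a (u, g u)\<bar>)"
      using g(1) by (intro sum.cong refl) (simp add: sum.delta)
    finally show ?thesis .
  qed
  ultimately show ?thesis
    using g by (intro that[of \<omega> "\<lambda>u. \<bar>a (u, g u)\<bar>"]) auto
qed

text \<open>The functionals form an operator of norm at most \<open>B\<close> into l_p^N, and l_p
  has cotype p with constant one: averaging over all signs controls the sum of the p-th powers by
  the bound on the signed sums. The number of vectors does not enter.\<close>

lemma sum_lp_sum_unconditional:
  fixes z :: "'i \<Rightarrow> 'a::real_normed_vector" and N :: nat
  assumes "p \<ge> 2" "finite V" "B \<ge> 0" "\<And>S. norm (\<Sum>v\<in>V. sign_of S v *\<^sub>R z v) \<le> C"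
    and "\<And>i. i < N \<Longrightarrow> bounded_linear (\<psi> i)" "\<And>y. lp_sum p {..<N} (\<lambda>i. \<psi> i y) \<le> B * norm y"
  shows "(\<Sum>v\<in>V. \<Sum>i<N. \<bar>\<psi> i (z v)\<bar> powr p) \<le> (B * C) powr p"
proof -
  have \<psi>: "\<psi> i (\<Sum>v\<in>V. sign_of S v *\<^sub>R z v) = (\<Sum>v\<in>V. sign_of S v * \<psi> i (z v))" if "i < N" for i S
  proof -
    interpret bounded_linear "\<psi> i"
      using assms(5) that .
    show ?thesis
      by (simp add: sum scaleR)
  qed
  have "2 ^ card V * (\<Sum>v\<in>V. \<Sum>i<N. \<bar>\<psi> i (z v)\<bar> powr p) = (\<Sum>i<N. 2 ^ card V * (\<Sum>v\<in>V. \<bar>\<psi> i (z v)\<bar> powr p))"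
    by (subst sum.swap) (simp add: sum_distrib_left)
  also have "\<dots> \<le> (\<Sum>i<N. \<Sum>S\<in>Pow V. \<bar>\<Sum>v\<in>V. sign_of S v * \<psi> i (z v)\<bar> powr p)"
    using assms by (intro sum_mono sum_powr_le_sum_signs) auto
  also have "\<dots> = (\<Sum>S\<in>Pow V. \<Sum>i<N. \<bar>\<psi> i (\<Sum>v\<in>V. sign_of S v *\<^sub>R z v)\<bar> powr p)"
    by (subst sum.swap) (simp add: \<psi>)
  also have "\<dots> = (\<Sum>S\<in>Pow V. lp_sum p {..<N} (\<lambda>i. \<psi> i (\<Sum>v\<in>V. sign_of S v *\<^sub>R z v)) powr p)"
    using assms(1) by (simp add: lp_sum_powr)
  also have "\<dots> \<le> (\<Sum>S\<in>Pow V. (B * C) powr p)"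
  proof (rule sum_mono)
    fix S
    have "lp_sum p {..<N} (\<lambda>i. \<psi> i (\<Sum>v\<in>V. sign_of S v *\<^sub>R z v)) \<le> B * norm (\<Sum>v\<in>V. sign_of S v *\<^sub>R z v)"
      by (rule assms)
    also have "\<dots> \<le> B * C"
      using assms by (intro mult_left_mono) auto
    finally show "lp_sum p {..<N} (\<lambda>i. \<psi> i (\<Sum>v\<in>V. sign_of S v *\<^sub>R z v)) powr p \<le> (B * C) powr p"
      using assms(1) by (intro powr_mono2) auto
  qed
  also have "\<dots> = 2 ^ card V * (B * C) powr p"
    using assms(2) by (simp add: card_Pow)
  finally show ?thesis
    by simp
qed

lemma lp_sum_average_le:
  assumes "p \<ge> 1" "finite I" "I \<noteq> {}"
  shows "lp_sum p {..<N::nat} (\<lambda>i. (\<Sum>k\<in>I. \<bar>f i k\<bar>) / real (card I)) powr p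
    \<le> (\<Sum>k\<in>I. \<Sum>i<N. \<bar>f i k\<bar> powr p) / real (card I)"
proof -
  define m where "m = real (card I)"
  have m: "m > 0"
    using assms by (simp add: m_def card_gt_0_iff)
  have "\<bar>(\<Sum>k\<in>I. \<bar>f i k\<bar>) / m\<bar> powr p \<le> (\<Sum>k\<in>I. \<bar>f i k\<bar> powr p) / m" for i
  proof -
    have "\<bar>(\<Sum>k\<in>I. \<bar>f i k\<bar>) / m\<bar> powr p = \<bar>\<Sum>k\<in>I. \<bar>f i k\<bar>\<bar> powr p / m powr p"
      using m by (simp add: powr_divide sum_nonneg)
    also have "\<dots> \<le> (m powr (p - 1) * (\<Sum>k\<in>I. \<bar>f i k\<bar> powr p)) / m powr p"
      unfolding m_def using jensen_powr[OF assms(2,1), of "\<lambda>k. \<bar>f i k\<bar>"]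
      by (intro divide_right_mono) auto
    also have "\<dots> = (\<Sum>k\<in>I. \<bar>f i k\<bar> powr p) / m"
      using m by (simp add: powr_diff)
    finally show ?thesis .
  qed
  then have "(\<Sum>i<N. \<bar>(\<Sum>k\<in>I. \<bar>f i k\<bar>) / m\<bar> powr p) \<le> (\<Sum>i<N. (\<Sum>k\<in>I. \<bar>f i k\<bar> powr p) / m)"
    by (rule sum_mono)
  also have "\<dots> = (\<Sum>k\<in>I. \<Sum>i<N. \<bar>f i k\<bar> powr p) / m"
    by (simp only: sum_divide_distrib[symmetric] sum.swap[of _ I])
  finally show ?thesis
    using assms(1) by (simp add: lp_sum_powr m_def)
qed

lemma powr_add_le:
  fixes s t p :: real
  assumes "p \<ge> 1"
  shows "\<bar>s + t\<bar> powr p \<le> 2 powr (p - 1) * (\<bar>s\<bar> powr p + \<bar>t\<bar> powr p)"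
  using jensen_powr[of "UNIV :: bool set" p "\<lambda>b. if b then s else t"] assms
  by (simp add: UNIV_bool add.commute)

text \<open>A whole row of r vectors contributes only one term (B * C)^p, because its signed sums
  stay bounded by C. The grid of r * r vectors thus gives r terms, and averaging over it leaves the
  small factor 1 / r.\<close>

lemma sum_lp_sum_row_family:
  fixes y :: "(nat \<times> nat \<Rightarrow> real) \<Rightarrow> 'a::real_normed_vector" and N :: nat
  assumes "p \<ge> 2" "B \<ge> 0"
    and upper: "\<And>a. (\<And>\<omega>. \<omega> \<in> row_selections r \<Longrightarrow> \<bar>a \<omega>\<bar> \<le> 1) \<Longrightarrow> norm (\<Sum>\<omega>\<in>row_selections r. a \<omega> *\<^sub>R y \<omega>) \<le> C"
    and lin: "\<And>i. i < N \<Longrightarrow> bounded_linear (\<psi> i)"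
    and \<psi>: "\<And>y. lp_sum p {..<N} (\<lambda>i. \<psi> i y) \<le> B * norm y"
  shows "(\<Sum>k\<in>{..<r} \<times> {..<r}. \<Sum>i<N. \<bar>\<psi> i (\<Sum>\<omega>\<in>row_selections r. \<omega> k *\<^sub>R y \<omega>)\<bar> powr p) \<le> real r * (B * C) powr p"
proof -
  define x where "x k = (\<Sum>\<omega>\<in>row_selections r. \<omega> k *\<^sub>R y \<omega>)" for k
  have "norm (\<Sum>v<r. sign_of S v *\<^sub>R x (u, v)) \<le> C" for S u
  proof -
    have "(\<Sum>v<r. sign_of S v *\<^sub>R x (u, v)) = (\<Sum>\<omega>\<in>row_selections r. (\<Sum>v<r. sign_of S v * \<omega> (u, v)) *\<^sub>R y \<omega>)"
      unfolding x_def by (simp add: scaleR_sum_right scaleR_sum_left) (rule sum.swap)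
    then show ?thesis
      using upper[OF row_selection_signs] by simp
  qed
  then have "(\<Sum>u<r. \<Sum>v<r. \<Sum>i<N. \<bar>\<psi> i (x (u, v))\<bar> powr p) \<le> (\<Sum>u<r. (B * C) powr p)"
    using assms(1,2) lin \<psi> by (intro sum_mono sum_lp_sum_unconditional) auto
  moreover have "(\<Sum>k\<in>{..<r} \<times> {..<r}. g k) = (\<Sum>u<r. \<Sum>v<r. g (u, v))" for g :: "nat \<times> nat \<Rightarrow> real"
    by (simp add: sum.cartesian_product)
  ultimately show ?thesis
    by (simp add: x_def)
qed

text \<open>
  The vectors indexed by a square grid span a space whose norm is the larger of the \<open>\<ell>\<^sub>1\<close> norm
  of the row maxima and the \<open>\<ell>\<^sub>1\<close> norm of the column maxima. It dominates the \<open>\<ell>\<^sub>2\<close> norm since the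
  square of an entry is at most the product of the two maxima, while a single row (or column) of the
  corresponding summand is equivalent to the basis of \<open>\<ell>\<^sub>\<infinity>\<close>, so that cotype \<open>p\<close> applies to it.
\<close>

lemma spread_family_l_infinity:
  fixes y :: "bool \<times> (nat \<times> nat \<Rightarrow> real) \<Rightarrow> 'a::real_normed_vector"
  assumes "p \<ge> 2" "\<eta> > 0" "C \<ge> 0" "r > 0" "(2 * C / \<eta>) powr p \<le> real r"
    and J_def: "J = UNIV \<times> row_selections r"
    and lower: "\<And>a j. j \<in> J \<Longrightarrow> \<bar>a j\<bar> \<le> norm (\<Sum>j\<in>J. a j *\<^sub>R y j)"
    and upper: "\<And>a B. B \<ge> 0 \<Longrightarrow> (\<And>j. j \<in> J \<Longrightarrow> \<bar>a j\<bar> \<le> B) \<Longrightarrow> norm (\<Sum>j\<in>J. a j *\<^sub>R y j) \<le> C * B"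
  shows "spread_family p \<eta> ({..<r} \<times> {..<r})
    (\<lambda>k. \<Sum>(b, \<omega>)\<in>J. (if b then \<omega> (prod.swap k) else \<omega> k) *\<^sub>R y (b, \<omega>))"
proof -
  define I where "I = {..<r} \<times> {..<r}"
  define c where "c k = (\<lambda>(b, \<omega>). if b then \<omega> (prod.swap k) else \<omega> k :: real)" for k :: "nat \<times> nat"
  define x where "x k = (\<Sum>j\<in>J. c k j *\<^sub>R y j)" for k
  have I: "finite I" "I \<noteq> {}" "card I = r * r"
    using assms(4) by (auto simp: I_def)
  have swap: "(\<Sum>k\<in>I. f (prod.swap k)) = (\<Sum>k\<in>I. f k)" for f :: "nat \<times> nat \<Rightarrow> real"
    by (rule sum.reindex_bij_betw[of prod.swap I I]) (auto simp: I_def bij_betw_def product_swap)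
  have "L2_set a I \<le> norm (\<Sum>k\<in>I. a k *\<^sub>R x k)" for a
  proof -
    define M where "M = norm (\<Sum>k\<in>I. a k *\<^sub>R x k)"
    have "(\<Sum>k\<in>I. a k *\<^sub>R x k) = (\<Sum>j\<in>J. (\<Sum>k\<in>I. a k * c k j) *\<^sub>R y j)"
      unfolding x_def by (simp add: scaleR_sum_right scaleR_sum_left) (rule sum.swap)
    then have M: "\<bar>\<Sum>k\<in>I. a k * c k j\<bar> \<le> M" if "j \<in> J" for j
      using lower[OF that] by (simp add: M_def)
    obtain \<omega> \<alpha> where \<omega>: "\<omega> \<in> row_selections r" "\<And>u. \<alpha> u \<ge> 0" "\<And>u v. u < r \<Longrightarrow> v < r \<Longrightarrow> \<bar>a (u, v)\<bar> \<le> \<alpha> u"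
      "(\<Sum>k\<in>I. a k * \<omega> k) = (\<Sum>u<r. \<alpha> u)"
      using row_selection_maxima[OF assms(4), of a] unfolding I_def by blast
    obtain \<omega>' \<beta> where \<omega>': "\<omega>' \<in> row_selections r" "\<And>u. \<beta> u \<ge> 0" "\<And>u v. u < r \<Longrightarrow> v < r \<Longrightarrow> \<bar>a (v, u)\<bar> \<le> \<beta> u"
      "(\<Sum>k\<in>I. a (prod.swap k) * \<omega>' k) = (\<Sum>u<r. \<beta> u)"
      using row_selection_maxima[OF assms(4), of "a \<circ> prod.swap"] unfolding I_def by auto
    have "(\<Sum>u<r. \<alpha> u) \<le> M"
      using M[of "(False, \<omega>)"] \<omega> by (simp add: c_def J_def)
    moreover have "(\<Sum>u<r. \<beta> u) \<le> M"
      using M[of "(True, \<omega>')"] \<omega>' swap[of "\<lambda>k. a (prod.swap k) * \<omega>' k"] by (simp add: c_def J_def)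
    moreover have "(\<Sum>k\<in>I. (a k)\<^sup>2) \<le> (\<Sum>u<r. \<alpha> u) * (\<Sum>v<r. \<beta> v)"
    proof -
      have "(\<Sum>k\<in>I. (a k)\<^sup>2) \<le> (\<Sum>k\<in>I. \<alpha> (fst k) * \<beta> (snd k))"
      proof (rule sum_mono)
        fix k assume "k \<in> I"
        then have "\<bar>a k\<bar> * \<bar>a k\<bar> \<le> \<alpha> (fst k) * \<beta> (snd k)"
          using \<omega>(3)[of "fst k" "snd k"] \<omega>'(3)[of "snd k" "fst k"] \<omega>(2)
          by (intro mult_mono) (auto simp: I_def)
        then show "(a k)\<^sup>2 \<le> \<alpha> (fst k) * \<beta> (snd k)"
          by (simp add: power2_eq_square)
      qed
      also have "\<dots> = (\<Sum>u<r. \<alpha> u) * (\<Sum>v<r. \<beta> v)"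
        by (simp add: I_def sum_product sum.cartesian_product case_prod_beta)
      finally show ?thesis .
    qed
    ultimately have "(\<Sum>k\<in>I. (a k)\<^sup>2) \<le> M * M"
      using \<omega>(2) \<omega>'(2) mult_mono[of "\<Sum>u<r. \<alpha> u" M "\<Sum>v<r. \<beta> v" M]
      by (smt (verit) sum_nonneg norm_ge_zero M_def)
    then show ?thesis
      unfolding L2_set_def M_def[symmetric] by (intro real_le_lsqrt) (auto simp: M_def sum_nonneg power2_eq_square)
  qed
  moreover have "lp_sum p {..<N} (\<lambda>i. (\<Sum>k\<in>I. \<bar>\<psi> i (x k)\<bar>) / real (card I)) \<le> \<eta> * B"
    if B: "B \<ge> 0" and lin: "\<And>i. i < N \<Longrightarrow> bounded_linear (\<psi> i)"
      and \<psi>: "\<And>y. lp_sum p {..<N} (\<lambda>i. \<psi> i y) \<le> B * norm y" for N :: nat and \<psi> B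
  proof -
    \<comment> \<open>Each vector is a row part plus a column part. Exchanging the two coordinates
      of the grid turns columns into rows, so that one estimate serves both parts.\<close>
    define x1 where "x1 k = (\<Sum>\<omega>\<in>row_selections r. \<omega> k *\<^sub>R y (False, \<omega>))" for k
    define x2 where "x2 k = (\<Sum>\<omega>\<in>row_selections r. \<omega> k *\<^sub>R y (True, \<omega>))" for k
    have sum_J: "(\<Sum>j\<in>J. g j) = (\<Sum>\<omega>\<in>row_selections r. g (False, \<omega>)) + (\<Sum>\<omega>\<in>row_selections r. g (True, \<omega>))"
      for g :: "bool \<times> (nat \<times> nat \<Rightarrow> real) \<Rightarrow> 'a"
      using sum.cartesian_product[of "\<lambda>b \<omega>. g (b, \<omega>)" "row_selections r" UNIV]
      by (simp add: J_def UNIV_bool add.commute)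
    have x12: "x k = x1 k + x2 (prod.swap k)" for k
      by (simp add: x_def x1_def x2_def sum_J c_def)
    have half: "norm (\<Sum>\<omega>\<in>row_selections r. a \<omega> *\<^sub>R y (b, \<omega>)) \<le> C"
      if "\<And>\<omega>. \<omega> \<in> row_selections r \<Longrightarrow> \<bar>a \<omega>\<bar> \<le> 1" for a b
    proof -
      have "norm (\<Sum>j\<in>J. (if fst j = b then a (snd j) else 0) *\<^sub>R y j) \<le> C * 1"
        using that by (intro upper) (auto simp: J_def)
      then show ?thesis
        by (cases b) (simp_all add: sum_J)
    qed
    note row = sum_lp_sum_row_family[OF assms(1) B half lin \<psi>, folded I_def]
    have 1: "(\<Sum>k\<in>I. \<Sum>i<N. \<bar>\<psi> i (x1 k)\<bar> powr p) \<le> real r * (B * C) powr p"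
      and 2: "(\<Sum>k\<in>I. \<Sum>i<N. \<bar>\<psi> i (x2 (prod.swap k))\<bar> powr p) \<le> real r * (B * C) powr p"
      using row[of False] row[of True] swap[of "\<lambda>k. \<Sum>i<N. \<bar>\<psi> i (x2 k)\<bar> powr p"] by (simp_all add: x1_def x2_def)
    have "(\<Sum>k\<in>I. \<Sum>i<N. \<bar>\<psi> i (x k)\<bar> powr p)
        \<le> (\<Sum>k\<in>I. \<Sum>i<N. 2 powr (p - 1) * (\<bar>\<psi> i (x1 k)\<bar> powr p + \<bar>\<psi> i (x2 (prod.swap k))\<bar> powr p))"
    proof (intro sum_mono)
      fix k i assume "i \<in> {..<N}"
      then interpret bounded_linear "\<psi> i"
        using lin by simp
      show "\<bar>\<psi> i (x k)\<bar> powr p \<le> 2 powr (p - 1) * (\<bar>\<psi> i (x1 k)\<bar> powr p + \<bar>\<psi> i (x2 (prod.swap k))\<bar> powr p)"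
        unfolding x12 add using assms(1) by (intro powr_add_le) auto
    qed
    also have "\<dots> = 2 powr (p - 1) * ((\<Sum>k\<in>I. \<Sum>i<N. \<bar>\<psi> i (x1 k)\<bar> powr p) + (\<Sum>k\<in>I. \<Sum>i<N. \<bar>\<psi> i (x2 (prod.swap k))\<bar> powr p))"
      by (simp only: sum_distrib_left[symmetric] sum.distrib)
    also have "\<dots> \<le> 2 powr (p - 1) * (real r * (B * C) powr p + real r * (B * C) powr p)"
      using 1 2 by (intro mult_left_mono add_mono) auto
    also have "\<dots> = real r * (2 * C * B) powr p"
      using B assms(3) by (simp add: powr_diff powr_mult)
    finally have "(\<Sum>k\<in>I. \<Sum>i<N. \<bar>\<psi> i (x k)\<bar> powr p) / real (card I) \<le> real r * (2 * C * B) powr p / real (card I)"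
      by (intro divide_right_mono) auto
    also have "\<dots> = (2 * C * B) powr p / real r"
      using assms(4) I by simp
    \<comment> \<open>The two parts and the convexity constant combine to (2 * C * B)^p / r; the
      assumption on the size of \<open>r\<close> is designed for this comparison.\<close>
    also have "\<dots> \<le> (\<eta> * B) powr p"
    proof -
      have "(2 * C * B) powr p = (2 * C / \<eta>) powr p * (\<eta> * B) powr p"
        using assms(2,3) B by (simp add: powr_mult[symmetric] mult.assoc)
      also have "\<dots> \<le> real r * (\<eta> * B) powr p"
        using assms(5) by (intro mult_right_mono) auto
      finally show ?thesis
        using assms(4) by (simp add: field_simps)
    qed
    finally have "lp_sum p {..<N} (\<lambda>i. (\<Sum>k\<in>I. \<bar>\<psi> i (x k)\<bar>) / real (card I)) powr p \<le> (\<eta> * B) powr p"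
      using lp_sum_average_le[of p I N "\<lambda>i k. \<psi> i (x k)"] I assms(1) by linarith
    then show ?thesis
      using assms(1,2) B by (subst lp_sum_le_iff) (auto simp: lp_sum_powr)
  qed
  moreover have "(\<lambda>k. \<Sum>(b, \<omega>)\<in>J. (if b then \<omega> (prod.swap k) else \<omega> k) *\<^sub>R y (b, \<omega>)) = x"
    unfolding x_def c_def by (intro ext sum.cong) (auto simp: case_prod_beta)
  ultimately show ?thesis
    using I unfolding spread_family_def I_def[symmetric] by auto
qed

section \<open>Flat subspaces of \<open>\<ell>\<^sub>q\<^sup>n\<close>\<close>

text \<open>
  The lower bound is required for \<open>\<ell>\<^sub>2\<close>-valued coefficients because this version is inherited by
  tensor products.
\<close>

definition flat_matrix :: "real \<Rightarrow> real \<Rightarrow> nat set \<Rightarrow> nat set \<Rightarrow> (nat \<Rightarrow> nat \<Rightarrow> real) \<Rightarrow> bool" where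
  "flat_matrix q c K J x \<longleftrightarrow> finite K \<and> finite J \<and>
    (\<forall>t. (\<Sum>k\<in>K. (\<Sum>j\<in>J. x k j * t j)\<^sup>2) \<le> (\<Sum>j\<in>J. (t j)\<^sup>2)) \<and>
    (\<forall>(L::nat set) a. finite L \<longrightarrow>
      c * (\<Sum>k\<in>K. \<Sum>l\<in>L. (a k l)\<^sup>2) powr (q / 2)
        \<le> (\<Sum>j\<in>J. (\<Sum>l\<in>L. (\<Sum>k\<in>K. a k l * x k j)\<^sup>2) powr (q / 2)))"

lemma flat_matrix_bessel:
  "flat_matrix q c K J x \<Longrightarrow> (\<Sum>k\<in>K. (\<Sum>j\<in>J. x k j * t j)\<^sup>2) \<le> (\<Sum>j\<in>J. (t j)\<^sup>2)"
  by (simp add: flat_matrix_def)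

text \<open>A definition can quantify only over index sets of one fixed type. Enumerating
  \<open>L\<close> carries the estimate to any type, in particular to the product index sets that
  occur for tensor products.\<close>

lemma flat_matrix_lower:
  fixes L :: "'l set"
  assumes "flat_matrix q c K J x" "finite L"
  shows "c * (\<Sum>k\<in>K. \<Sum>l\<in>L. (a k l)\<^sup>2) powr (q / 2)
    \<le> (\<Sum>j\<in>J. (\<Sum>l\<in>L. (\<Sum>k\<in>K. a k l * x k j)\<^sup>2) powr (q / 2))"
proof -
  obtain n where n: "bij_betw n L {..<card L}"
    using ex_bij_betw_finite_nat[OF assms(2)] by (auto simp: atLeast0LessThan)
  have reindex: "(\<Sum>i<card L. f (inv_into L n i)) = (\<Sum>l\<in>L. f l)" for f :: "'l \<Rightarrow> real"
    using sum.reindex_bij_betw[OF bij_betw_inv_into[OF n]] .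
  have "c * (\<Sum>k\<in>K. \<Sum>i<card L. (a k (inv_into L n i))\<^sup>2) powr (q / 2)
    \<le> (\<Sum>j\<in>J. (\<Sum>i<card L. (\<Sum>k\<in>K. a k (inv_into L n i) * x k j)\<^sup>2) powr (q / 2))"
    using assms(1)[unfolded flat_matrix_def, THEN conjunct2, THEN conjunct2, THEN conjunct2,
        rule_format, of "{..<card L}" "\<lambda>k i. a k (inv_into L n i)"] by simp
  moreover have "(\<Sum>i<card L. (a k (inv_into L n i))\<^sup>2) = (\<Sum>l\<in>L. (a k l)\<^sup>2)" for k
    using reindex[of "\<lambda>l. (a k l)\<^sup>2"] .
  moreover have "(\<Sum>i<card L. (\<Sum>k\<in>K. a k (inv_into L n i) * x k j)\<^sup>2) = (\<Sum>l\<in>L. (\<Sum>k\<in>K. a k l * x k j)\<^sup>2)" for j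
    using reindex[of "\<lambda>l. (\<Sum>k\<in>K. a k l * x k j)\<^sup>2"] .
  ultimately show ?thesis
    by simp
qed

lemma sum_prod_encode:
  "(\<Sum>m\<in>prod_encode ` (A \<times> B). f m) = (\<Sum>i\<in>A. \<Sum>j\<in>B. f (prod_encode (i, j)))"
  by (simp add: sum.reindex inj_prod_encode sum.cartesian_product case_prod_beta)

text \<open>Each property is used for one factor at a time. For the lower bound, the row index of
  \<open>x\<close> is first absorbed into the l_2-valued coefficients of \<open>x'\<close>, via the
  index set \<open>K \<times> L\<close>; afterwards the bound for \<open>x\<close> applies at every
  fixed column of \<open>x'\<close>.\<close>

lemma flat_matrix_tensor:
  assumes "flat_matrix q c K J x" "flat_matrix q c' K' J' x'" "c \<ge> 0"
  shows "flat_matrix q (c * c') (prod_encode ` (K \<times> K')) (prod_encode ` (J \<times> J'))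
    (\<lambda>k j. x (fst (prod_decode k)) (fst (prod_decode j)) * x' (snd (prod_decode k)) (snd (prod_decode j)))"
proof -
  have fin: "finite K" "finite K'" "finite J" "finite J'"
    using assms by (auto simp: flat_matrix_def)
  have "(\<Sum>k\<in>K. \<Sum>k'\<in>K'. (\<Sum>j\<in>J. \<Sum>j'\<in>J'. x k j * x' k' j' * t j j')\<^sup>2) \<le> (\<Sum>j\<in>J. \<Sum>j'\<in>J'. (t j j')\<^sup>2)"
    for t :: "nat \<Rightarrow> nat \<Rightarrow> real"
  proof -
    have "(\<Sum>k\<in>K. \<Sum>k'\<in>K'. (\<Sum>j\<in>J. \<Sum>j'\<in>J'. x k j * x' k' j' * t j j')\<^sup>2)
      = (\<Sum>k'\<in>K'. \<Sum>k\<in>K. (\<Sum>j\<in>J. x k j * (\<Sum>j'\<in>J'. x' k' j' * t j j'))\<^sup>2)"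
      by (subst sum.swap) (simp add: sum_distrib_left mult.assoc)
    also have "\<dots> \<le> (\<Sum>k'\<in>K'. \<Sum>j\<in>J. (\<Sum>j'\<in>J'. x' k' j' * t j j')\<^sup>2)"
      by (intro sum_mono flat_matrix_bessel[OF assms(1)])
    also have "\<dots> = (\<Sum>j\<in>J. \<Sum>k'\<in>K'. (\<Sum>j'\<in>J'. x' k' j' * t j j')\<^sup>2)"
      by (rule sum.swap)
    also have "\<dots> \<le> (\<Sum>j\<in>J. \<Sum>j'\<in>J'. (t j j')\<^sup>2)"
      by (intro sum_mono flat_matrix_bessel[OF assms(2)])
    finally show ?thesis .
  qed
  moreover have "c * c' * (\<Sum>k\<in>K. \<Sum>k'\<in>K'. \<Sum>l\<in>L. (a k k' l)\<^sup>2) powr (q / 2)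
      \<le> (\<Sum>j\<in>J. \<Sum>j'\<in>J'. (\<Sum>l\<in>L. (\<Sum>k\<in>K. \<Sum>k'\<in>K'. a k k' l * (x k j * x' k' j'))\<^sup>2) powr (q / 2))"
    if "finite L" for L :: "nat set" and a
  proof -
    have "(\<Sum>k\<in>K. \<Sum>k'\<in>K'. \<Sum>l\<in>L. (a k k' l)\<^sup>2) = (\<Sum>k'\<in>K'. \<Sum>m\<in>K \<times> L. (a (fst m) k' (snd m))\<^sup>2)"
      by (subst sum.swap) (simp add: sum.cartesian_product case_prod_beta)
    then have "c * c' * (\<Sum>k\<in>K. \<Sum>k'\<in>K'. \<Sum>l\<in>L. (a k k' l)\<^sup>2) powr (q / 2)
      \<le> c * (\<Sum>j'\<in>J'. (\<Sum>m\<in>K \<times> L. (\<Sum>k'\<in>K'. a (fst m) k' (snd m) * x' k' j')\<^sup>2) powr (q / 2))"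
      using flat_matrix_lower[OF assms(2), of "K \<times> L" "\<lambda>k' m. a (fst m) k' (snd m)"] fin that assms(3)
      by (auto simp: mult.assoc intro!: mult_left_mono)
    also have "\<dots> = (\<Sum>j'\<in>J'. c * (\<Sum>k\<in>K. \<Sum>l\<in>L. (\<Sum>k'\<in>K'. a k k' l * x' k' j')\<^sup>2) powr (q / 2))"
      by (simp add: sum_distrib_left sum.cartesian_product case_prod_beta)
    also have "\<dots> \<le> (\<Sum>j'\<in>J'. \<Sum>j\<in>J. (\<Sum>l\<in>L. (\<Sum>k\<in>K. (\<Sum>k'\<in>K'. a k k' l * x' k' j') * x k j)\<^sup>2) powr (q / 2))"
      by (intro sum_mono flat_matrix_lower[OF assms(1) that])
    also have "\<dots> = (\<Sum>j\<in>J. \<Sum>j'\<in>J'. (\<Sum>l\<in>L. (\<Sum>k\<in>K. (\<Sum>k'\<in>K'. a k k' l * x' k' j') * x k j)\<^sup>2) powr (q / 2))"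
      by (rule sum.swap)
    also have "\<dots> = (\<Sum>j\<in>J. \<Sum>j'\<in>J'. (\<Sum>l\<in>L. (\<Sum>k\<in>K. \<Sum>k'\<in>K'. a k k' l * (x k j * x' k' j'))\<^sup>2) powr (q / 2))"
      by (simp add: sum_distrib_left sum_distrib_right mult_ac)
    finally show ?thesis .
  qed
  ultimately show ?thesis
    using fin unfolding flat_matrix_def by (simp add: sum_prod_encode)
qed

lemma flat_matrix_power:
  assumes "flat_matrix q c K J x" "c \<ge> 0"
  shows "\<exists>K' J' x'. flat_matrix q (c ^ t) K' J' x' \<and> card K' = card K ^ t \<and> card J' = card J ^ t"
proof (induction t)
  case 0
  have "flat_matrix q 1 {0} {0} (\<lambda>_ _. 1)"
    by (simp add: flat_matrix_def)
  then show ?case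
    by (intro exI[of _ "{0}"] exI[of _ "\<lambda>_ _. 1"]) auto
next
  case (Suc t)
  then obtain K' J' x' where *: "flat_matrix q (c ^ t) K' J' x'" "card K' = card K ^ t" "card J' = card J ^ t"
    by blast
  have "card (prod_encode ` (A \<times> B)) = card A * card B" for A B
    by (simp add: card_image inj_prod_encode card_cartesian_product)
  then have "card (prod_encode ` (K \<times> K')) = card K ^ Suc t" "card (prod_encode ` (J \<times> J')) = card J ^ Suc t"
    using * by simp_all
  then show ?case
    using flat_matrix_tensor[OF assms(1) *(1) assms(2)] unfolding power_Suc[of c] by blast
qed

section \<open>Power sums without a dominant coordinate\<close>

lemma powr_ge_linear:
  fixes t b s :: real
  assumes "0 \<le> t" "t \<le> b" "s \<le> 1"
  shows "t * b powr (s - 1) \<le> t powr s"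
proof (cases "t = 0")
  case False
  then have "t * b powr (s - 1) \<le> t * t powr (s - 1)"
    using assms by (intro mult_left_mono powr_mono2') auto
  also have "\<dots> = t powr s"
    using False assms by (simp add: powr_mult_base)
  finally show ?thesis .
qed simp

text \<open>A lower bound for the sum of t_j^s over probability vectors with all t_j \<le> 1 -
  \<epsilon>. If all t_j are at most 1/2, then t_j^s \<ge> 2^(1-s) * t_j. Otherwise one of them is 1
  - u with \<epsilon> \<le> u \<le> 1/2, and (1 - u) + u^s exceeds 1 by u^s - u, which is at least
  u^s * (1 - 2^(s-1)).\<close>

definition flatness :: "real \<Rightarrow> real \<Rightarrow> real" where
  "flatness s \<epsilon> = min (2 powr (1 - s)) (1 + \<epsilon> powr s * (1 - 2 powr (s - 1)))"

lemma sum_powr_ge_flatness_unit: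
  fixes t :: "'i \<Rightarrow> real"
  assumes "finite J" "0 < s" "s \<le> 1" "0 < \<epsilon>" "\<And>j. j \<in> J \<Longrightarrow> 0 \<le> t j" "\<And>j. j \<in> J \<Longrightarrow> t j \<le> 1 - \<epsilon>"
    and "(\<Sum>j\<in>J. t j) = 1"
  shows "flatness s \<epsilon> \<le> (\<Sum>j\<in>J. t j powr s)"
proof (cases "\<forall>j\<in>J. t j \<le> 1 / 2")
  case True
  have "2 powr (1 - s) = (\<Sum>j\<in>J. t j * (1 / 2) powr (s - 1))"
    using assms(7) by (simp add: sum_distrib_right[symmetric] powr_divide powr_minus_divide[symmetric])
  also have "\<dots> \<le> (\<Sum>j\<in>J. t j powr s)"
    using True assms by (intro sum_mono powr_ge_linear) auto
  finally show ?thesis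
    by (simp add: flatness_def)
next
  case False
  then obtain i where i: "i \<in> J" "t i > 1 / 2"
    by force
  define u where "u = (\<Sum>j\<in>J - {i}. t j)"
  have u: "u = 1 - t i"
    using assms(1,7) i by (simp add: u_def sum_diff1)
  have u': "\<epsilon> \<le> u" "u \<le> 1 / 2" "u > 0"
    using u i assms(4) assms(6)[of i] by auto
  have others: "t j \<le> u" if "j \<in> J - {i}" for j
    unfolding u_def using that assms by (intro member_le_sum) auto
  have "u powr s = u * u powr (s - 1)"
    using u' by (simp add: powr_mult_base)
  also have "\<dots> = (\<Sum>j\<in>J - {i}. t j * u powr (s - 1))"
    by (subst u_def) (simp add: sum_distrib_right)
  also have "\<dots> \<le> (\<Sum>j\<in>J - {i}. t j powr s)"
    using others assms by (intro sum_mono powr_ge_linear) auto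
  finally have 1: "u powr s \<le> (\<Sum>j\<in>J - {i}. t j powr s)" .
  have 2: "1 - u \<le> t i powr s"
    using powr_ge_linear[of "t i" 1 s] assms u u' i by simp
  have "u = u powr s * u powr (1 - s)"
    using u' by (simp add: powr_add[symmetric])
  also have "\<dots> \<le> u powr s * (1 / 2) powr (1 - s)"
    using u' assms by (intro mult_left_mono powr_mono2) auto
  also have "(1 / 2) powr (1 - s) = 2 powr (s - 1)"
    by (simp add: powr_divide powr_minus_divide[symmetric])
  finally have "u powr s * (1 - 2 powr (s - 1)) \<le> u powr s - u"
    by (simp add: algebra_simps)
  moreover have "\<epsilon> powr s * (1 - 2 powr (s - 1)) \<le> u powr s * (1 - 2 powr (s - 1))"
    using u' assms powr_mono[of "s - 1" 0 2] by (intro mult_right_mono powr_mono2) auto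
  ultimately have "1 + \<epsilon> powr s * (1 - 2 powr (s - 1)) \<le> (\<Sum>j\<in>J. t j powr s)"
    using 1 2 assms(1) i by (simp add: sum.remove)
  then show ?thesis
    by (simp add: flatness_def)
qed

lemma sum_powr_ge_flatness:
  fixes t :: "'i \<Rightarrow> real"
  assumes "finite J" "0 < s" "s \<le> 1" "0 < \<epsilon>" "\<And>j. j \<in> J \<Longrightarrow> 0 \<le> t j"
    and "\<And>j. j \<in> J \<Longrightarrow> t j \<le> (1 - \<epsilon>) * (\<Sum>j\<in>J. t j)"
  shows "flatness s \<epsilon> * (\<Sum>j\<in>J. t j) powr s \<le> (\<Sum>j\<in>J. t j powr s)"
proof (cases "(\<Sum>j\<in>J. t j) = 0")
  case True
  then show ?thesis
    by (simp add: sum_nonneg)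
next
  case False
  define A where "A = (\<Sum>j\<in>J. t j)"
  have A: "A > 0"
    using False assms(5) sum_nonneg[of J t] unfolding A_def by fastforce
  have "flatness s \<epsilon> \<le> (\<Sum>j\<in>J. (t j / A) powr s)"
    using assms A by (intro sum_powr_ge_flatness_unit) 
      (auto simp: A_def[symmetric] sum_divide_distrib[symmetric] divide_le_eq)
  also have "\<dots> = (\<Sum>j\<in>J. t j powr s) / A powr s"
    using assms(5) A by (simp add: powr_divide sum_divide_distrib)
  finally show ?thesis
    using A by (simp add: A_def[symmetric] field_simps)
qed

text \<open>With n = m + 1, flatness gains a term of order n^(-s) over 1, while the lost dimension
  costs the factor (1 - 1/n)^s \<ge> 1 - 1/n. For s < 1 the gain wins when n is large; with s = q/2
  this is where q < 2 enters.\<close>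

lemma flatness_large:
  fixes s :: real
  assumes "0 < s" "s < 1"
  obtains m :: nat where "m > 0" "flatness s (1 / real (m + 1)) * (real m / real (m + 1)) powr s > 1"
proof -
  define \<delta> where "\<delta> = 1 - 2 powr (s - 1)"
  have \<delta>: "\<delta> > 0" "\<delta> < 1"
    using assms powr_less_mono[of "s - 1" 0 2] by (auto simp: \<delta>_def)
  \<comment> \<open>The bound n > 1 / \<delta> settles the first branch of the minimum. The last
    requirement gives \<delta> * n^(-s) \<ge> 3 / n, which outweighs the loss 1 / n in the second
    branch.\<close>
  obtain m :: nat where m: "real m \<ge> max 1 (max (1 / \<delta>) ((3 / \<delta>) powr (1 / (1 - s))))"
    using real_arch_simple by blast
  define n where "n = real (m + 1)"
  have n: "n \<ge> 2" "n > 1 / \<delta>" "n \<ge> (3 / \<delta>) powr (1 / (1 - s))" "real m = n - 1"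
    using m by (auto simp: n_def)
  have frac: "(real m / n) powr s \<ge> 1 - 1 / n"
  proof -
    have "(real m / n) powr 1 \<le> (real m / n) powr s"
      using n assms by (intro powr_mono') auto
    moreover have "(real m / n) powr 1 = 1 - 1 / n"
      using n by (simp add: field_simps)
    ultimately show ?thesis
      by simp
  qed
  have frac0: "1 - 1 / n > 0"
    using n by (simp add: field_simps)
  have "2 powr (1 - s) * (1 - 1 / n) > 1"
  proof -
    have "1 / n < \<delta>"
      using n \<delta> by (simp add: field_simps)
    then have "2 powr (1 - s) * (1 - 1 / n) > 2 powr (1 - s) * 2 powr (s - 1)"
      unfolding \<delta>_def by (intro mult_strict_left_mono) auto
    then show ?thesis
      by (simp add: powr_add[symmetric])
  qed
  moreover have "(1 + (1 / n) powr s * \<delta>) * (1 - 1 / n) > 1"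
  proof -
    have "3 / \<delta> = ((3 / \<delta>) powr (1 / (1 - s))) powr (1 - s)"
      using assms \<delta> by (simp add: powr_powr)
    also have "\<dots> \<le> n powr (1 - s)"
      using n assms by (intro powr_mono2) auto
    also have "\<dots> = n * (1 / n) powr s"
      using n by (simp add: powr_diff powr_divide)
    finally have "3 \<le> n * ((1 / n) powr s * \<delta>)"
      using \<delta> by (simp add: field_simps)
    then have "3 / n \<le> (1 / n) powr s * \<delta>"
      using n by (simp add: field_simps)
    then have "(1 + 3 / n) * (1 - 1 / n) \<le> (1 + (1 / n) powr s * \<delta>) * (1 - 1 / n)"
      using frac0 by (intro mult_right_mono) auto
    moreover have "(1 + 3 / n) * (1 - 1 / n) > 1"
    proof -
      have "(1 + 3 / n) * (1 - 1 / n) - 1 = (2 * n - 3) / (n * n)"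
        using n by (simp add: field_simps)
      moreover have "\<dots> > 0"
        using n by (intro divide_pos_pos) auto
      ultimately show ?thesis
        by linarith
    qed
    ultimately show ?thesis
      by linarith
  qed
  ultimately have "flatness s (1 / n) * (1 - 1 / n) > 1"
    by (auto simp: flatness_def min_def \<delta>_def)
  moreover have "flatness s (1 / n) * (1 - 1 / n) \<le> flatness s (1 / n) * (real m / n) powr s"
    using frac \<delta> by (intro mult_left_mono) (auto simp: flatness_def \<delta>_def)
  ultimately show ?thesis
    using m that[of m] by (simp add: n_def)
qed

text \<open>
  The first \<open>m\<close> columns of the reflection exchanging the last basis vector with the normalized
  constant vector form an orthonormal basis of the mean zero vectors of \<open>\<real>\<^sup>m\<^sup>+\<^sup>1\<close>.
\<close>

lemma flat_matrix_mean_zero: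
  assumes "0 < q" "q \<le> 2" "m > 0"
  obtains x where "flat_matrix q (flatness (q / 2) (1 / real (m + 1))) {..<m} {..m} x"
proof -
  define n where "n = real (m + 1)"
  define \<beta> where "\<beta> = 1 / sqrt n"
  define \<alpha> where "\<alpha> = (1 - \<beta>) / real m"
  define x where "x k j = (if j = m then - \<beta> else (if j = k then 1 else 0) - \<alpha>)" for k j
  have \<beta>: "\<beta>\<^sup>2 = 1 / n"
    by (simp add: \<beta>_def n_def power_divide)
  have m\<alpha>: "real m * \<alpha> = 1 - \<beta>"
    using assms by (simp add: \<alpha>_def)
  \<comment> \<open>The left-hand side is the amount by which the inner product of two rows of
    \<open>x\<close> differs from that of two basis vectors; its vanishing makes the rows
    orthonormal.\<close>
  have key: "real m * \<alpha>\<^sup>2 - 2 * \<alpha> + \<beta>\<^sup>2 = 0"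
  proof -
    have "real m * (real m * \<alpha>\<^sup>2 - 2 * \<alpha> + \<beta>\<^sup>2) = (real m * \<alpha>)\<^sup>2 - 2 * (real m * \<alpha>) + real m * \<beta>\<^sup>2"
      by (simp add: algebra_simps power2_eq_square)
    also have "\<dots> = n * \<beta>\<^sup>2 - 1"
      unfolding m\<alpha> by (simp add: n_def algebra_simps power2_eq_square)
    also have "\<dots> = 0"
      unfolding \<beta> by (simp add: n_def)
    finally show ?thesis
      using assms by simp
  qed
  have entry: "(\<Sum>k<m. a k * x k j) = (if j = m then - \<beta> * (\<Sum>k<m. a k) else a j - \<alpha> * (\<Sum>k<m. a k))"
    if "j \<le> m" for a j
  proof (cases "j = m")
    case False
    then have "(\<Sum>k<m. a k * x k j) = (\<Sum>k<m. (if j = k then a k else 0) - \<alpha> * a k)"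
      unfolding x_def by (intro sum.cong) (auto simp: algebra_simps)
    then show ?thesis
      using False that by (simp add: sum_subtractf sum_distrib_left)
  qed (simp add: x_def sum_distrib_left sum_negf mult.commute)
  have iso: "(\<Sum>j\<le>m. (\<Sum>k<m. a k * x k j)\<^sup>2) = (\<Sum>k<m. (a k)\<^sup>2)" for a
  proof -
    define S where "S = (\<Sum>k<m. a k)"
    have "(\<Sum>j\<le>m. (\<Sum>k<m. a k * x k j)\<^sup>2) = (\<Sum>j<m. (a j - \<alpha> * S)\<^sup>2) + (\<beta> * S)\<^sup>2"
      unfolding lessThan_Suc_atMost[symmetric] S_def by (simp add: entry power_mult_distrib)
    also have "(\<Sum>j<m. (a j - \<alpha> * S)\<^sup>2) = (\<Sum>j<m. (a j)\<^sup>2) - 2 * \<alpha> * S * S + real m * (\<alpha> * S)\<^sup>2"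
      by (simp add: power2_diff sum.distrib sum_subtractf sum_distrib_left[symmetric] sum_distrib_right[symmetric]
          mult_ac S_def)
    also have "\<dots> + (\<beta> * S)\<^sup>2 = (\<Sum>j<m. (a j)\<^sup>2) + S\<^sup>2 * (real m * \<alpha>\<^sup>2 - 2 * \<alpha> + \<beta>\<^sup>2)"
      by (simp add: algebra_simps power2_eq_square)
    finally show ?thesis
      by (simp add: key)
  qed
  \<comment> \<open>Bessel's inequality for orthonormal rows: \<open>u\<close> is the orthogonal
    projection of \<open>t\<close> onto their span, and the squared norm of \<open>t - u\<close> is
    nonnegative.\<close>
  have bessel: "(\<Sum>k<m. (\<Sum>j\<le>m. x k j * t j)\<^sup>2) \<le> (\<Sum>j\<le>m. (t j)\<^sup>2)" for t
  proof -
    define c where "c k = (\<Sum>j\<le>m. x k j * t j)" for k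
    define u where "u j = (\<Sum>k<m. c k * x k j)" for j
    have "(\<Sum>j\<le>m. t j * u j) = (\<Sum>k<m. (c k)\<^sup>2)"
      unfolding u_def sum_distrib_left
      by (subst sum.swap) (simp add: c_def power2_eq_square sum_distrib_left mult_ac)
    moreover have "(\<Sum>j\<le>m. (u j)\<^sup>2) = (\<Sum>k<m. (c k)\<^sup>2)"
      unfolding u_def by (rule iso)
    moreover have "0 \<le> (\<Sum>j\<le>m. (t j - u j)\<^sup>2)"
      by (intro sum_nonneg) auto
    moreover have "(\<Sum>j\<le>m. (t j - u j)\<^sup>2) = (\<Sum>j\<le>m. (t j)\<^sup>2) - 2 * (\<Sum>j\<le>m. t j * u j) + (\<Sum>j\<le>m. (u j)\<^sup>2)"
      by (simp add: power2_diff sum.distrib sum_subtractf sum_distrib_left mult_ac)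
    ultimately show ?thesis
      unfolding c_def by linarith
  qed
  \<comment> \<open>This is the squared length of the projection of a basis vector to the mean zero
    vectors. Through Cauchy-Schwarz it prevents any coordinate from carrying more than the share 1 -
    1/n of the squares, as flatness with \<epsilon> = 1/n demands.\<close>
  have column: "(\<Sum>k<m. (x k j)\<^sup>2) = 1 - 1 / n" if "j \<le> m" for j
  proof (cases "j = m")
    case True
    then show ?thesis
      using \<beta> by (simp add: x_def n_def field_simps)
  next
    case False
    then have "(\<Sum>k<m. (x k j)\<^sup>2) = (\<Sum>k<m. (if j = k then 1 - 2 * \<alpha> else 0) + \<alpha>\<^sup>2)"
      unfolding x_def by (intro sum.cong) (auto simp: power2_eq_square algebra_simps)
    also have "\<dots> = 1 - 2 * \<alpha> + real m * \<alpha>\<^sup>2"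
      using False that by (simp add: sum.distrib)
    finally show ?thesis
      using key \<beta> by linarith
  qed
  have "flatness (q / 2) (1 / n) * (\<Sum>k<m. \<Sum>l\<in>L. (a k l)\<^sup>2) powr (q / 2)
      \<le> (\<Sum>j\<le>m. (\<Sum>l\<in>L. (\<Sum>k<m. a k l * x k j)\<^sup>2) powr (q / 2))" for L :: "nat set" and a
  proof -
    define t where "t j = (\<Sum>l\<in>L. (\<Sum>k<m. a k l * x k j)\<^sup>2)" for j
    define A where "A = (\<Sum>k<m. \<Sum>l\<in>L. (a k l)\<^sup>2)"
    have t_nonneg: "t j \<ge> 0" for j
      by (simp add: t_def sum_nonneg)
    have "(\<Sum>j\<le>m. t j) = (\<Sum>l\<in>L. \<Sum>j\<le>m. (\<Sum>k<m. a k l * x k j)\<^sup>2)"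
      unfolding t_def by (rule sum.swap)
    also have "\<dots> = A"
      unfolding iso A_def by (rule sum.swap)
    finally have t_sum: "(\<Sum>j\<le>m. t j) = A" .
    have "t j \<le> (1 - 1 / n) * A" if "j \<le> m" for j
    proof -
      have "t j \<le> (\<Sum>l\<in>L. (\<Sum>k<m. (a k l)\<^sup>2) * (\<Sum>k<m. (x k j)\<^sup>2))"
        unfolding t_def by (intro sum_mono Cauchy_Schwarz_ineq_sum)
      also have "\<dots> = (1 - 1 / n) * A"
        unfolding column[OF that] A_def
        by (simp only: sum_distrib_right[symmetric] mult.commute[of "1 - 1 / n"] sum.swap[of _ L])
      finally show ?thesis .
    qed
    then have "flatness (q / 2) (1 / n) * (\<Sum>j\<le>m. t j) powr (q / 2) \<le> (\<Sum>j\<le>m. t j powr (q / 2))"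
      using assms by (intro sum_powr_ge_flatness) (auto simp: t_sum n_def t_nonneg)
    then show ?thesis
      unfolding t_sum by (simp add: A_def t_def)
  qed
  then have "flat_matrix q (flatness (q / 2) (1 / real (m + 1))) {..<m} {..m} x"
    using bessel unfolding flat_matrix_def n_def by auto
  then show ?thesis
    by (rule that)
qed

section \<open>Spread families in \<open>\<ell>\<^sub>q\<^sup>n\<close>\<close>

lemma spread_family_mono:
  assumes "spread_family p \<eta> I x" "\<eta> \<le> \<eta>'"
  shows "spread_family p \<eta>' I x"
proof -
  have "\<eta> * B \<le> \<eta>' * B" if "B \<ge> 0" for B
    using assms(2) that by (rule mult_right_mono)
  then show ?thesis
    using assms(1) unfolding spread_family_def by (meson order_trans)
qed

text \<open>The factor \<open>c powr (- 1 / q)\<close> normalizes the lower l_2 estimate. For the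
  averages, let M and D be the numbers of rows and columns. Cauchy-Schwarz and Bessel bound the
  average for one functional by M^(-1/2) times the l_2 norm of its values at the \<open>y j\<close>,
  and Jensen passes to their p-th powers. Summed over all functionals, each \<open>y j\<close>
  contributes at most (B * C)^p, so the D columns give (D / M)^(1/2) altogether.\<close>

lemma spread_family_lq:
  fixes y :: "nat \<Rightarrow> 'a::real_normed_vector"
  assumes p: "p \<ge> 2" and q: "q \<ge> 1" and flat: "flat_matrix q c K J x" and c: "c > 0"
    and ne: "K \<noteq> {}" "J \<noteq> {}"
    and lower: "\<And>a. lp_sum q J a \<le> norm (\<Sum>j\<in>J. a j *\<^sub>R y j)"
    and upper: "\<And>j. j \<in> J \<Longrightarrow> norm (y j) \<le> C" and C: "C \<ge> 0"
  shows "spread_family p (c powr (- 1 / q) * C * (real (card J) / real (card K)) powr (1 / 2)) K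
    (\<lambda>k. c powr (- 1 / q) *\<^sub>R (\<Sum>j\<in>J. x k j *\<^sub>R y j))"
proof -
  define \<mu> where "\<mu> = c powr (- 1 / q)"
  have "\<mu> powr q = c powr - 1"
    using q by (simp only: \<mu>_def powr_powr) simp
  then have \<mu>: "\<mu> > 0" "\<mu> powr q = 1 / c"
    using c by (auto simp: \<mu>_def powr_minus_divide)
  have fin: "finite K" "finite J"
    using flat by (auto simp: flat_matrix_def)
  define M where "M = real (card K)"
  define D where "D = real (card J)"
  have MD: "M > 0" "D > 0"
    using fin ne by (auto simp: M_def D_def card_gt_0_iff)
  define z where "z k = \<mu> *\<^sub>R (\<Sum>j\<in>J. x k j *\<^sub>R y j)" for k
  have "L2_set a K \<le> norm (\<Sum>k\<in>K. a k *\<^sub>R z k)" for a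
  proof -
    define b where "b j = \<mu> * (\<Sum>k\<in>K. a k * x k j)" for j
    have z_eq: "(\<Sum>k\<in>K. a k *\<^sub>R z k) = (\<Sum>j\<in>J. b j *\<^sub>R y j)"
    proof -
      have "(\<Sum>k\<in>K. a k *\<^sub>R z k) = (\<Sum>k\<in>K. \<Sum>j\<in>J. (\<mu> * (a k * x k j)) *\<^sub>R y j)"
        unfolding z_def by (simp add: scaleR_sum_right mult_ac)
      also have "\<dots> = (\<Sum>j\<in>J. b j *\<^sub>R y j)"
        by (subst sum.swap) (simp add: b_def scaleR_sum_left sum_distrib_left)
      finally show ?thesis .
    qed
    define s where "s = (\<Sum>k\<in>K. (a k)\<^sup>2)"
    have s: "s \<ge> 0"
      by (simp add: s_def sum_nonneg)
    have "c * s powr (q / 2) \<le> (\<Sum>j\<in>J. \<bar>\<Sum>k\<in>K. a k * x k j\<bar> powr q)"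
      using flat_matrix_lower[OF flat, of "{0::nat}" "\<lambda>k _. a k"] by (simp add: s_def power2_powr_half)
    then have "\<mu> powr q * (c * s powr (q / 2)) \<le> \<mu> powr q * (\<Sum>j\<in>J. \<bar>\<Sum>k\<in>K. a k * x k j\<bar> powr q)"
      by (intro mult_left_mono) auto
    moreover have "lp_sum q J b powr q = \<mu> powr q * (\<Sum>j\<in>J. \<bar>\<Sum>k\<in>K. a k * x k j\<bar> powr q)"
      using \<mu> q by (simp add: b_def[abs_def] lp_sum_cmult powr_mult lp_sum_powr)
    ultimately have "s powr (q / 2) \<le> lp_sum q J b powr q"
      using \<mu> c by simp
    then have "(s powr (q / 2)) powr (1 / q) \<le> (lp_sum q J b powr q) powr (1 / q)"
      using q by (intro powr_mono2) auto
    then have "s powr (1 / 2) \<le> lp_sum q J b"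
      using q by (simp add: powr_powr)
    then have "L2_set a K \<le> lp_sum q J b"
      using s by (simp add: L2_set_def s_def[symmetric] powr_half_sqrt)
    also have "\<dots> \<le> norm (\<Sum>j\<in>J. b j *\<^sub>R y j)"
      by (rule lower)
    finally show ?thesis
      unfolding z_eq .
  qed
  moreover have "lp_sum p {..<N} (\<lambda>i. (\<Sum>k\<in>K. \<bar>\<psi> i (z k)\<bar>) / real (card K)) \<le> \<mu> * C * (D / M) powr (1 / 2) * B"
    if B: "B \<ge> 0" and lin: "\<And>i. i < N \<Longrightarrow> bounded_linear (\<psi> i)"
      and \<psi>: "\<And>y. lp_sum p {..<N} (\<lambda>i. \<psi> i y) \<le> B * norm y" for N :: nat and \<psi> B
  proof -
    define \<tau> where "\<tau> i j = \<psi> i (y j)" for i j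
    have row: "\<bar>(\<Sum>k\<in>K. \<bar>\<psi> i (z k)\<bar>) / M\<bar> powr p
        \<le> \<mu> powr p * (1 / M) powr (p / 2) * D powr (p / 2 - 1) * (\<Sum>j\<in>J. \<bar>\<tau> i j\<bar> powr p)" if "i < N" for i
    proof -
      interpret bounded_linear "\<psi> i"
        using lin that .
      define w where "w k = (\<Sum>j\<in>J. x k j * \<tau> i j)" for k
      have \<psi>z: "\<psi> i (z k) = \<mu> * w k" for k
        by (simp add: z_def w_def \<tau>_def scaleR sum)
      have "(\<Sum>k\<in>K. \<bar>w k\<bar>)\<^sup>2 \<le> M * (\<Sum>k\<in>K. (w k)\<^sup>2)"
        using Cauchy_Schwarz_ineq_sum[of "\<lambda>_. 1" "\<lambda>k. \<bar>w k\<bar>" K] by (simp add: M_def)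
      also have "\<dots> \<le> M * (\<Sum>j\<in>J. (\<tau> i j)\<^sup>2)"
        unfolding w_def using MD by (intro mult_left_mono flat_matrix_bessel[OF flat]) auto
      finally have "((\<Sum>k\<in>K. \<bar>w k\<bar>) / M)\<^sup>2 \<le> (1 / M) * (\<Sum>j\<in>J. (\<tau> i j)\<^sup>2)"
        using MD by (simp add: power_divide power2_eq_square field_simps)
      then have "(((\<Sum>k\<in>K. \<bar>w k\<bar>) / M)\<^sup>2) powr (p / 2) \<le> ((1 / M) * (\<Sum>j\<in>J. (\<tau> i j)\<^sup>2)) powr (p / 2)"
        using p by (intro powr_mono2) auto
      also have "(((\<Sum>k\<in>K. \<bar>w k\<bar>) / M)\<^sup>2) powr (p / 2) = ((\<Sum>k\<in>K. \<bar>w k\<bar>) / M) powr p"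
        using MD by (simp add: power2_powr_half sum_nonneg)
      also have "((1 / M) * (\<Sum>j\<in>J. (\<tau> i j)\<^sup>2)) powr (p / 2) = (1 / M) powr (p / 2) * (\<Sum>j\<in>J. (\<tau> i j)\<^sup>2) powr (p / 2)"
        by (rule powr_mult)
      finally have 1: "((\<Sum>k\<in>K. \<bar>w k\<bar>) / M) powr p \<le> (1 / M) powr (p / 2) * (\<Sum>j\<in>J. (\<tau> i j)\<^sup>2) powr (p / 2)" .
      have 2: "(\<Sum>j\<in>J. (\<tau> i j)\<^sup>2) powr (p / 2) \<le> D powr (p / 2 - 1) * (\<Sum>j\<in>J. \<bar>\<tau> i j\<bar> powr p)"
      proof -
        show ?thesis
          using jensen_powr[OF fin(2), of "p / 2" "\<lambda>j. (\<tau> i j)\<^sup>2"] p by (simp add: power2_powr_half D_def sum_nonneg)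
      qed
      have "\<bar>(\<Sum>k\<in>K. \<bar>\<psi> i (z k)\<bar>) / M\<bar> powr p = \<mu> powr p * ((\<Sum>k\<in>K. \<bar>w k\<bar>) / M) powr p"
        unfolding \<psi>z using \<mu> MD
        by (simp add: abs_mult sum_distrib_left[symmetric] powr_mult[symmetric] sum_nonneg)
      also have "\<dots> \<le> \<mu> powr p * ((1 / M) powr (p / 2) * (D powr (p / 2 - 1) * (\<Sum>j\<in>J. \<bar>\<tau> i j\<bar> powr p)))"
        by (intro mult_left_mono order_trans[OF 1 mult_left_mono[OF 2]]) auto
      finally show ?thesis
        by (simp add: mult_ac)
    qed
    have col: "(\<Sum>i<N. \<bar>\<tau> i j\<bar> powr p) \<le> (B * C) powr p" if "j \<in> J" for j
    proof -
      have "lp_sum p {..<N} (\<lambda>i. \<tau> i j) \<le> B * norm (y j)"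
        unfolding \<tau>_def by (rule \<psi>)
      also have "\<dots> \<le> B * C"
        using upper[OF that] B by (rule mult_left_mono)
      finally show ?thesis
        using p B C by (subst (asm) lp_sum_le_iff) auto
    qed
    have "(\<Sum>i<N. \<bar>(\<Sum>k\<in>K. \<bar>\<psi> i (z k)\<bar>) / M\<bar> powr p)
        \<le> (\<Sum>i<N. \<mu> powr p * (1 / M) powr (p / 2) * D powr (p / 2 - 1) * (\<Sum>j\<in>J. \<bar>\<tau> i j\<bar> powr p))"
      using row by (intro sum_mono) auto
    also have "\<dots> = \<mu> powr p * (1 / M) powr (p / 2) * D powr (p / 2 - 1) * (\<Sum>j\<in>J. \<Sum>i<N. \<bar>\<tau> i j\<bar> powr p)"
      by (simp only: sum_distrib_left[symmetric] sum.swap[of _ J])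
    also have "\<dots> \<le> \<mu> powr p * (1 / M) powr (p / 2) * D powr (p / 2 - 1) * (\<Sum>j\<in>J. (B * C) powr p)"
      using col by (intro mult_left_mono sum_mono) auto
    also have "\<dots> = \<mu> powr p * (1 / M) powr (p / 2) * D powr (p / 2) * (B * C) powr p"
      using MD by (simp add: D_def[symmetric] powr_diff)
    also have "\<dots> = (\<mu> * C * (D / M) powr (1 / 2) * B) powr p"
      using \<mu> MD B C by (simp add: powr_mult powr_divide powr_powr mult_ac)
    finally show ?thesis
      using p \<mu> C B MD by (subst lp_sum_le_iff) (auto simp: M_def)
  qed
  ultimately show ?thesis
    using fin ne unfolding spread_family_def z_def \<mu>_def M_def D_def by auto
qed

lemma lq_system_constant_pos:
  assumes "q \<in> {\<infinity>} \<union> {1..<2}" "lq_system q C 1 y"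
  shows "C > 0"
proof -
  have "1 \<le> lq_norm q 1 (\<lambda>_. 1)"
    using abs_le_lq_norm[OF assms(1), of 0 1 "\<lambda>_. 1"] by simp
  moreover have "lq_norm q 1 (\<lambda>_. 1) \<le> C * lq_norm q 1 (\<lambda>_. 1)"
    using assms(2) unfolding lq_system_def by (meson order_trans)
  ultimately have "0 < C * lq_norm q 1 (\<lambda>_. 1)"
    by linarith
  then show ?thesis
    using \<open>1 \<le> lq_norm q 1 (\<lambda>_. 1)\<close> by (simp add: zero_less_mult_iff)
qed

lemma lq_system_reindex:
  assumes "lq_system q C (card J) y" "bij_betw h J {..<card J}"
  shows "lq_norm q (card J) (a \<circ> inv_into J h) \<le> norm (\<Sum>j\<in>J. a j *\<^sub>R y (h j))"
    and "norm (\<Sum>j\<in>J. a j *\<^sub>R y (h j)) \<le> C * lq_norm q (card J) (a \<circ> inv_into J h)"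
proof -
  have "(\<Sum>i<card J. (a \<circ> inv_into J h) i *\<^sub>R y i) = (\<Sum>j\<in>J. (a \<circ> inv_into J h) (h j) *\<^sub>R y (h j))"
    using sum.reindex_bij_betw[OF assms(2), of "\<lambda>i. (a \<circ> inv_into J h) i *\<^sub>R y i"] by simp
  also have "\<dots> = (\<Sum>j\<in>J. a j *\<^sub>R y (h j))"
    using assms(2) by (intro sum.cong) (auto simp: bij_betw_def)
  finally show "lq_norm q (card J) (a \<circ> inv_into J h) \<le> norm (\<Sum>j\<in>J. a j *\<^sub>R y (h j))"
    "norm (\<Sum>j\<in>J. a j *\<^sub>R y (h j)) \<le> C * lq_norm q (card J) (a \<circ> inv_into J h)"
    using assms(1) unfolding lq_system_def by metis+
qed

lemma spread_family_exists:
  fixes \<Phi> :: "('a::real_normed_vector \<Rightarrow> real) set"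
  assumes p: "p \<ge> 2" and q: "q \<in> {\<infinity>} \<union> {1..<2}" and sys: "\<And>n. \<exists>y :: nat \<Rightarrow> 'a. lq_system q C n y"
    and \<Phi>: "finite \<Phi>" "\<Phi> \<subseteq> Collect bounded_linear" and \<eta>: "\<eta> > 0"
  obtains m :: nat and x :: "nat \<Rightarrow> 'a" where "spread_family p \<eta> {..<m} x" "\<And>\<phi> j. \<phi> \<in> \<Phi> \<Longrightarrow> \<phi> (x j) = 0"
proof -
  have C: "C > 0"
    using sys lq_system_constant_pos[OF q] by blast
  have kernel_sys: "\<exists>y :: nat \<Rightarrow> 'a. lq_system q C n y \<and> (\<forall>\<phi>\<in>\<Phi>. \<forall>j. \<phi> (y j) = 0)" for n
    using lq_system_in_kernel[OF q sys \<Phi>] .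
  have \<Phi>_lin: "linear \<phi>" if "\<phi> \<in> \<Phi>" for \<phi>
    using \<Phi> that by (auto intro: bounded_linear.linear)
  note result = that
  have finish: thesis if fam: "spread_family p \<eta> I x" and ker: "\<And>\<phi> j. \<phi> \<in> \<Phi> \<Longrightarrow> \<phi> (x j) = 0"
    for I :: "'i set" and x
  proof -
    have "finite I"
      using fam by (simp add: spread_family_def)
    then obtain h where h: "bij_betw h {..<card I} I"
      using ex_bij_betw_nat_finite by (metis atLeast0LessThan)
    show thesis
      using result[OF spread_family_reindex[OF fam h]] ker by simp
  qed
  from q show ?thesis
  proof (cases rule: exponent_cases)
    case 1
    obtain r0 :: nat where r0: "(2 * C / \<eta>) powr p \<le> real r0"
      using real_arch_simple by blast
    define r where "r = Suc r0"
    define J where "J = (UNIV :: bool set) \<times> row_selections r"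
    have "finite J"
      by (simp add: J_def finite_row_selections)
    then obtain h where h: "bij_betw h J {..<card J}"
      using ex_bij_betw_finite_nat by (metis atLeast0LessThan)
    obtain y :: "nat \<Rightarrow> 'a" where y: "lq_system \<infinity> C (card J) y" "\<And>\<phi> j. \<phi> \<in> \<Phi> \<Longrightarrow> \<phi> (y j) = 0"
      using kernel_sys 1 by blast
    note re = lq_system_reindex[OF y(1) h]
    have lower: "\<bar>a j\<bar> \<le> norm (\<Sum>j\<in>J. a j *\<^sub>R y (h j))" if "j \<in> J" for a j
    proof -
      have "h j < card J" "inv_into J h (h j) = j"
        using h that by (auto simp: bij_betw_def)
      then have "\<bar>a j\<bar> \<le> lq_norm \<infinity> (card J) (a \<circ> inv_into J h)"
        using abs_le_lq_norm[of \<infinity> "h j" "card J" "a \<circ> inv_into J h"] by simp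
      then show ?thesis
        using re(1)[of a] by linarith
    qed
    have upper: "norm (\<Sum>j\<in>J. a j *\<^sub>R y (h j)) \<le> C * B" if "B \<ge> 0" "\<And>j. j \<in> J \<Longrightarrow> \<bar>a j\<bar> \<le> B" for a B
    proof -
      have "inv_into J h i \<in> J" if "i < card J" for i
        using h that by (auto simp: bij_betw_def intro: inv_into_into)
      then have "lq_norm \<infinity> (card J) (a \<circ> inv_into J h) \<le> B"
        using that by (simp add: lq_norm_infinity_le_iff)
      then have "C * lq_norm \<infinity> (card J) (a \<circ> inv_into J h) \<le> C * B"
        using C by (intro mult_left_mono) auto
      then show ?thesis
        using re(2)[of a] by linarith
    qed
    have "spread_family p \<eta> ({..<r} \<times> {..<r})
        (\<lambda>k. \<Sum>(b, \<omega>)\<in>J. (if b then \<omega> (prod.swap k) else \<omega> k) *\<^sub>R (y \<circ> h) (b, \<omega>))"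
      using p \<eta> C r0 lower upper
      by (intro spread_family_l_infinity[where C = C]) (auto simp: J_def r_def)
    then show ?thesis
    proof (rule finish)
      fix \<phi> and k :: "nat \<times> nat" assume "\<phi> \<in> \<Phi>"
      note y(2)[OF this] \<Phi>_lin[OF this]
      then show "\<phi> (\<Sum>(b, \<omega>)\<in>J. (if b then \<omega> (prod.swap k) else \<omega> k) *\<^sub>R (y \<circ> h) (b, \<omega>)) = 0"
        by (simp add: linear_sum linear_scale case_prod_beta)
    qed
  next
    case (2 r)
    obtain m :: nat where m: "m > 0" "flatness (r / 2) (1 / real (m + 1)) * (real m / real (m + 1)) powr (r / 2) > 1"
      using flatness_large[of "r / 2"] 2 by auto
    define \<kappa> where "\<kappa> = flatness (r / 2) (1 / real (m + 1))"
    have \<kappa>: "\<kappa> > 0" "\<kappa> * (real m / real (m + 1)) powr (r / 2) > 1"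
      using m zero_less_mult_pos2[of \<kappa> "(real m / real (m + 1)) powr (r / 2)"] by (auto simp: \<kappa>_def)
    obtain x0 where x0: "flat_matrix r \<kappa> {..<m} {..m} x0"
      using flat_matrix_mean_zero[of r m] 2 m unfolding \<kappa>_def by auto
    \<comment> \<open>The constant in \<open>spread_family_lq\<close> for the mean zero matrix
      itself, without \<open>C\<close>. Its ingredients are multiplicative under tensor powers, so
      the t-th power has constant \<open>C * \<rho> ^ t\<close>.\<close>
    define \<rho> where "\<rho> = \<kappa> powr (- 1 / r) * (real (m + 1) / real m) powr (1 / 2)"
    have "\<rho> > 0"
      using \<kappa> m by (simp add: \<rho>_def)
    have "\<rho> < 1"
    proof -
      have "\<rho> powr r = 1 / (\<kappa> * (real m / real (m + 1)) powr (r / 2))"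
        using \<kappa> m 2 by (simp add: \<rho>_def powr_mult powr_powr powr_divide powr_minus_divide)
      also have "\<dots> < 1"
        using \<kappa> by simp
      finally show ?thesis
        using 2 \<open>\<rho> > 0\<close> powr_mono2[of r 1 \<rho>] by fastforce
    qed
    then obtain t where t: "\<rho> ^ t < \<eta> / C"
      using real_arch_pow_inv[of "\<eta> / C" \<rho>] \<eta> C by auto
    obtain K J x where x: "flat_matrix r (\<kappa> ^ t) K J x" "card K = m ^ t" "card J = (m + 1) ^ t"
      using flat_matrix_power[OF x0, of t] \<kappa> by auto
    have fin: "finite K" "finite J" "K \<noteq> {}" "J \<noteq> {}"
      using x m by (auto simp: flat_matrix_def)
    then obtain h where h: "bij_betw h J {..<card J}"
      using ex_bij_betw_finite_nat by (metis atLeast0LessThan)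
    obtain y :: "nat \<Rightarrow> 'a" where y: "lq_system (ereal r) C (card J) y" "\<And>\<phi> j. \<phi> \<in> \<Phi> \<Longrightarrow> \<phi> (y j) = 0"
      using kernel_sys 2 by blast
    have lp: "lq_norm (ereal r) (card J) (a \<circ> inv_into J h) = lp_sum r J a" for a
    proof -
      have "(\<Sum>i<card J. \<bar>a (inv_into J h i)\<bar> powr r) = (\<Sum>j\<in>J. \<bar>a j\<bar> powr r)"
        using sum.reindex_bij_betw[OF bij_betw_inv_into[OF h], of "\<lambda>j. \<bar>a j\<bar> powr r"] .
      then show ?thesis
        by (simp add: lq_norm_ereal lp_sum_def)
    qed
    note re = lq_system_reindex[OF y(1) h, unfolded lp]
    have upper: "norm (y (h j)) \<le> C" if "j \<in> J" for j
    proof -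
      have "(\<Sum>i\<in>J. (if i = j then 1 else 0) *\<^sub>R y (h i)) = y (h j)"
        using fin that by (simp add: if_distrib[of "\<lambda>c. c *\<^sub>R _"] cong: if_cong)
      moreover have "lp_sum r J (\<lambda>i. if i = j then 1 else 0) = 1"
        using fin that 2 by (simp add: lp_sum_def if_distrib[of abs] if_distrib[of "\<lambda>c. c powr r"] cong: if_cong)
      ultimately show ?thesis
        using re(2)[of "\<lambda>i. if i = j then 1 else 0"] by simp
    qed
    have "spread_family p ((\<kappa> ^ t) powr (- 1 / r) * C * (real (card J) / real (card K)) powr (1 / 2)) K
        (\<lambda>k. (\<kappa> ^ t) powr (- 1 / r) *\<^sub>R (\<Sum>j\<in>J. x k j *\<^sub>R (y \<circ> h) j))"
      using p 2 x \<kappa> fin re upper C by (intro spread_family_lq) auto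
    moreover have "(\<kappa> ^ t) powr (- 1 / r) * C * (real (card J) / real (card K)) powr (1 / 2) \<le> \<eta>"
    proof -
      have pw: "(z ^ t) powr e = (z powr e) ^ t" if "z > 0" for z e :: real
        using that by (simp add: powr_realpow[symmetric] powr_powr mult.commute)
      have "(\<kappa> ^ t) powr (- 1 / r) = (\<kappa> powr (- 1 / r)) ^ t"
        using \<kappa> by (intro pw)
      moreover have "(real (card J) / real (card K)) powr (1 / 2) = ((real (m + 1) / real m) powr (1 / 2)) ^ t"
      proof -
        have "real (card J) / real (card K) = (real (m + 1) / real m) ^ t"
          unfolding x(2,3) by (simp only: power_divide of_nat_power)
        then show ?thesis
          using m by (simp only:) (intro pw, simp)
      qed
      ultimately have "(\<kappa> ^ t) powr (- 1 / r) * C * (real (card J) / real (card K)) powr (1 / 2) = C * \<rho> ^ t"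
        by (simp add: \<rho>_def power_mult_distrib)
      then show ?thesis
        using t C by (simp add: field_simps)
    qed
    ultimately have "spread_family p \<eta> K (\<lambda>k. (\<kappa> ^ t) powr (- 1 / r) *\<^sub>R (\<Sum>j\<in>J. x k j *\<^sub>R (y \<circ> h) j))"
      by (rule spread_family_mono)
    then show ?thesis
    proof (rule finish)
      fix \<phi> k assume "\<phi> \<in> \<Phi>"
      note y(2)[OF this] \<Phi>_lin[OF this]
      then show "\<phi> ((\<kappa> ^ t) powr (- 1 / r) *\<^sub>R (\<Sum>j\<in>J. x k j *\<^sub>R (y \<circ> h) j)) = 0"
        by (simp add: linear_sum linear_scale)
    qed
  qed
qed

section \<open>Biorthogonal systems of spread families\<close>

lemma contains_lq_uniformly_systems:
  assumes "q \<in> {\<infinity>} \<union> {1..<2}" "contains_lq_uniformly (UNIV :: 'a::real_normed_vector set) q"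
  obtains C where "\<And>n. \<exists>y :: nat \<Rightarrow> 'a. lq_system q C n y"
proof -
  obtain C where C: "\<And>n. \<exists>Z :: 'a set. closed_subspace Z \<and> C_isomorphic_lq C q n Z"
    using assms(2) unfolding contains_lq_uniformly_def by metis
  have "\<exists>y :: nat \<Rightarrow> 'a. lq_system q C n y" for n
    using C[of n] lq_system_of_isomorphic[OF assms(1)] unfolding closed_subspace_def by metis
  then show ?thesis
    by (rule that)
qed

lemma subspace_common_kernel:
  assumes "\<Phi> \<subseteq> Collect bounded_linear"
  shows "subspace {z. \<forall>\<phi>\<in>\<Phi>. \<phi> z = 0}"
proof -
  have "linear \<phi>" if "\<phi> \<in> \<Phi>" for \<phi>
    using assms that by (auto intro: bounded_linear.linear)
  then show ?thesis
    by (auto simp: subspace_def linear_0 linear_add linear_scale)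
qed

lemma span_image_lessThan:
  fixes x :: "nat \<Rightarrow> 'a::real_vector"
  assumes "v \<in> span (x ` {..<m})"
  obtains a where "v = (\<Sum>i<m. a i *\<^sub>R x i)"
proof -
  define R where "R = range (\<lambda>a. \<Sum>i<m. a i *\<^sub>R x i)"
  have "subspace R"
  proof (rule subspaceI)
    show "0 \<in> R"
      unfolding R_def by (intro image_eqI[of _ _ "\<lambda>_. 0"]) auto
    fix s t and c :: real
    assume "s \<in> R"
    then obtain a where a: "s = (\<Sum>i<m. a i *\<^sub>R x i)"
      by (auto simp: R_def)
    show "c *\<^sub>R s \<in> R"
      unfolding R_def a by (intro image_eqI[of _ _ "\<lambda>i. c * a i"]) (auto simp: scaleR_sum_right)
    assume "t \<in> R"
    then obtain b where b: "t = (\<Sum>i<m. b i *\<^sub>R x i)"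
      by (auto simp: R_def)
    show "s + t \<in> R"
      unfolding R_def a b
      by (intro image_eqI[of _ _ "\<lambda>i. a i + b i"]) (auto simp: scaleR_add_left sum.distrib)
  qed
  moreover have "x i \<in> R" if "i < m" for i
    unfolding R_def using that
    by (intro image_eqI[of _ _ "\<lambda>j. if j = i then 1 else 0"])
      (auto simp: if_distrib[of "\<lambda>c. c *\<^sub>R _"] cong: if_cong)
  ultimately have "span (x ` {..<m}) \<subseteq> R"
    by (intro span_minimal) auto
  then show ?thesis
    using assms that unfolding R_def by blast
qed

text \<open>
  The coordinate functionals of a stage of the construction: \<open>B\<close> spans the earlier stages, and
  \<open>\<Phi>\<close> annihilates the later ones.
\<close>

definition coordinate_functionals ::
    "'a::real_normed_vector set \<Rightarrow> ('a \<Rightarrow> real) set \<Rightarrow> nat \<Rightarrow> (nat \<Rightarrow> 'a) \<Rightarrow> (nat \<Rightarrow> 'a \<Rightarrow> real) \<Rightarrow> bool" where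
  "coordinate_functionals B \<Phi> m x f \<longleftrightarrow> (\<forall>j<m. bounded_linear (f j)) \<and>
    (\<forall>u\<in>span B. \<forall>a z. (\<forall>\<phi>\<in>\<Phi>. \<phi> z = 0) \<longrightarrow>
       (\<forall>j<m. f j (u + (\<Sum>i<m. a i *\<^sub>R x i) + z) = a j) \<and>
       L2_set a {..<m} \<le> 4 * norm (u + (\<Sum>i<m. a i *\<^sub>R x i) + z))"

text \<open>Let v be the combination of the family. \<open>\<Phi>'\<close> controls u + v against
  the later vectors, and \<open>\<Phi>\<close>, which annihilates v and z, controls u alone; the two
  factors 2 add up to 4 for v. This one bound makes the coordinates well defined and extends them to
  the whole space by Hahn-Banach.\<close>

lemma coordinate_functionals_exist:
  fixes x :: "nat \<Rightarrow> 'a::real_normed_vector"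
  assumes \<Phi>': "\<Phi>' \<subseteq> Collect bounded_linear" "\<Phi> \<subseteq> \<Phi>'"
    and norming: "\<And>u z. u \<in> span B \<Longrightarrow> (\<And>\<phi>. \<phi> \<in> \<Phi> \<Longrightarrow> \<phi> z = (0::real)) \<Longrightarrow> norm u \<le> 2 * norm (u + z)"
    and norming': "\<And>u z. u \<in> span (B \<union> x ` {..<m}) \<Longrightarrow> (\<And>\<phi>. \<phi> \<in> \<Phi>' \<Longrightarrow> \<phi> z = (0::real)) \<Longrightarrow> norm u \<le> 2 * norm (u + z)"
    and lower: "\<And>a. L2_set a {..<m} \<le> norm (\<Sum>j<m. a j *\<^sub>R x j)"
    and ker: "\<And>\<phi> j. \<phi> \<in> \<Phi> \<Longrightarrow> \<phi> (x j) = 0"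
  shows "\<exists>f. coordinate_functionals B \<Phi>' m x f"
proof -
  define Z where "Z = {z. \<forall>\<phi>\<in>\<Phi>'. \<phi> z = 0}"
  have Z: "subspace Z"
    unfolding Z_def by (rule subspace_common_kernel[OF \<Phi>'(1)])
  have lin: "linear \<phi>" if "\<phi> \<in> \<Phi>'" for \<phi>
    using \<Phi>'(1) that by (auto intro: bounded_linear.linear)
  have bound: "L2_set a {..<m} \<le> 4 * norm (u + (\<Sum>i<m. a i *\<^sub>R x i) + z)" if u: "u \<in> span B" and z: "z \<in> Z" for u a z
  proof -
    define v where "v = (\<Sum>i<m. a i *\<^sub>R x i)"
    have "v \<in> span (B \<union> x ` {..<m})"
      unfolding v_def by (intro span_sum span_scale span_base) auto
    moreover have "u \<in> span (B \<union> x ` {..<m})"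
      using u span_mono[of B "B \<union> x ` {..<m}"] by auto
    ultimately have 1: "norm (u + v) \<le> 2 * norm (u + v + z)"
      using z by (intro norming' span_add) (auto simp: Z_def)
    have "\<phi> (v + z) = 0" if "\<phi> \<in> \<Phi>" for \<phi>
    proof -
      have "\<phi> \<in> \<Phi>'"
        using that \<Phi>' by blast
      then have "linear \<phi>" "\<phi> z = 0"
        using lin z by (auto simp: Z_def)
      then show ?thesis
        using ker[OF that] by (simp add: v_def linear_add linear_sum linear_scale)
    qed
    then have 2: "norm u \<le> 2 * norm (u + v + z)"
      using norming[OF u, of "v + z"] by (simp add: add.assoc)
    have "norm v \<le> norm (u + v) + norm u"
      using norm_triangle_ineq4[of "u + v" u] by simp
    then show ?thesis
      using 1 2 lower[of a] unfolding v_def by linarith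
  qed
  define G where "G j = {(u + (\<Sum>i<m. a i *\<^sub>R x i) + z, a j) |u a z. u \<in> span B \<and> z \<in> Z}" for j
  have "\<exists>g. bounded_linear g \<and> (\<forall>s c. (s, c) \<in> G j \<longrightarrow> g s = c)" if "j < m" for j
  proof -
    have "subspace (G j)"
    proof (rule subspaceI)
      show "0 \<in> G j"
        unfolding G_def zero_prod_def using subspace_0[OF Z]
        by (intro CollectI exI[of _ 0] exI[of _ "\<lambda>_. 0"]) (auto simp: span_0)
      fix s c assume "s \<in> G j"
      then obtain u a z where s: "s = (u + (\<Sum>i<m. a i *\<^sub>R x i) + z, a j)" "u \<in> span B" "z \<in> Z"
        unfolding G_def by blast
      then have "c *\<^sub>R s = (c *\<^sub>R u + (\<Sum>i<m. (c * a i) *\<^sub>R x i) + c *\<^sub>R z, c * a j)"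
        by (simp add: scaleR_add_right scaleR_sum_right)
      then show "c *\<^sub>R s \<in> G j"
        unfolding G_def using s subspace_scale[OF Z] span_scale
        by (intro CollectI exI[of _ "c *\<^sub>R u"] exI[of _ "\<lambda>i. c * a i"] exI[of _ "c *\<^sub>R z"]) auto
      fix s' assume "s' \<in> G j"
      then obtain u' a' z' where s': "s' = (u' + (\<Sum>i<m. a' i *\<^sub>R x i) + z', a' j)" "u' \<in> span B" "z' \<in> Z"
        unfolding G_def by blast
      have "s + s' = ((u + u') + (\<Sum>i<m. (a i + a' i) *\<^sub>R x i) + (z + z'), a j + a' j)"
        unfolding s s' by (simp add: scaleR_add_left sum.distrib)
      then show "s + s' \<in> G j"
        unfolding G_def using s s' subspace_add[OF Z] span_add
        by (intro CollectI exI[of _ "u + u'"] exI[of _ "\<lambda>i. a i + a' i"] exI[of _ "z + z'"]) auto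
    qed
    moreover have "c \<le> 4 * norm s" if sc: "(s, c) \<in> G j" for s c
    proof -
      obtain u a z where s: "s = u + (\<Sum>i<m. a i *\<^sub>R x i) + z" "c = a j" "u \<in> span B" "z \<in> Z"
        using sc unfolding G_def by blast
      have "\<bar>a j\<bar> \<le> L2_set a {..<m}"
        using \<open>j < m\<close> member_le_L2_set[of "{..<m}" j "\<lambda>i. \<bar>a i\<bar>"] by (simp add: L2_set_def)
      then show ?thesis
        using bound[OF s(3,4), of a] unfolding s(1,2) by linarith
    qed
    ultimately show ?thesis
      using hahn_banach_graph[of "G j" 4] by (metis zero_le_numeral)
  qed
  then obtain f where f: "\<And>j. j < m \<Longrightarrow> bounded_linear (f j)" "\<And>j s c. j < m \<Longrightarrow> (s, c) \<in> G j \<Longrightarrow> f j s = c"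
    by metis
  have feq: "f j (u + (\<Sum>i<m. a i *\<^sub>R x i) + z) = a j" if "j < m" "u \<in> span B" "z \<in> Z" for j u a z
    using that by (intro f) (auto simp: G_def)
  have "coordinate_functionals B \<Phi>' m x f"
    using f(1) feq bound by (auto simp: coordinate_functionals_def Z_def)
  then show ?thesis
    by blast
qed

text \<open>By \<open>f_x0\<close> and \<open>f_earlier\<close> every vector of the span is
  annihilated by all coordinate functionals of late stages, and \<open>f_le\<close> transfers the
  decay to the closure. The bound \<open>f_le\<close> concerns the l_2 norm of the coordinates, the
  quantity that Khinchine's inequality turns into a weak p-norm. The constants
  \<open>(1 / 4) ^ k\<close> leave room for multiplying the averages by 2^k.\<close>

locale biorthogonal_spread_families =
  fixes p :: real and x0 :: "'a::real_normed_vector" and y0 :: "'a \<Rightarrow> real" and m :: "nat \<Rightarrow> nat"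
    and x :: "nat \<Rightarrow> nat \<Rightarrow> 'a" and f :: "nat \<Rightarrow> nat \<Rightarrow> 'a \<Rightarrow> real" and X :: "'a set"
  assumes p: "p \<ge> 2"
    and y0: "bounded_linear y0" "y0 x0 = 1" "y0 (x k j) = 0"
    and spread: "spread_family p ((1 / 4) ^ k) {..<m k} (x k)"
    and f_linear: "j < m k \<Longrightarrow> bounded_linear (f k j)"
    and f_x0: "j < m k \<Longrightarrow> f k j x0 = 0"
    and f_earlier: "j < m k \<Longrightarrow> l < k \<Longrightarrow> i < m l \<Longrightarrow> f k j (x l i) = 0"
    and f_own: "j < m k \<Longrightarrow> i < m k \<Longrightarrow> f k j (x k i) = (if i = j then 1 else 0)"
    and X_def: "X = closure (span (insert x0 (\<Union>k. x k ` {..<m k})))"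
    and f_le: "s \<in> X \<Longrightarrow> L2_set (\<lambda>j. f k j s) {..<m k} \<le> 4 * norm s"

lemma biorthogonal_spread_families_exist:
  assumes p: "p \<ge> 2" and q: "q \<in> {\<infinity>} \<union> {1..<2}"
    and Y: "contains_lq_uniformly (UNIV :: 'a::real_normed_vector set) q"
  shows "\<exists>(x0 :: 'a) y0 m x f X. biorthogonal_spread_families p x0 y0 m x f X"
proof -
  obtain C where C: "\<And>n. \<exists>y :: nat \<Rightarrow> 'a. lq_system q C n y"
    by (rule contains_lq_uniformly_systems[OF q Y]) blast
  obtain y where y: "lq_system q C 1 (y :: nat \<Rightarrow> 'a)"
    using C by blast
  have "norm (y 0) \<ge> 1"
  proof -
    have "1 \<le> lq_norm q 1 (\<lambda>_. 1)"
      using abs_le_lq_norm[OF q, of 0 1 "\<lambda>_. 1"] by simp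
    also have "\<dots> \<le> norm (\<Sum>j<1. 1 *\<^sub>R y j)"
      using y unfolding lq_system_def by blast
    finally show ?thesis
      by simp
  qed
  obtain y0 where y0: "bounded_linear y0" "y0 (y 0) = norm (y 0)"
    by (rule norming_functional[of "y 0"])
  define x0 where "x0 = (1 / norm (y 0)) *\<^sub>R y 0"
  have x0: "y0 x0 = 1"
    using y0 \<open>norm (y 0) \<ge> 1\<close> by (auto simp add: x0_def linear_scale bounded_linear.linear)
  define norms where "norms B \<Phi> \<longleftrightarrow> finite B \<and> finite \<Phi> \<and> \<Phi> \<subseteq> Collect bounded_linear \<and>
      (\<forall>u\<in>span B. \<forall>z. (\<forall>\<phi>\<in>\<Phi>. \<phi> z = 0) \<longrightarrow> norm u \<le> 2 * norm (u + z))"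
    for B :: "'a set" and \<Phi> :: "('a \<Rightarrow> real) set"
  have norms_ex: "\<exists>\<Phi>'. norms B \<Phi>' \<and> \<Phi> \<subseteq> \<Phi>'" if fin: "finite B" "finite \<Phi>" "\<Phi> \<subseteq> Collect bounded_linear" for B \<Phi>
  proof -
    obtain \<Phi>1 where "finite \<Phi>1" "\<Phi>1 \<subseteq> Collect bounded_linear"
      "\<And>u z. u \<in> span B \<Longrightarrow> (\<And>\<phi>. \<phi> \<in> \<Phi>1 \<Longrightarrow> \<phi> z = (0::real)) \<Longrightarrow> norm u \<le> 2 * norm (u + z)"
      by (rule finite_norming_set[OF fin(1)]) blast
    then have "norms B (\<Phi> \<union> \<Phi>1)"
      using fin unfolding norms_def by auto
    then show ?thesis
      by blast
  qed
  \<comment> \<open>In a state, \<open>B\<close> holds the vectors chosen before the stage,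
    \<open>\<Phi>\<close> annihilates the family of this stage, and the last two components are that
    family. Keeping \<open>x0\<close> in every \<open>B\<close> and \<open>y0\<close> in every
    \<open>\<Phi>\<close> makes all coordinate functionals vanish at \<open>x0\<close> and
    \<open>y0\<close> vanish on all families.\<close>
  define P where "P n \<sigma> = (case \<sigma> of (B, \<Phi>, m, x) \<Rightarrow> norms B \<Phi> \<and> x0 \<in> B \<and> y0 \<in> \<Phi> \<and>
      spread_family p ((1 / 4) ^ n) {..<m} x \<and> (\<forall>\<phi>\<in>\<Phi>. \<forall>j. \<phi> (x j) = 0))"
    for n :: nat and \<sigma> :: "'a set \<times> ('a \<Rightarrow> real) set \<times> nat \<times> (nat \<Rightarrow> 'a)"
  define Q where "Q \<sigma> \<sigma>' = (case \<sigma> of (B, \<Phi>, m, x) \<Rightarrow> case \<sigma>' of (B', \<Phi>', _, _) \<Rightarrow>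
      B' = B \<union> x ` {..<m} \<and> \<Phi> \<subseteq> \<Phi>')"
    for \<sigma> \<sigma>' :: "'a set \<times> ('a \<Rightarrow> real) set \<times> nat \<times> (nat \<Rightarrow> 'a)"
  have P_ex: "\<exists>m x. P n (B, \<Phi>, m, x)" if "norms B \<Phi>" "x0 \<in> B" "y0 \<in> \<Phi>" for n B \<Phi>
  proof -
    have fin: "finite \<Phi>" "\<Phi> \<subseteq> Collect bounded_linear"
      using that by (auto simp: norms_def)
    have pos: "(0::real) < (1 / 4) ^ n"
      by simp
    obtain m :: nat and x where "spread_family p ((1 / 4) ^ n) {..<m} x" "\<forall>\<phi>\<in>\<Phi>. \<forall>j. \<phi> (x j) = 0"
      by (rule spread_family_exists[OF p q C fin pos]) blast
    then show ?thesis
      using that by (auto simp: P_def)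
  qed
  have "\<exists>\<sigma>. \<forall>n. P n (\<sigma> n) \<and> Q (\<sigma> n) (\<sigma> (Suc n))"
  proof (rule dependent_nat_choice)
    obtain \<Phi> where "norms {x0} \<Phi>" "{y0} \<subseteq> \<Phi>"
      using norms_ex[of "{x0}" "{y0}"] y0 by auto
    then show "\<exists>\<sigma>. P 0 \<sigma>"
      using P_ex[of "{x0}" \<Phi> 0] by auto
  next
    fix \<sigma> n assume "P n \<sigma>"
    obtain B \<Phi> m x where \<sigma>: "\<sigma> = (B, \<Phi>, m, x)"
      by (metis prod_cases4)
    have *: "norms B \<Phi>" "x0 \<in> B" "y0 \<in> \<Phi>"
      using \<open>P n \<sigma>\<close> by (auto simp: P_def \<sigma>)
    obtain \<Phi>' where \<Phi>': "norms (B \<union> x ` {..<m}) \<Phi>'" "\<Phi> \<subseteq> \<Phi>'"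
      using norms_ex[of "B \<union> x ` {..<m}" \<Phi>] * by (auto simp: norms_def)
    obtain m' x' where "P (Suc n) (B \<union> x ` {..<m}, \<Phi>', m', x')"
      using P_ex[OF \<Phi>'(1), of "Suc n"] * \<Phi>' by auto
    then show "\<exists>\<sigma>'. P (Suc n) \<sigma>' \<and> Q \<sigma> \<sigma>'"
      using \<Phi>' by (auto simp: Q_def \<sigma>)
  qed
  then obtain \<sigma> where \<sigma>: "\<And>n. P n (\<sigma> n)" "\<And>n. Q (\<sigma> n) (\<sigma> (Suc n))"
    by blast
  define B where "B n = fst (\<sigma> n)" for n
  define \<Phi> where "\<Phi> n = fst (snd (\<sigma> n))" for n
  define m where "m n = fst (snd (snd (\<sigma> n)))" for n
  define x where "x n = snd (snd (snd (\<sigma> n)))" for n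
  have eq: "\<sigma> n = (B n, \<Phi> n, m n, x n)" for n
    by (simp add: B_def \<Phi>_def m_def x_def)
  have norms: "norms (B n) (\<Phi> n)" and mem: "x0 \<in> B n" "y0 \<in> \<Phi> n"
    and spread: "spread_family p ((1 / 4) ^ n) {..<m n} (x n)"
    and ker: "\<And>\<phi> j. \<phi> \<in> \<Phi> n \<Longrightarrow> \<phi> (x n j) = 0"
    and B_Suc: "B (Suc n) = B n \<union> x n ` {..<m n}" and \<Phi>_Suc: "\<Phi> n \<subseteq> \<Phi> (Suc n)" for n
    using \<sigma>(1)[of n] \<sigma>(2)[of n] by (auto simp: P_def Q_def eq)
  have B_mono: "B l \<subseteq> B k" if "l \<le> k" for l k
    by (rule lift_Suc_mono_le[OF _ that]) (simp add: B_Suc)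
  have \<Phi>_mono: "\<Phi> l \<subseteq> \<Phi> k" if "l \<le> k" for l k
    by (rule lift_Suc_mono_le[OF _ that]) (rule \<Phi>_Suc)
  have "\<exists>g. coordinate_functionals (B k) (\<Phi> (Suc k)) (m k) (x k) g" for k
  proof (rule coordinate_functionals_exist[of "\<Phi> (Suc k)" "\<Phi> k"])
    show "norm u \<le> 2 * norm (u + z)" if "u \<in> span (B k)" "\<And>\<phi>. \<phi> \<in> \<Phi> k \<Longrightarrow> \<phi> z = 0" for u z
      using norms[of k] that by (simp add: norms_def)
    show "norm u \<le> 2 * norm (u + z)" if "u \<in> span (B k \<union> x k ` {..<m k})" "\<And>\<phi>. \<phi> \<in> \<Phi> (Suc k) \<Longrightarrow> \<phi> z = 0" for u z
      using norms[of "Suc k"] that by (simp add: norms_def B_Suc)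
    show "\<Phi> (Suc k) \<subseteq> Collect bounded_linear"
      using norms[of "Suc k"] by (simp add: norms_def)
    show "L2_set a {..<m k} \<le> norm (\<Sum>j<m k. a j *\<^sub>R x k j)" for a
      using spread[of k] by (simp add: spread_family_def)
  qed (use ker \<Phi>_Suc in auto)
  then have "\<exists>f. \<forall>k. coordinate_functionals (B k) (\<Phi> (Suc k)) (m k) (x k) (f k)"
    by (intro choice allI)
  then obtain f where "\<And>k. coordinate_functionals (B k) (\<Phi> (Suc k)) (m k) (x k) (f k)"
    by blast
  then have f: "j < m k \<Longrightarrow> bounded_linear (f k j)"
    "j < m k \<Longrightarrow> u \<in> span (B k) \<Longrightarrow> (\<And>\<phi>. \<phi> \<in> \<Phi> (Suc k) \<Longrightarrow> \<phi> z = 0) \<Longrightarrow>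
         f k j (u + (\<Sum>i<m k. a i *\<^sub>R x k i) + z) = a j"
    "u \<in> span (B k) \<Longrightarrow> (\<And>\<phi>. \<phi> \<in> \<Phi> (Suc k) \<Longrightarrow> \<phi> z = 0) \<Longrightarrow>
         L2_set a {..<m k} \<le> 4 * norm (u + (\<Sum>i<m k. a i *\<^sub>R x k i) + z)"
    for k j u a z
    unfolding coordinate_functionals_def by simp_all
  have zero: "\<phi> 0 = 0" if "\<phi> \<in> \<Phi> k" for \<phi> k
    using that norms[of k] by (auto simp: norms_def intro!: linear_0 bounded_linear.linear)
  have f_B: "f k j u = 0" if "j < m k" "u \<in> B k" for k j u
    using f(2)[of j k u 0 "\<lambda>_. 0"] that zero by (auto simp: span_base)
  have f_x: "f k j (x k i) = (if i = j then 1 else 0)" if "j < m k" "i < m k" for k j i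
  proof -
    have "(\<Sum>i'<m k. (if i = i' then 1 else 0) *\<^sub>R x k i') = x k i"
      using that by (simp add: if_distrib[of "\<lambda>c. c *\<^sub>R _"] cong: if_cong)
    then show ?thesis
      using f(2)[of j k 0 0 "\<lambda>i'. if i = i' then 1 else 0"] that zero by (auto simp: span_0)
  qed
  define V where "V = span (insert x0 (\<Union>k. x k ` {..<m k}))"
  have L2_V: "L2_set (\<lambda>j. f k j s) {..<m k} \<le> 4 * norm s" if "s \<in> V" for k s
  proof -
    \<comment> \<open>The k-th and all earlier families lie in \<open>B (Suc k)\<close>, the later
      ones in the common kernel \<open>Z\<close>. So every element of \<open>V\<close> has the form
      from which \<open>f k\<close> reads off the coordinates.\<close>
    define Z where "Z = {z. \<forall>\<phi>\<in>\<Phi> (Suc k). \<phi> z = 0}"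
    define W where "W = {w + z |w z. w \<in> span (B k \<union> x k ` {..<m k}) \<and> z \<in> Z}"
    have Z: "subspace Z"
      unfolding Z_def using norms[of "Suc k"] by (intro subspace_common_kernel) (simp add: norms_def)
    have W: "subspace W"
      unfolding W_def by (intro subspace_sums Z subspace_span)
    have in1: "v \<in> W" if "v \<in> B k \<union> x k ` {..<m k}" for v
      unfolding W_def using span_base[OF that] subspace_0[OF Z] by force
    have in2: "v \<in> W" if "v \<in> Z" for v
      unfolding W_def using that span_0[of "B k \<union> x k ` {..<m k}"] by force
    have "x l i \<in> W" if "i < m l" for l i
    proof (cases "l \<le> k")
      case True
      have "x l i \<in> B (Suc l)"
        using that by (auto simp: B_Suc)
      also have "\<dots> \<subseteq> B (Suc k)"
        using True by (intro B_mono) auto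
      finally show ?thesis
        by (intro in1) (simp add: B_Suc)
    next
      case False
      then have "\<Phi> (Suc k) \<subseteq> \<Phi> l"
        by (intro \<Phi>_mono) auto
      then show ?thesis
        using ker by (intro in2) (auto simp: Z_def)
    qed
    moreover have "x0 \<in> W"
      using mem by (intro in1) auto
    ultimately have "V \<subseteq> W"
      unfolding V_def using W by (intro span_minimal) auto
    then obtain w z where wz: "s = w + z" "w \<in> span (B k \<union> x k ` {..<m k})" "z \<in> Z"
      using \<open>s \<in> V\<close> unfolding W_def by blast
    obtain u v where uv: "w = u + v" "u \<in> span (B k)" "v \<in> span (x k ` {..<m k})"
      using wz(2) unfolding span_Un by blast
    obtain a where a: "v = (\<Sum>i<m k. a i *\<^sub>R x k i)"
      by (rule span_image_lessThan[OF uv(3)])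
    have "f k j s = a j" if "j < m k" for j
      unfolding wz uv a using that uv wz by (intro f(2)) (auto simp: Z_def)
    then have "L2_set (\<lambda>j. f k j s) {..<m k} = L2_set a {..<m k}"
      by (intro L2_set_cong) auto
    also have "\<dots> \<le> 4 * norm s"
      unfolding wz uv a using uv wz by (intro f(3)) (auto simp: Z_def)
    finally show ?thesis .
  qed
  have L2_closure: "L2_set (\<lambda>j. f k j s) {..<m k} \<le> 4 * norm s" if "s \<in> closure V" for k s
  proof -
    have "closed {s. L2_set (\<lambda>j. f k j s) {..<m k} \<le> 4 * norm s}"
      unfolding L2_set_def using f(1)
      by (intro closed_Collect_le continuous_intros) (auto intro: linear_continuous_on)
    then have "closure V \<subseteq> {s. L2_set (\<lambda>j. f k j s) {..<m k} \<le> 4 * norm s}"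
      using L2_V by (intro closure_minimal) auto
    then show ?thesis
      using that by blast
  qed
  have earlier: "f k j (x l i) = 0" if "j < m k" "l < k" "i < m l" for k j l i
  proof -
    have "x l i \<in> B (Suc l)"
      using that by (auto simp: B_Suc)
    also have "\<dots> \<subseteq> B k"
      using that by (intro B_mono) auto
    finally show ?thesis
      using f_B that by blast
  qed
  have "biorthogonal_spread_families p x0 y0 m x f (closure V)"
  proof (rule biorthogonal_spread_families.intro)
    show "y0 (x k j) = 0" for k j
      using ker mem(2) by blast
    show "f k j x0 = 0" if "j < m k" for k j
      by (rule f_B[OF that mem(1)])
    show "closure V = closure (span (insert x0 (\<Union>k. x k ` {..<m k})))"
      by (simp only: V_def)
  qed (fact p y0(1) x0 spread f(1) f_x earlier L2_closure)+
  then show ?thesis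
    by blast
qed

section \<open>The weak \<open>p\<close>-norm and free Banach lattices\<close>

lemma dualD:
  assumes "\<phi> \<in> dual S"
  shows "x \<in> S \<Longrightarrow> y \<in> S \<Longrightarrow> \<phi> (x + y) = \<phi> x + \<phi> y" "x \<in> S \<Longrightarrow> \<phi> (c *\<^sub>R x) = c * \<phi> x"
    "x \<notin> S \<Longrightarrow> \<phi> x = 0"
  using assms by (auto simp: dual_def)

lemma dual_bounded:
  assumes "\<phi> \<in> dual S"
  obtains K where "K \<ge> 0" "\<And>x. x \<in> S \<Longrightarrow> \<bar>\<phi> x\<bar> \<le> K * norm x"
proof -
  have "\<exists>K. \<forall>x\<in>S. \<bar>\<phi> x\<bar> \<le> K * norm x"
    using assms by (simp add: dual_def bounded_op_on_def)
  then obtain K where K: "\<And>x. x \<in> S \<Longrightarrow> \<bar>\<phi> x\<bar> \<le> K * norm x"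
    by blast
  have "\<bar>\<phi> x\<bar> \<le> \<bar>K\<bar> * norm x" if "x \<in> S" for x
    using K[OF that] mult_right_mono[OF abs_ge_self[of K] norm_ge_zero[of x]] by linarith
  then show ?thesis
    using that[of "\<bar>K\<bar>"] by simp
qed

lemma dualI:
  assumes "\<And>x y. x \<in> S \<Longrightarrow> y \<in> S \<Longrightarrow> \<phi> (x + y) = \<phi> x + \<phi> y" "\<And>x c. x \<in> S \<Longrightarrow> \<phi> (c *\<^sub>R x) = c * \<phi> x"
    "\<And>x. x \<notin> S \<Longrightarrow> \<phi> x = 0" "\<And>x. x \<in> S \<Longrightarrow> \<bar>\<phi> x\<bar> \<le> K * norm x"
  shows "\<phi> \<in> dual S"
  using assms unfolding dual_def bounded_op_on_def by blast

lemma dual_add: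
  assumes "\<phi> \<in> dual S" "\<psi> \<in> dual S"
  shows "(\<lambda>x. \<phi> x + \<psi> x) \<in> dual S"
proof -
  obtain K where K: "\<And>x. x \<in> S \<Longrightarrow> \<bar>\<phi> x\<bar> \<le> K * norm x"
    using dual_bounded[OF assms(1)] by blast
  obtain L where L: "\<And>x. x \<in> S \<Longrightarrow> \<bar>\<psi> x\<bar> \<le> L * norm x"
    using dual_bounded[OF assms(2)] by blast
  show ?thesis
  proof (rule dualI)
    show "\<bar>\<phi> x + \<psi> x\<bar> \<le> (K + L) * norm x" if "x \<in> S" for x
      using K[OF that] L[OF that] abs_triangle_ineq[of "\<phi> x" "\<psi> x"] by (simp add: distrib_right)
  qed (use dualD[OF assms(1)] dualD[OF assms(2)] in \<open>auto simp: algebra_simps\<close>)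
qed

lemma dual_cmult:
  assumes "\<phi> \<in> dual S"
  shows "(\<lambda>x. c * \<phi> x) \<in> dual S"
proof -
  obtain K where K: "\<And>x. x \<in> S \<Longrightarrow> \<bar>\<phi> x\<bar> \<le> K * norm x"
    using dual_bounded[OF assms(1)] by blast
  show ?thesis
  proof (rule dualI)
    show "\<bar>c * \<phi> x\<bar> \<le> (\<bar>c\<bar> * K) * norm x" if "x \<in> S" for x
      using mult_left_mono[OF K[OF that], of "\<bar>c\<bar>"] by (simp add: abs_mult mult.assoc)
  qed (use dualD[OF assms(1)] in \<open>auto simp: algebra_simps\<close>)
qed

lemma dual_zero: "(\<lambda>_. 0) \<in> dual S"
  by (rule dualI[where K = 0]) auto

lemma dual_at_zero:
  assumes "\<phi> \<in> dual S" "0 \<in> S"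
  shows "\<phi> 0 = 0"
  using dualD(2)[OF assms, of 0] by simp

lemma abs_le_dual_norm:
  assumes "subspace S" "\<phi> \<in> dual S" "x \<in> S"
  shows "\<bar>\<phi> x\<bar> \<le> dual_norm S \<phi> * norm x"
proof (cases "x = 0")
  case True
  then show ?thesis
    using assms by (simp add: dual_at_zero)
next
  case False
  have "\<bar>\<phi> ((1 / norm x) *\<^sub>R x)\<bar> \<le> dual_norm S \<phi>"
    using assms False
    by (intro op_norm_upper) (auto simp: dual_def subspace_scale)
  then show ?thesis
    using False assms by (simp add: dualD(2) abs_mult field_simps)
qed

lemma dual_norm_nonneg:
  assumes "subspace S" "\<phi> \<in> dual S"
  shows "0 \<le> dual_norm S \<phi>"
proof -
  have "\<bar>\<phi> 0\<bar> \<le> dual_norm S \<phi>"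
    using assms by (intro op_norm_upper) (auto simp: dual_def subspace_0)
  then show ?thesis
    by linarith
qed

lemma lq_norm_conjugate:
  assumes "p > 1"
  shows "lq_norm (conjugate_exponent p) n a = lp_sum (p / (p - 1)) {..<n} a"
  using assms by (simp add: conjugate_exponent_def lq_norm_ereal)

lemma combination_le:
  assumes p: "p > 1" and le: "\<And>x. x \<in> S \<Longrightarrow> lp_sum p {..<n} (\<lambda>i. \<phi> i x) \<le> B * norm x" and B: "B \<ge> 0"
    and a: "lq_norm (conjugate_exponent p) n a \<le> 1" and x: "x \<in> S" "norm x \<le> 1"
  shows "\<bar>\<Sum>i<n. a i * \<phi> i x\<bar> \<le> B"
proof -
  have "\<bar>\<Sum>i<n. a i * \<phi> i x\<bar> \<le> lp_sum (p / (p - 1)) {..<n} a * lp_sum p {..<n} (\<lambda>i. \<phi> i x)"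
    using conjugate_real[OF p] p by (intro holder_sum) auto
  also have "\<dots> \<le> 1 * (B * 1)"
    using a le[OF x(1)] x B lq_norm_conjugate[OF p, of n a] mult_left_mono[OF x(2) B]
    by (intro mult_mono) auto
  finally show ?thesis
    by simp
qed

text \<open>Together with \<open>lp_sum_le_weak_p_norm\<close> this identifies the weak p-norm as
  the least B with \<open>lp_sum p {..<n} (\<lambda>i. \<phi> i x) \<le> B * norm x\<close> on S,
  i.e. as the norm of the operator from S into l_p^n given by the tuple. This is the form in which
  it is used for free Banach lattices.\<close>

lemma weak_p_norm_le:
  assumes "p > 1" "0 \<in> S" "B \<ge> 0" "\<And>x. x \<in> S \<Longrightarrow> lp_sum p {..<n} (\<lambda>i. \<phi> i x) \<le> B * norm x"
  shows "weak_p_norm S p n \<phi> \<le> B"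
  unfolding weak_p_norm_def
proof (rule cSUP_least)
  have "lq_norm (conjugate_exponent p) n (\<lambda>_. 0) \<le> 1"
    using assms(1) by (simp add: lq_norm_conjugate lp_sum_def)
  then show "{a. lq_norm (conjugate_exponent p) n a \<le> 1} \<noteq> {}"
    by blast
  fix a assume "a \<in> {a. lq_norm (conjugate_exponent p) n a \<le> 1}"
  then show "dual_norm S (\<lambda>x. \<Sum>i<n. a i * \<phi> i x) \<le> B"
    unfolding op_norm_def using assms combination_le[of p S n \<phi> B a]
    by (intro cSUP_least) (auto intro!: exI[of _ 0])
qed

text \<open>A supremum of reals is meaningful only for a bounded set, so both suprema in the
  definition are first bounded crudely by the l_p norm of bounds for the individual
  functionals.\<close>

lemma combination_le_weak_p_norm:
  assumes p: "p > 1" and S: "subspace S" and \<phi>: "\<And>i. i < n \<Longrightarrow> \<phi> i \<in> dual S"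
    and a: "lq_norm (conjugate_exponent p) n a \<le> 1" and x: "x \<in> S" "norm x \<le> 1"
  shows "\<bar>\<Sum>i<n. a i * \<phi> i x\<bar> \<le> weak_p_norm S p n \<phi>"
proof -
  have "\<exists>K\<ge>0. \<forall>x\<in>S. \<bar>\<phi> i x\<bar> \<le> K * norm x" if "i < n" for i
    using dual_bounded[OF \<phi>[OF that]] by metis
  then obtain K where K: "\<And>i. i < n \<Longrightarrow> K i \<ge> 0"
    "\<And>i x. i < n \<Longrightarrow> x \<in> S \<Longrightarrow> \<bar>\<phi> i x\<bar> \<le> K i * norm x"
    by metis
  define B where "B = lp_sum p {..<n} K"
  have B: "lp_sum p {..<n} (\<lambda>i. \<phi> i x) \<le> B * norm x" if "x \<in> S" for x
  proof -
    have "lp_sum p {..<n} (\<lambda>i. \<phi> i x) \<le> lp_sum p {..<n} (\<lambda>i. norm x * K i)"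
      using K(1) K(2)[OF _ that] p by (intro lp_sum_mono) (auto simp: abs_mult mult.commute)
    also have "\<dots> = norm x * B"
      using p by (simp add: B_def lp_sum_cmult)
    finally show ?thesis
      by (simp add: mult.commute)
  qed
  have comb: "\<bar>\<Sum>i<n. b i * \<phi> i v\<bar> \<le> B"
    if "lq_norm (conjugate_exponent p) n b \<le> 1" "v \<in> S" "norm v \<le> 1" for b v
    by (rule combination_le[OF p B]) (use that in \<open>auto simp: B_def\<close>)
  have dn: "dual_norm S (\<lambda>x. \<Sum>i<n. b i * \<phi> i x) \<le> B" if "lq_norm (conjugate_exponent p) n b \<le> 1" for b
    unfolding op_norm_def using comb[OF that] subspace_0[OF S]
    by (intro cSUP_least) (auto intro!: exI[of _ 0])
  have "\<bar>\<Sum>i<n. a i * \<phi> i x\<bar> \<le> dual_norm S (\<lambda>x. \<Sum>i<n. a i * \<phi> i x)"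
    unfolding op_norm_def using x comb[OF a]
    by (intro cSUP_upper2[where x = x]) (auto simp: bdd_above_def)
  also have "\<dots> \<le> weak_p_norm S p n \<phi>"
    unfolding weak_p_norm_def using a dn
    by (intro cSUP_upper2[where x = a]) (auto simp: bdd_above_def)
  finally show ?thesis .
qed

lemma weak_p_norm_nonneg:
  assumes "p > 1" "subspace S" "\<And>i. i < n \<Longrightarrow> \<phi> i \<in> dual S"
  shows "0 \<le> weak_p_norm S p n \<phi>"
  using combination_le_weak_p_norm[OF assms, where a = "\<lambda>_. 0" and x = 0] assms(1) subspace_0[OF assms(2)]
  by (simp add: lq_norm_conjugate lp_sum_def)

lemma lp_sum_le_weak_p_norm:
  assumes p: "p > 1" and S: "subspace S" and \<phi>: "\<And>i. i < n \<Longrightarrow> \<phi> i \<in> dual S" and x: "x \<in> S"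
  shows "lp_sum p {..<n} (\<lambda>i. \<phi> i x) \<le> weak_p_norm S p n \<phi> * norm x"
proof (cases "x = 0")
  case True
  then have "lp_sum p {..<n} (\<lambda>i. \<phi> i x) = 0"
    using \<phi> x p by (auto simp: lp_sum_eq_0_iff intro: dual_at_zero)
  then show ?thesis
    using True by simp
next
  case False
  obtain a where a: "lp_sum (p / (p - 1)) {..<n} a \<le> 1" "(\<Sum>i<n. a i * \<phi> i x) = lp_sum p {..<n} (\<lambda>i. \<phi> i x)"
    by (rule holder_sum_attained[OF _ p conjugate_real[OF p], of "{..<n}" "\<lambda>i. \<phi> i x"]) auto
  have "\<bar>\<Sum>i<n. a i * \<phi> i ((1 / norm x) *\<^sub>R x)\<bar> \<le> weak_p_norm S p n \<phi>"
    using a p x False by (intro combination_le_weak_p_norm \<phi> S) (auto simp: lq_norm_conjugate subspace_scale[OF S])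
  moreover have "(\<Sum>i<n. a i * \<phi> i ((1 / norm x) *\<^sub>R x)) = (1 / norm x) * (\<Sum>i<n. a i * \<phi> i x)"
    unfolding sum_distrib_left
  proof (rule sum.cong)
    fix i assume "i \<in> {..<n}"
    then show "a i * \<phi> i ((1 / norm x) *\<^sub>R x) = (1 / norm x) * (a i * \<phi> i x)"
      using dualD(2)[OF \<phi> x, of i "1 / norm x"] by simp
  qed simp
  ultimately show ?thesis
    using False by (simp add: a(2) abs_mult field_simps)
qed

lemma weak_p_norm_single:
  assumes "p > 1" "subspace S" "\<phi> \<in> dual S"
  shows "weak_p_norm S p 1 (\<lambda>_. \<phi>) \<le> dual_norm S \<phi>"
proof (rule weak_p_norm_le)
  show "lp_sum p {..<1::nat} (\<lambda>_. \<phi> x) \<le> dual_norm S \<phi> * norm x" if "x \<in> S" for x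
    using assms that abs_le_dual_norm[OF assms(2,3) that] by (simp add: lp_sum_def powr_powr)
qed (use assms dual_norm_nonneg subspace_0 in auto)

section \<open>Functions of finite p-norm and the free vector lattice\<close>

definition p_bounded :: "'a::real_normed_vector set \<Rightarrow> real \<Rightarrow> real \<Rightarrow> (('a \<Rightarrow> real) \<Rightarrow> real) \<Rightarrow> bool" where
  "p_bounded S p C f \<longleftrightarrow> (\<forall>n \<phi>. (\<forall>i<n. \<phi> i \<in> dual S) \<longrightarrow>
     lp_sum p {..<n} (\<lambda>i. f (\<phi> i)) \<le> C * weak_p_norm S p n \<phi>)"

lemma p_norm_le:
  assumes "C \<ge> 0" "p_bounded S p C f"
  shows "p_norm S p f \<le> ereal C"
  unfolding p_norm_def using assms
  by (intro Inf_lower) (auto simp: p_bounded_def lq_norm_ereal)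

lemma p_norm_lessE:
  assumes "p_norm S p f < ereal e"
  obtains C where "0 \<le> C" "C < e" "p_bounded S p C f"
  using assms unfolding p_norm_def by (auto simp: Inf_less_iff p_bounded_def lq_norm_ereal)

definition lipschitz_bound :: "'a::real_normed_vector set \<Rightarrow> 'a set \<Rightarrow> real \<Rightarrow> (('a \<Rightarrow> real) \<Rightarrow> real) \<Rightarrow> bool" where
  "lipschitz_bound S Z L f \<longleftrightarrow> finite Z \<and> Z \<subseteq> S \<and> L \<ge> 0 \<and>
    (\<forall>\<phi>\<in>dual S. \<forall>\<psi>\<in>dual S. \<bar>f \<phi> - f \<psi>\<bar> \<le> L * (\<Sum>z\<in>Z. \<bar>\<phi> z - \<psi> z\<bar>))"

lemma lipschitz_boundD:
  assumes "lipschitz_bound S Z L f"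
  shows "finite Z" "Z \<subseteq> S" "L \<ge> 0"
    "\<phi> \<in> dual S \<Longrightarrow> \<psi> \<in> dual S \<Longrightarrow> \<bar>f \<phi> - f \<psi>\<bar> \<le> L * (\<Sum>z\<in>Z. \<bar>\<phi> z - \<psi> z\<bar>)"
  using assms by (auto simp: lipschitz_bound_def)

text \<open>A sublattice of \<open>H_wstar S\<close> containing all evaluations, so that minimality
  of the hull puts \<open>FVL S\<close> inside it. It stands in for an explicit description of
  lattice-linear expressions and retains their dependence on finitely many vectors in a quantitative
  form.\<close>

definition lipschitz_functions :: "'a::real_normed_vector set \<Rightarrow> (('a \<Rightarrow> real) \<Rightarrow> real) set" where
  "lipschitz_functions S = {f. (\<forall>\<phi>\<in>dual S. \<forall>c\<ge>0. f (\<lambda>x. c * \<phi> x) = c * f \<phi>) \<and>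
     (\<forall>\<phi>. \<phi> \<notin> dual S \<longrightarrow> f \<phi> = 0) \<and> (\<exists>Z L. lipschitz_bound S Z L f)}"

text \<open>Addition, maximum and minimum share positive homogeneity and the Lipschitz estimate in
  the l_1 norm of the plane, so the three closure properties are obtained at once.\<close>

lemma lipschitz_functions_combine:
  assumes f: "f \<in> lipschitz_functions S" and g: "g \<in> lipschitz_functions S"
    and hom: "\<And>c s t. c \<ge> 0 \<Longrightarrow> h (c * s) (c * t) = c * (h s t :: real)" and "h 0 0 = 0"
    and lip: "\<And>s t s' t'. \<bar>h s t - h s' t'\<bar> \<le> \<bar>s - s'\<bar> + \<bar>t - t'\<bar>"
  shows "(\<lambda>\<phi>. h (f \<phi>) (g \<phi>)) \<in> lipschitz_functions S"
proof -
  obtain Z L where "lipschitz_bound S Z L f"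
    using f unfolding lipschitz_functions_def by blast
  note Z = lipschitz_boundD[OF this]
  obtain Z' L' where "lipschitz_bound S Z' L' g"
    using g unfolding lipschitz_functions_def by blast
  note Z' = lipschitz_boundD[OF this]
  have "\<bar>h (f \<phi>) (g \<phi>) - h (f \<psi>) (g \<psi>)\<bar> \<le> (L + L') * (\<Sum>z\<in>Z \<union> Z'. \<bar>\<phi> z - \<psi> z\<bar>)"
    if "\<phi> \<in> dual S" "\<psi> \<in> dual S" for \<phi> \<psi>
  proof -
    have "\<bar>h (f \<phi>) (g \<phi>) - h (f \<psi>) (g \<psi>)\<bar> \<le> L * (\<Sum>z\<in>Z. \<bar>\<phi> z - \<psi> z\<bar>) + L' * (\<Sum>z\<in>Z'. \<bar>\<phi> z - \<psi> z\<bar>)"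
      using lip[of "f \<phi>" "g \<phi>" "f \<psi>" "g \<psi>"] Z(4)[OF that] Z'(4)[OF that] by linarith
    also have "\<dots> \<le> L * (\<Sum>z\<in>Z \<union> Z'. \<bar>\<phi> z - \<psi> z\<bar>) + L' * (\<Sum>z\<in>Z \<union> Z'. \<bar>\<phi> z - \<psi> z\<bar>)"
      using Z Z' by (intro add_mono mult_left_mono sum_mono2) auto
    finally show ?thesis
      by (simp add: distrib_right)
  qed
  moreover have "finite (Z \<union> Z')" "Z \<union> Z' \<subseteq> S" "L + L' \<ge> 0"
    using Z Z' by auto
  moreover have "\<forall>\<phi>\<in>dual S. \<forall>c\<ge>0. h (f (\<lambda>x. c * \<phi> x)) (g (\<lambda>x. c * \<phi> x)) = c * h (f \<phi>) (g \<phi>)"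
    using f g hom by (simp add: lipschitz_functions_def)
  moreover have "\<forall>\<phi>. \<phi> \<notin> dual S \<longrightarrow> h (f \<phi>) (g \<phi>) = 0"
    using f g \<open>h 0 0 = 0\<close> by (simp add: lipschitz_functions_def)
  ultimately show ?thesis
    unfolding lipschitz_functions_def lipschitz_bound_def by blast
qed

lemma lipschitz_functions_cmult:
  assumes "f \<in> lipschitz_functions S"
  shows "(\<lambda>\<phi>. c * f \<phi>) \<in> lipschitz_functions S"
proof -
  obtain Z L where "lipschitz_bound S Z L f"
    using assms unfolding lipschitz_functions_def by blast
  note Z = lipschitz_boundD[OF this]
  have "\<bar>c * f \<phi> - c * f \<psi>\<bar> \<le> (\<bar>c\<bar> * L) * (\<Sum>z\<in>Z. \<bar>\<phi> z - \<psi> z\<bar>)" if "\<phi> \<in> dual S" "\<psi> \<in> dual S" for \<phi> \<psi>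
    using mult_left_mono[OF Z(4)[OF that], of "\<bar>c\<bar>"]
    by (simp add: abs_mult[symmetric] right_diff_distrib mult.assoc)
  moreover have "\<bar>c\<bar> * L \<ge> 0"
    using Z by simp
  moreover have "\<forall>\<phi>\<in>dual S. \<forall>d\<ge>0. c * f (\<lambda>x. d * \<phi> x) = d * (c * f \<phi>)" "\<forall>\<phi>. \<phi> \<notin> dual S \<longrightarrow> c * f \<phi> = 0"
    using assms by (simp_all add: lipschitz_functions_def)
  ultimately show ?thesis
    using Z(1,2) unfolding lipschitz_functions_def lipschitz_bound_def by blast
qed

lemma zero_lipschitz: "(\<lambda>_. 0) \<in> lipschitz_functions S"
  unfolding lipschitz_functions_def lipschitz_bound_def by (auto intro!: exI[of _ "{}"] intro: exI[of _ "0 :: real"])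

lemma lipschitz_functions_lattice: "vector_sublattice (lipschitz_functions S)"
  unfolding vector_sublattice_def
proof (intro conjI ballI allI)
  fix f g assume fg: "f \<in> lipschitz_functions S" "g \<in> lipschitz_functions S"
  show "(\<lambda>t. f t + g t) \<in> lipschitz_functions S"
    by (rule lipschitz_functions_combine[OF fg, of "(+)"]) (auto simp: distrib_left)
  show "(\<lambda>t. max (f t) (g t)) \<in> lipschitz_functions S"
  proof (rule lipschitz_functions_combine[OF fg, of max])
    show "max (c * s) (c * t) = c * max s t" if "c \<ge> 0" for c s t :: real
      using that by (simp add: max_mult_distrib_left)
  qed (auto simp: max_def)
  show "(\<lambda>t. min (f t) (g t)) \<in> lipschitz_functions S"
  proof (rule lipschitz_functions_combine[OF fg, of min])
    show "min (c * s) (c * t) = c * min s t" if "c \<ge> 0" for c s t :: real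
      using that by (simp add: min_mult_distrib_left)
  qed (auto simp: min_def)
qed (auto intro: zero_lipschitz lipschitz_functions_cmult)

lemma lipschitz_functions_H_wstar: "lipschitz_functions S \<subseteq> H_wstar S"
proof
  fix f assume f: "f \<in> lipschitz_functions S"
  then obtain Z L where "lipschitz_bound S Z L f"
    unfolding lipschitz_functions_def by blast
  note Z = lipschitz_boundD[OF this]
  have "continuous_on B f" if B: "B \<subseteq> dual S" for B
    unfolding continuous_on_def
  proof
    fix \<phi> assume \<phi>: "\<phi> \<in> B"
    define g where "g \<psi> = L * (\<Sum>z\<in>Z. \<bar>\<psi> z - \<phi> z\<bar>)" for \<psi>
    have "continuous_on B g"
      unfolding g_def
      by (intro continuous_intros continuous_on_subset[OF continuous_on_product_coordinates]) auto
    then have "(g \<longlongrightarrow> g \<phi>) (at \<phi> within B)"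
      using \<phi> by (simp add: continuous_on_def)
    then have "(g \<longlongrightarrow> 0) (at \<phi> within B)"
      by (simp add: g_def)
    moreover have "\<forall>\<^sub>F \<psi> in at \<phi> within B. norm (f \<psi> - f \<phi>) \<le> g \<psi>"
      unfolding eventually_at_filter using Z(4) B \<phi> by (intro always_eventually) (auto simp: g_def)
    ultimately have "((\<lambda>\<psi>. f \<psi> - f \<phi>) \<longlongrightarrow> 0) (at \<phi> within B)"
      by (rule Lim_null_comparison[rotated])
    then show "(f \<longlongrightarrow> f \<phi>) (at \<phi> within B)"
      by (rule LIM_zero_cancel)
  qed
  then show "f \<in> H_wstar S"
    using f by (simp add: H_wstar_def lipschitz_functions_def)
qed

lemma delta_lipschitz: "x \<in> S \<Longrightarrow> delta S x \<in> lipschitz_functions S"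
  unfolding lipschitz_functions_def lipschitz_bound_def delta_def
  by (auto simp: dual_cmult intro!: exI[of _ "{x}"] exI[of _ 1])

lemma FVL_lipschitz: "FVL S \<subseteq> lipschitz_functions S"
  unfolding FVL_def
  by (intro hull_minimal conjI lipschitz_functions_lattice lipschitz_functions_H_wstar)
    (auto intro: delta_lipschitz)

lemma FVL_lattice: "vector_sublattice (FVL S)"
  unfolding FVL_def hull_def vector_sublattice_def by blast

lemma delta_FVL: "x \<in> S \<Longrightarrow> delta S x \<in> FVL S"
  unfolding FVL_def by (intro hull_inc) auto

lemma FVL_cmult: "f \<in> FVL S \<Longrightarrow> (\<lambda>t. c * f t) \<in> FVL S"
  and FVL_add: "f \<in> FVL S \<Longrightarrow> g \<in> FVL S \<Longrightarrow> (\<lambda>t. f t + g t) \<in> FVL S"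
  and FVL_max: "f \<in> FVL S \<Longrightarrow> g \<in> FVL S \<Longrightarrow> (\<lambda>t. max (f t) (g t)) \<in> FVL S"
  and FVL_min: "f \<in> FVL S \<Longrightarrow> g \<in> FVL S \<Longrightarrow> (\<lambda>t. min (f t) (g t)) \<in> FVL S"
  using FVL_lattice[of S] by (simp_all add: vector_sublattice_def)

lemma FVL_abs:
  assumes "f \<in> FVL S"
  shows "(\<lambda>t. \<bar>f t\<bar>) \<in> FVL S"
proof -
  have "(\<lambda>t. max (f t) (- 1 * f t)) \<in> FVL S"
    by (intro FVL_max FVL_cmult assms)
  moreover have "(\<lambda>t. max (f t) (- 1 * f t)) = (\<lambda>t. \<bar>f t\<bar>)"
    by (auto simp: abs_if max_def)
  ultimately show ?thesis
    by simp
qed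

lemma FVL_sum:
  assumes "finite I" "\<And>i. i \<in> I \<Longrightarrow> f i \<in> FVL S"
  shows "(\<lambda>t. \<Sum>i\<in>I. f i t) \<in> FVL S"
  using assms
proof (induction I rule: finite_induct)
  case empty
  then show ?case
    using FVL_lattice[of S] by (simp add: vector_sublattice_def)
qed (simp add: FVL_add)

lemma lipschitz_p_bounded:
  assumes "p > 1" "subspace S" "f \<in> lipschitz_functions S"
  obtains C where "C \<ge> 0" "p_bounded S p C f"
proof -
  obtain Z L where "lipschitz_bound S Z L f"
    using assms(3) unfolding lipschitz_functions_def by blast
  note Z = lipschitz_boundD[OF this]
  have "f (\<lambda>x. c * \<phi> x) = c * f \<phi>" if "\<phi> \<in> dual S" "c \<ge> 0" for \<phi> c
    using assms(3) that by (simp add: lipschitz_functions_def)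
  from this[OF dual_zero, of 0] have "f (\<lambda>_. 0) = 0"
    by simp
  then have le: "\<bar>f \<phi>\<bar> \<le> L * (\<Sum>z\<in>Z. \<bar>\<phi> z\<bar>)" if "\<phi> \<in> dual S" for \<phi>
    using Z(4)[OF that dual_zero] by simp
  show ?thesis
  proof
    show "L * (\<Sum>z\<in>Z. norm z) \<ge> 0"
      using Z by (intro mult_nonneg_nonneg sum_nonneg) auto
    show "p_bounded S p (L * (\<Sum>z\<in>Z. norm z)) f"
      unfolding p_bounded_def
    proof (intro allI impI)
      fix n :: nat and \<phi> assume \<phi>: "\<forall>i<n. \<phi> i \<in> dual S"
      have "lp_sum p {..<n} (\<lambda>i. f (\<phi> i)) \<le> lp_sum p {..<n} (\<lambda>i. L * (\<Sum>z\<in>Z. \<bar>\<phi> i z\<bar>))"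
        using \<phi> assms(1) by (intro lp_sum_mono order_trans[OF le abs_ge_self]) auto
      also have "\<dots> = L * lp_sum p {..<n} (\<lambda>i. \<Sum>z\<in>Z. \<bar>\<phi> i z\<bar>)"
        using assms(1) Z(3) by (simp add: lp_sum_cmult)
      also have "\<dots> \<le> L * (\<Sum>z\<in>Z. lp_sum p {..<n} (\<lambda>i. \<bar>\<phi> i z\<bar>))"
        using assms(1) Z by (intro mult_left_mono minkowski_sum_sum) auto
      also have "\<dots> \<le> L * (\<Sum>z\<in>Z. weak_p_norm S p n \<phi> * norm z)"
      proof (intro mult_left_mono sum_mono)
        fix z assume "z \<in> Z"
        then show "lp_sum p {..<n} (\<lambda>i. \<bar>\<phi> i z\<bar>) \<le> weak_p_norm S p n \<phi> * norm z"
          using lp_sum_le_weak_p_norm[OF assms(1,2), of n \<phi> z] \<phi> Z(2) by (auto simp: lp_sum_def)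
      qed (use Z in auto)
      finally show "lp_sum p {..<n} (\<lambda>i. f (\<phi> i)) \<le> L * (\<Sum>z\<in>Z. norm z) * weak_p_norm S p n \<phi>"
        by (simp add: sum_distrib_right[symmetric] mult_ac)
    qed
  qed
qed

lemma p_bounded_zero:
  assumes "p > 1"
  shows "p_bounded S p 0 (\<lambda>_. 0)"
  using assms by (simp add: p_bounded_def lp_sum_def)

lemma FVL_subset_FBL:
  assumes "p > 1" "subspace S"
  shows "FVL S \<subseteq> FBL S p"
proof
  fix f assume f: "f \<in> FVL S"
  obtain C where "C \<ge> 0" "p_bounded S p C f"
    using lipschitz_p_bounded[OF assms] f FVL_lipschitz by blast
  then have "p_norm S p f \<le> ereal C"
    by (rule p_norm_le)
  then have "p_norm S p f < \<infinity>"
    by auto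
  moreover have "f \<in> H_wstar S"
    using f FVL_lipschitz lipschitz_functions_H_wstar by blast
  moreover have "p_norm S p (\<lambda>\<phi>. f \<phi> - f \<phi>) < ereal e" if "e > 0" for e
  proof -
    have "p_norm S p (\<lambda>_. 0) \<le> ereal 0"
      by (rule p_norm_le[OF _ p_bounded_zero[OF assms(1)]]) simp
    also have "\<dots> < ereal e"
      using that by simp
    finally show ?thesis
      by simp
  qed
  ultimately show "f \<in> FBL S p"
    using f unfolding FBL_def H_wstar_p_def by blast
qed

lemma p_bounded_pointwise:
  assumes "p > 1" "subspace S" "p_bounded S p C f" "C \<ge> 0" "\<phi> \<in> dual S"
  shows "\<bar>f \<phi>\<bar> \<le> C * dual_norm S \<phi>"
proof -
  have "lp_sum p {..<1::nat} (\<lambda>_. f \<phi>) \<le> C * weak_p_norm S p 1 (\<lambda>_. \<phi>)"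
    using assms(3,5) unfolding p_bounded_def by (elim allE[of _ "1::nat"] allE[of _ "\<lambda>_. \<phi>"]) auto
  also have "\<dots> \<le> C * dual_norm S \<phi>"
    using assms by (intro mult_left_mono weak_p_norm_single) auto
  finally show ?thesis
    using assms(1) by (simp add: lp_sum_def powr_powr)
qed

text \<open>The pointwise sum is examined directly, without completeness of the lattice: the terms
  are at most 2^(-k) times the dual norm, so the Weierstrass test gives weak* continuity on bounded
  sets, and the tails have p-norm at most 2 * 2^(-K), so the partial sums approximate in the
  p-norm.\<close>

lemma FBL_series:
  assumes p: "p > 1" and S: "subspace S" and g: "\<And>k. g k \<in> FVL S" and bd: "\<And>k. p_bounded S p ((1 / 2) ^ k) (g k)"
  shows "(\<lambda>\<phi>. \<Sum>k. g k \<phi>) \<in> FBL S p"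
proof -
  define c where "c \<phi> = (\<Sum>k. g k \<phi>)" for \<phi>
  have gL: "g k \<in> lipschitz_functions S" for k
    using g FVL_lipschitz by blast
  have pw: "\<bar>g k \<phi>\<bar> \<le> (1 / 2) ^ k * dual_norm S \<phi>" if "\<phi> \<in> dual S" for k \<phi>
    using p_bounded_pointwise[OF p S bd _ that] by simp
  have geo: "summable (\<lambda>k. (1 / 2) ^ k * r)" for r :: real
    by (intro summable_mult2 summable_geometric) simp
  have sm: "summable (\<lambda>k. g k \<phi>)" if "\<phi> \<in> dual S" for \<phi>
    using pw[OF that] by (intro summable_comparison_test[OF _ geo[of "dual_norm S \<phi>"]]) auto
  have "c (\<lambda>x. t * \<phi> x) = t * c \<phi>" if "\<phi> \<in> dual S" "t \<ge> 0" for t \<phi>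
  proof -
    have "g k (\<lambda>x. t * \<phi> x) = t * g k \<phi>" for k
      using gL[of k] that by (simp add: lipschitz_functions_def)
    then show ?thesis
      using suminf_mult[OF sm[OF that(1)]] by (simp add: c_def)
  qed
  moreover have "c \<phi> = 0" if "\<phi> \<notin> dual S" for \<phi>
    using gL that by (simp add: c_def lipschitz_functions_def)
  moreover have "continuous_on B c" if B: "B \<subseteq> dual S" "\<And>\<phi>. \<phi> \<in> B \<Longrightarrow> dual_norm S \<phi> \<le> r" for B r
  proof -
    have "uniform_limit B (\<lambda>n \<phi>. \<Sum>k<n. g k \<phi>) c sequentially"
      unfolding c_def
    proof (rule Weierstrass_m_test)
      show "norm (g k \<phi>) \<le> (1 / 2) ^ k * r" if "\<phi> \<in> B" for k \<phi>
      proof -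
        have "\<bar>g k \<phi>\<bar> \<le> (1 / 2) ^ k * dual_norm S \<phi>"
          using that B(1) by (intro pw) auto
        also have "\<dots> \<le> (1 / 2) ^ k * r"
          using B(2)[OF that] by (intro mult_left_mono) auto
        finally show ?thesis
          by simp
      qed
    qed (rule geo)
    moreover have "continuous_on B (\<lambda>\<phi>. \<Sum>k<n. g k \<phi>)" for n
    proof (intro continuous_on_sum)
      fix k
      have "\<forall>B\<subseteq>dual S. (\<exists>r. \<forall>\<phi>\<in>B. dual_norm S \<phi> \<le> r) \<longrightarrow> continuous_on B (g k)"
        using subsetD[OF lipschitz_functions_H_wstar gL[of k]] by (simp add: H_wstar_def)
      then show "continuous_on B (g k)"
        using B by blast
    qed
    ultimately show ?thesis
      by (intro uniform_limit_theorem[of _ "\<lambda>n \<phi>. \<Sum>k<n. g k \<phi>" sequentially]) auto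
  qed
  ultimately have c_H: "c \<in> H_wstar S"
    unfolding H_wstar_def by blast
  have tail: "p_bounded S p (2 * (1 / 2) ^ K) (\<lambda>\<phi>. c \<phi> - (\<Sum>k<K. g k \<phi>))" for K
    unfolding p_bounded_def
  proof (intro allI impI)
    fix n :: nat and \<phi> assume \<phi>: "\<forall>i<n. \<phi> i \<in> dual S"
    define W where "W = weak_p_norm S p n \<phi>"
    have W: "W \<ge> 0"
      unfolding W_def using \<phi> by (intro weak_p_norm_nonneg[OF p S]) auto
    have part: "(\<Sum>i<n. \<bar>\<Sum>l<M. g (l + K) (\<phi> i)\<bar> powr p) \<le> (2 * (1 / 2) ^ K * W) powr p" for M
    proof -
      have "lp_sum p {..<n} (\<lambda>i. \<Sum>l<M. g (l + K) (\<phi> i)) \<le> (\<Sum>l<M. lp_sum p {..<n} (\<lambda>i. g (l + K) (\<phi> i)))"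
        using p by (intro minkowski_sum_sum) auto
      also have "\<dots> \<le> (\<Sum>l<M. (1 / 2) ^ (l + K) * W)"
        unfolding W_def using bd \<phi> by (intro sum_mono) (simp add: p_bounded_def)
      also have "\<dots> = (\<Sum>l<M. (1 / 2) ^ l) * ((1 / 2) ^ K * W)"
        by (simp add: sum_distrib_left sum_distrib_right power_add mult_ac)
      also have "\<dots> \<le> 2 * ((1 / 2) ^ K * W)"
      proof (rule mult_right_mono)
        have "(\<Sum>l<M. (1 / 2) ^ l) \<le> (\<Sum>l. (1 / 2 :: real) ^ l)"
          by (intro sum_le_suminf summable_geometric) auto
        then show "(\<Sum>l<M. (1 / 2) ^ l) \<le> (2 :: real)"
          by (simp add: suminf_geometric)
      qed (use W in auto)
      finally show ?thesis
        using p W by (subst (asm) lp_sum_le_iff) (auto simp: mult_ac)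
    qed
    \<comment> \<open>For a fixed tuple the l_p sum has finitely many terms, so bounds on partial
      sums of the series pass to the limit.\<close>
    have "(\<lambda>M. \<Sum>i<n. \<bar>\<Sum>l<M. g (l + K) (\<phi> i)\<bar> powr p) \<longlonglongrightarrow> (\<Sum>i<n. \<bar>c (\<phi> i) - (\<Sum>k<K. g k (\<phi> i))\<bar> powr p)"
    proof (intro tendsto_sum tendsto_powr' tendsto_rabs tendsto_const)
      fix i assume "i \<in> {..<n}"
      then have s: "summable (\<lambda>k. g k (\<phi> i))"
        using sm \<phi> by simp
      then have "summable (\<lambda>l. g (l + K) (\<phi> i))"
        by (subst summable_iff_shift)
      then have "(\<lambda>M. \<Sum>l<M. g (l + K) (\<phi> i)) \<longlonglongrightarrow> (\<Sum>l. g (l + K) (\<phi> i))"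
        by (rule summable_LIMSEQ)
      then show "(\<lambda>M. \<Sum>l<M. g (l + K) (\<phi> i)) \<longlonglongrightarrow> c (\<phi> i) - (\<Sum>k<K. g k (\<phi> i))"
        using suminf_minus_initial_segment[OF s, of K] by (simp add: c_def)
    qed (use p in auto)
    then have "(\<Sum>i<n. \<bar>c (\<phi> i) - (\<Sum>k<K. g k (\<phi> i))\<bar> powr p) \<le> (2 * (1 / 2) ^ K * W) powr p"
      by (rule LIMSEQ_le_const2) (use part in blast)
    then show "lp_sum p {..<n} (\<lambda>i. c (\<phi> i) - (\<Sum>k<K. g k (\<phi> i))) \<le> 2 * (1 / 2) ^ K * weak_p_norm S p n \<phi>"
      using p W by (subst lp_sum_le_iff) (auto simp: W_def)
  qed
  have "p_norm S p c \<le> ereal 2"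
    using p_norm_le[OF _ tail[of 0]] by simp
  then have "p_norm S p c < \<infinity>"
    by auto
  moreover have "\<exists>v\<in>FVL S. p_norm S p (\<lambda>\<phi>. c \<phi> - v \<phi>) < ereal e" if e: "e > 0" for e
  proof -
    obtain K where K: "(1 / 2) ^ K < e / 2"
      using real_arch_pow_inv[of "e / 2" "1 / 2"] e by auto
    have "p_norm S p (\<lambda>\<phi>. c \<phi> - (\<Sum>k<K. g k \<phi>)) \<le> ereal (2 * (1 / 2) ^ K)"
      by (rule p_norm_le[OF _ tail]) simp
    also have "\<dots> < ereal e"
      using K by simp
    finally show ?thesis
      using FVL_sum[of "{..<K}" g S] g by (intro bexI[of _ "\<lambda>\<phi>. \<Sum>k<K. g k \<phi>"]) auto
  qed
  ultimately have "c \<in> FBL S p"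
    using c_H unfolding FBL_def H_wstar_p_def by blast
  then show ?thesis
    by (simp add: c_def[abs_def])
qed

section \<open>Failure of regularity\<close>

lemma dual_norm_le:
  assumes "0 \<in> S" "K \<ge> 0" "\<And>s. s \<in> S \<Longrightarrow> \<bar>\<phi> s\<bar> \<le> K * norm s"
  shows "dual_norm S \<phi> \<le> K"
  unfolding op_norm_def
proof (rule cSUP_least)
  show "{v \<in> S. norm v \<le> 1} \<noteq> {}"
    using assms(1) by (auto intro!: exI[of _ 0])
  fix v assume "v \<in> {v \<in> S. norm v \<le> 1}"
  then show "\<bar>\<phi> v\<bar> \<le> K"
    using assms(3)[of v] mult_left_mono[of "norm v" 1 K] assms(2) by auto
qed

lemma dual_extension:
  assumes S: "subspace S" and \<phi>: "\<phi> \<in> dual S" and K: "K \<ge> 0" "\<And>s. s \<in> S \<Longrightarrow> \<bar>\<phi> s\<bar> \<le> K * norm s"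
  obtains \<psi> where "bounded_linear \<psi>" "\<And>s. s \<in> S \<Longrightarrow> \<psi> s = \<phi> s" "\<And>y. \<bar>\<psi> y\<bar> \<le> K * norm y"
proof -
  define G where "G = {(s, \<phi> s) |s. s \<in> S}"
  have "subspace G"
  proof (rule subspaceI)
    show "0 \<in> G"
      using subspace_0[OF S] dual_at_zero[OF \<phi>] by (auto simp: G_def zero_prod_def)
    fix g g' and c :: real
    assume "g \<in> G" "g' \<in> G"
    then show "g + g' \<in> G" "c *\<^sub>R g \<in> G"
      using dualD[OF \<phi>] S by (auto simp: G_def subspace_add subspace_scale)
  qed
  moreover have "c \<le> K * norm s" if "(s, c) \<in> G" for s c
    using that K(2)[of s] by (auto simp: G_def)
  ultimately obtain \<psi> where "bounded_linear \<psi>" "\<And>s c. (s, c) \<in> G \<Longrightarrow> \<psi> s = c" "\<And>y. \<bar>\<psi> y\<bar> \<le> K * norm y"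
    using hahn_banach_graph[of G K] K(1) by blast
  then show ?thesis
    by (intro that[of \<psi>]) (auto simp: G_def)
qed

lemma subspace_closure:
  fixes V :: "'a::real_normed_vector set"
  assumes "subspace V"
  shows "subspace (closure V)"
proof (rule subspaceI)
  show "0 \<in> closure V"
    using subspace_0[OF assms] closure_subset by blast
  fix s t and c :: real
  assume "s \<in> closure V"
  then obtain a where a: "\<And>n. a n \<in> V" "a \<longlonglongrightarrow> s"
    by (auto simp: closure_sequential)
  have "(\<lambda>n. c *\<^sub>R a n) \<longlonglongrightarrow> c *\<^sub>R s" "\<And>n. c *\<^sub>R a n \<in> V"
    using a assms by (auto intro: tendsto_intros subspace_scale)
  then show "c *\<^sub>R s \<in> closure V"
    by (auto simp: closure_sequential intro: exI[of _ "\<lambda>n. c *\<^sub>R a n"])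
  assume "t \<in> closure V"
  then obtain b where b: "\<And>n. b n \<in> V" "b \<longlonglongrightarrow> t"
    by (auto simp: closure_sequential)
  have "(\<lambda>n. a n + b n) \<longlonglongrightarrow> s + t" "\<And>n. a n + b n \<in> V"
    using a b assms by (auto intro: tendsto_intros subspace_add)
  then show "s + t \<in> closure V"
    by (auto simp: closure_sequential intro: exI[of _ "\<lambda>n. a n + b n"])
qed

section \<open>Bumps, sign functionals and the two suprema\<close>

context biorthogonal_spread_families
begin

lemma closed_subspace_X: "closed_subspace X"
  unfolding closed_subspace_def X_def by (intro conjI subspace_closure) auto

lemma subspace_X: "subspace X"
  using closed_subspace_X by (simp add: closed_subspace_def)

lemma x0_X: "x0 \<in> X" and x_X: "j < m k \<Longrightarrow> x k j \<in> X"
proof -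
  have sub: "insert x0 (\<Union>k. x k ` {..<m k}) \<subseteq> X"
    unfolding X_def by (rule order_trans[OF span_superset closure_subset])
  then show "x0 \<in> X" "j < m k \<Longrightarrow> x k j \<in> X"
    by auto
qed

lemma m_pos: "m k > 0"
  using spread[of k] by (cases "m k = 0") (auto simp: spread_family_def)

lemma f_lin: "j < m k \<Longrightarrow> linear (f k j)"
  by (intro bounded_linear.linear f_linear)

text \<open>On the span the coordinates of late stages are exactly 0; the bound \<open>f_le\<close>,
  uniform in k, extends the limit to the closure. This is what makes a function of finitely many
  vectors blind to late perturbations.\<close>

lemma f_L2_tendsto_0:
  assumes "z \<in> X"
  shows "(\<lambda>k. L2_set (\<lambda>j. f k j z) {..<m k}) \<longlonglongrightarrow> 0"
proof (rule LIMSEQ_I)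
  fix r :: real assume r: "r > 0"
  define V where "V = span (insert x0 (\<Union>k. x k ` {..<m k}))"
  obtain s where s: "s \<in> V" "dist s z < r / 4"
    using assms r unfolding X_def V_def closure_approachable by (metis divide_pos_pos zero_less_numeral)
  have "s \<in> X"
    using s closure_subset unfolding X_def V_def by blast
  define R where "R = {s. \<exists>K. \<forall>k\<ge>K. \<forall>j<m k. f k j s = 0}"
  have "subspace R"
  proof (rule subspaceI)
    show "0 \<in> R"
      by (auto simp: R_def linear_0[OF f_lin])
    fix s t and c :: real
    assume "s \<in> R"
    then obtain K where K: "\<forall>k\<ge>K. \<forall>j<m k. f k j s = 0"
      by (auto simp: R_def)
    then show "c *\<^sub>R s \<in> R"
      by (auto simp: R_def linear_scale[OF f_lin])
    assume "t \<in> R"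
    then obtain L where L: "\<forall>k\<ge>L. \<forall>j<m k. f k j t = 0"
      by (auto simp: R_def)
    have "\<forall>k\<ge>max K L. \<forall>j<m k. f k j (s + t) = 0"
      using K L by (simp add: linear_add[OF f_lin])
    then show "s + t \<in> R"
      unfolding R_def by blast
  qed
  moreover have "x0 \<in> R"
    by (auto simp: R_def f_x0)
  moreover have "x l i \<in> R" if "i < m l" for l i
    unfolding R_def using f_earlier that by (auto intro!: exI[of _ "Suc l"])
  ultimately have "V \<subseteq> R"
    unfolding V_def by (intro span_minimal) auto
  then have "s \<in> R"
    using s by blast
  then obtain K where K: "\<And>k j. k \<ge> K \<Longrightarrow> j < m k \<Longrightarrow> f k j s = 0"
    unfolding R_def by blast
  have "norm (L2_set (\<lambda>j. f k j z) {..<m k} - 0) < r" if "k \<ge> K" for k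
  proof -
    have "L2_set (\<lambda>j. f k j z) {..<m k} = L2_set (\<lambda>j. f k j (z - s)) {..<m k}"
      using K[OF that] by (intro L2_set_cong) (auto simp: linear_diff[OF f_lin])
    also have "\<dots> \<le> 4 * norm (z - s)"
      using assms \<open>s \<in> X\<close> by (intro f_le subspace_diff[OF subspace_X])
    also have "\<dots> < r"
      using s by (simp add: dist_norm norm_minus_commute)
    finally show ?thesis
      using L2_set_nonneg[of "\<lambda>j. f k j z" "{..<m k}"] by simp
  qed
  then show "\<exists>K. \<forall>k\<ge>K. norm (L2_set (\<lambda>j. f k j z) {..<m k} - 0) < r"
    by blast
qed

text \<open>The functions G_k. The factor 2^k makes them exceed any given bound at late sign
  functionals, while over the whole space the spread constant (1/4)^k reduces the p-norm to (1/2)^k.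
  The carrier is a parameter because the same expression occurs over \<open>X\<close> and over
  \<open>UNIV\<close>.\<close>

definition bump :: "'a set \<Rightarrow> nat \<Rightarrow> ('a \<Rightarrow> real) \<Rightarrow> real" where
  "bump S k \<phi> = 2 ^ k * ((\<Sum>j<m k. \<bar>delta S (x k j) \<phi>\<bar>) / real (m k))"

lemma bump_FVL:
  assumes "\<And>j. j < m k \<Longrightarrow> x k j \<in> S"
  shows "bump S k \<in> FVL S"
proof -
  have "(\<lambda>\<phi>. (2 ^ k / real (m k)) * (\<Sum>j<m k. \<bar>delta S (x k j) \<phi>\<bar>)) \<in> FVL S"
    using assms by (intro FVL_cmult FVL_sum FVL_abs delta_FVL) auto
  then show ?thesis
    by (simp add: bump_def[abs_def])
qed

lemma bump_p_bounded: "p_bounded UNIV p ((1 / 2) ^ k) (bump UNIV k)"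
  unfolding p_bounded_def
proof (intro allI impI)
  fix n :: nat and \<phi> :: "nat \<Rightarrow> 'a \<Rightarrow> real" assume \<phi>: "\<forall>i<n. \<phi> i \<in> dual UNIV"
  define W where "W = weak_p_norm UNIV p n \<phi>"
  have p1: "p > 1"
    using p by simp
  have W: "W \<ge> 0"
    unfolding W_def using \<phi> p1 by (intro weak_p_norm_nonneg) auto
  have avg: "lp_sum p {..<n} (\<lambda>i. (\<Sum>j<m k. \<bar>\<phi> i (x k j)\<bar>) / real (m k)) \<le> (1 / 4) ^ k * W"
  proof -
    have "\<forall>i<n. bounded_linear (\<phi> i)"
      using \<phi> by (simp add: dual_UNIV)
    moreover have "\<forall>y. lp_sum p {..<n} (\<lambda>i. \<phi> i y) \<le> W * norm y"
      unfolding W_def using \<phi> p1 by (intro allI lp_sum_le_weak_p_norm) auto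
    ultimately show ?thesis
      using spread[of k] W unfolding spread_family_def by simp
  qed
  have "lp_sum p {..<n} (\<lambda>i. bump UNIV k (\<phi> i))
      \<le> lp_sum p {..<n} (\<lambda>i. 2 ^ k * ((\<Sum>j<m k. \<bar>\<phi> i (x k j)\<bar>) / real (m k)))"
    using \<phi> p by (intro lp_sum_mono) (auto simp: bump_def delta_def)
  also have "\<dots> = 2 ^ k * lp_sum p {..<n} (\<lambda>i. (\<Sum>j<m k. \<bar>\<phi> i (x k j)\<bar>) / real (m k))"
    by (subst lp_sum_cmult) (use p in auto)
  also have "\<dots> \<le> 2 ^ k * ((1 / 4) ^ k * W)"
    using avg by (intro mult_left_mono) auto
  also have "\<dots> = (1 / 2) ^ k * W"
    by (simp add: power_mult_distrib[symmetric] mult.assoc[symmetric])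
  finally show "lp_sum p {..<n} (\<lambda>i. bump UNIV k (\<phi> i)) \<le> (1 / 2) ^ k * weak_p_norm UNIV p n \<phi>"
    by (simp add: W_def)
qed

text \<open>The spread condition speaks of functionals on the whole space, so \<phi> is extended
  with the same bound and regarded as a tuple of length one. The estimate prevents the unperturbed
  functional from cancelling a sign functional in \<open>upper_bound_ge\<close>.\<close>

lemma average_le:
  assumes "\<phi> \<in> dual X" "K \<ge> 0" "\<And>s. s \<in> X \<Longrightarrow> \<bar>\<phi> s\<bar> \<le> K * norm s"
  shows "2 ^ k * ((\<Sum>j<m k. \<bar>\<phi> (x k j)\<bar>) / real (m k)) \<le> K"
proof -
  obtain \<psi> where \<psi>: "bounded_linear \<psi>" "\<And>s. s \<in> X \<Longrightarrow> \<psi> s = \<phi> s" "\<And>y. \<bar>\<psi> y\<bar> \<le> K * norm y"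
    using dual_extension[OF subspace_X assms] by blast
  have single: "lp_sum p {..<1::nat} (\<lambda>_. t) = \<bar>t\<bar>" for t
    using p by (simp add: lp_sum_def powr_powr)
  have "lp_sum p {..<1::nat} (\<lambda>_. (\<Sum>j\<in>{..<m k}. \<bar>\<psi> (x k j)\<bar>) / real (card {..<m k})) \<le> (1 / 4) ^ k * K"
    using spread[of k, unfolded spread_family_def, THEN conjunct2, THEN conjunct2, THEN conjunct2,
        rule_format, of K 1 "\<lambda>_. \<psi>"] \<psi>(1,3) assms(2) unfolding single by simp
  then have "(\<Sum>j<m k. \<bar>\<phi> (x k j)\<bar>) / real (m k) \<le> (1 / 4) ^ k * K"
    unfolding single using \<psi>(2) x_X by (simp add: sum_nonneg)
  then have "2 ^ k * ((\<Sum>j<m k. \<bar>\<phi> (x k j)\<bar>) / real (m k)) \<le> 2 ^ k * ((1 / 4) ^ k * K)"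
    by (intro mult_left_mono) auto
  also have "\<dots> = (1 / 2) ^ k * K"
    by (simp add: power_mult_distrib[symmetric] mult.assoc[symmetric])
  also have "\<dots> \<le> 1 * K"
    using assms(2) by (intro mult_right_mono power_le_one) auto
  finally show ?thesis
    by simp
qed

definition sign_functional :: "nat \<Rightarrow> nat set \<Rightarrow> 'a \<Rightarrow> real" where
  "sign_functional k S s = (if s \<in> X then \<Sum>j<m k. sign_of S j * f k j s else 0)"

lemma sign_functional_dual: "sign_functional k S \<in> dual X"
proof (rule dualI)
  fix s assume s: "s \<in> X"
  have "\<bar>sign_functional k S s\<bar> \<le> (\<Sum>j<m k. \<bar>f k j s\<bar>)"
    using s sum_abs[of "\<lambda>j. sign_of S j * f k j s" "{..<m k}"] by (simp add: sign_functional_def abs_mult)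
  also have "\<dots> \<le> (\<Sum>j<m k. 4 * norm s)"
  proof (rule sum_mono)
    fix j assume "j \<in> {..<m k}"
    then have "\<bar>f k j s\<bar> \<le> L2_set (\<lambda>j. \<bar>f k j s\<bar>) {..<m k}"
      by (intro member_le_L2_set) auto
    then show "\<bar>f k j s\<bar> \<le> 4 * norm s"
      using f_le[OF s, of k] by (simp add: L2_set_def)
  qed
  finally show "\<bar>sign_functional k S s\<bar> \<le> (real (m k) * 4) * norm s"
    by simp
qed (auto simp: sign_functional_def subspace_add[OF subspace_X] subspace_scale[OF subspace_X]
      linear_add[OF f_lin] linear_scale[OF f_lin] distrib_left sum.distrib sum_distrib_left mult_ac)

lemma sign_functional_own: "j < m k \<Longrightarrow> sign_functional k S (x k j) = sign_of S j"
proof -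
  assume j: "j < m k"
  have "(\<Sum>i<m k. sign_of S i * f k i (x k j)) = (\<Sum>i<m k. if i = j then sign_of S i else 0)"
    using f_own j by (intro sum.cong) auto
  then show ?thesis
    using j x_X by (simp add: sign_functional_def)
qed

lemma sign_functional_x0: "sign_functional k S x0 = 0"
  by (simp add: sign_functional_def f_x0)

text \<open>
  Near any \<open>\<phi>0\<close> there is a \<open>p\<close>-summable tuple on which \<open>u\<close> dominates \<open>\<bar>\<phi>0 x0\<bar>\<close>; it consists of
  perturbations of \<open>\<phi>0\<close> by sign functionals, to which a function in the free vector lattice is blind.
\<close>

lemma upper_bound_ge:
  assumes u: "u \<in> FBL X p" and ub: "\<And>k \<phi>. min \<bar>delta X x0 \<phi>\<bar> (bump X k \<phi>) \<le> u \<phi>"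
    and \<phi>0: "\<phi>0 \<in> dual X"
  shows "\<bar>\<phi>0 x0\<bar> \<le> u \<phi>0"
proof (rule ccontr)
  define D where "D = \<bar>\<phi>0 x0\<bar> - u \<phi>0"
  assume "\<not> \<bar>\<phi>0 x0\<bar> \<le> u \<phi>0"
  then have D: "D > 0"
    by (simp add: D_def)
  have p1: "p > 1" and p0: "p > 0"
    using p by auto
  obtain K0 where K0: "K0 \<ge> 0" "\<And>s. s \<in> X \<Longrightarrow> \<bar>\<phi>0 s\<bar> \<le> K0 * norm s"
    using dual_bounded[OF \<phi>0] by blast
  obtain C where C: "C > 0" "\<And>(I :: nat set) b. finite I \<Longrightarrow>
      (\<Sum>S\<in>Pow I. \<bar>\<Sum>i\<in>I. sign_of S i * b i\<bar> powr p) \<le> 2 ^ card I * (C * L2_set b I) powr p"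
    using khinchine_upper[OF p0] by blast
  \<comment> \<open>The approximation error of \<open>u\<close> by a lattice function is paid K0 + 4
    * C times on the tuple and K0 times at \<phi>0; this choice keeps the total at or below D / 3.
    Another D / 3 is reserved for the Lipschitz error, and 2 * D / 3 < D gives the
    contradiction.\<close>
  define \<epsilon> where "\<epsilon> = D / (3 * (2 * K0 + 4 * C + 1))"
  have den: "2 * K0 + 4 * C + 1 > 0"
    using K0 C by linarith
  then have "\<epsilon> > 0"
    using D by (simp add: \<epsilon>_def)
  then obtain v where v: "v \<in> FVL X" "p_norm X p (\<lambda>\<phi>. u \<phi> - v \<phi>) < ereal \<epsilon>"
    using u unfolding FBL_def by blast
  obtain C1 where C1: "0 \<le> C1" "C1 < \<epsilon>" "p_bounded X p C1 (\<lambda>\<phi>. u \<phi> - v \<phi>)"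
    using p_norm_lessE[OF v(2)] by blast
  have vL: "v \<in> lipschitz_functions X"
    using v FVL_lipschitz by blast
  then obtain Z L where "lipschitz_bound X Z L v"
    unfolding lipschitz_functions_def by blast
  note Z = lipschitz_boundD[OF this]
  have "(\<lambda>k. L * (\<Sum>z\<in>Z. C * L2_set (\<lambda>j. f k j z) {..<m k})) \<longlonglongrightarrow> L * (\<Sum>z\<in>Z. C * 0)"
    using Z(2) by (intro tendsto_intros f_L2_tendsto_0) auto
  then have "eventually (\<lambda>k. L * (\<Sum>z\<in>Z. C * L2_set (\<lambda>j. f k j z) {..<m k}) < D / 3) sequentially"
    using D by (intro order_tendstoD) auto
  then obtain k0 where k0: "\<And>k. k \<ge> k0 \<Longrightarrow> L * (\<Sum>z\<in>Z. C * L2_set (\<lambda>j. f k j z) {..<m k}) < D / 3"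
    by (auto simp: eventually_sequentially)
  \<comment> \<open>At a perturbed functional \<open>bump X k\<close> is at least 2^k - K0, and this
    has to reach the value of \<open>\<bar>delta X x0\<bar>\<close> there.\<close>
  obtain k1 where k1: "K0 + \<bar>\<phi>0 x0\<bar> < 2 ^ k1"
    using real_arch_pow[of "2 :: real" "K0 + \<bar>\<phi>0 x0\<bar>"] by force
  define k where "k = max k0 k1"
  have pow_mono: "2 ^ k1 \<le> (2 :: real) ^ k"
    by (intro power_increasing) (auto simp: k_def)
  have k: "L * (\<Sum>z\<in>Z. C * L2_set (\<lambda>j. f k j z) {..<m k}) < D / 3" "K0 + \<bar>\<phi>0 x0\<bar> \<le> 2 ^ k"
    by (rule k0, simp add: k_def) (use pow_mono k1 in linarith)
  define N where "N = card (Pow {..<m k})"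
  have N: "real N = 2 ^ m k" "N > 0"
    by (simp_all add: N_def card_Pow)
  obtain h where h: "bij_betw h {..<N} (Pow {..<m k})"
    unfolding N_def using ex_bij_betw_nat_finite[of "Pow {..<m k}"] by (auto simp: atLeast0LessThan)
  \<comment> \<open>With this scaling a constant tuple \<open>r * t\<close> of length N has l_p norm
    |t|, so the tuple registers the deficit D in full, and the factor 2^m in Khinchine's inequality
    cancels.\<close>
  define r where "r = real N powr (- 1 / p)"
  have "r > 0"
    using N by (simp add: r_def)
  have r_powr: "\<bar>r * t\<bar> powr p = \<bar>t\<bar> powr p / real N" for t
  proof -
    have "r powr p = real N powr - 1"
      using p0 by (simp only: r_def powr_powr) simp
    then have "r powr p = 1 / real N"
      using N by (simp add: powr_minus_divide)
    then show ?thesis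
      using \<open>r > 0\<close> by (simp add: abs_mult powr_mult)
  qed
  have lp_const: "lp_sum p {..<N} (\<lambda>_. r * t) = \<bar>t\<bar>" for t
    using N p0 unfolding lp_sum_def r_powr by (simp add: powr_powr)
  define w where "w i = sign_functional k (h i)" for i
  have w: "w i \<in> dual X" for i
    by (simp add: w_def sign_functional_dual)
  have lp_w: "lp_sum p {..<N} (\<lambda>i. r * w i s) \<le> C * L2_set (\<lambda>j. f k j s) {..<m k}" if "s \<in> X" for s
  proof -
    have "(\<Sum>i<N. \<bar>r * w i s\<bar> powr p) = (\<Sum>S\<in>Pow {..<m k}. \<bar>\<Sum>j<m k. sign_of S j * f k j s\<bar> powr p / real N)"
      unfolding r_powr w_def using that
      by (simp add: sign_functional_def
          sum.reindex_bij_betw[OF h, of "\<lambda>S. \<bar>\<Sum>j<m k. sign_of S j * f k j s\<bar> powr p / real N"])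
    also have "\<dots> = (\<Sum>S\<in>Pow {..<m k}. \<bar>\<Sum>j<m k. sign_of S j * f k j s\<bar> powr p) / real N"
      by (simp add: sum_divide_distrib)
    also have "\<dots> \<le> (C * L2_set (\<lambda>j. f k j s) {..<m k}) powr p"
      using C(2)[of "{..<m k}" "\<lambda>j. f k j s"] N by (simp add: field_simps)
    finally show ?thesis
      using C(1) p0 by (subst lp_sum_le_iff) (auto simp: L2_set_nonneg)
  qed
  define \<psi> where "\<psi> i = (\<lambda>s. \<phi>0 s + w i s)" for i
  have \<psi>: "\<psi> i \<in> dual X" for i
    unfolding \<psi>_def by (intro dual_add \<phi>0 w)
  define \<phi> where "\<phi> i = (\<lambda>s. r * \<psi> i s)" for i
  have \<phi>: "\<phi> i \<in> dual X" for i
    unfolding \<phi>_def by (intro dual_cmult \<psi>)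
  \<comment> \<open>K0 comes from the constant part of the tuple, and 4 * C from Khinchine's
    inequality and \<open>f_le\<close>. Neither depends on k, although the norms of the individual
    functionals are not bounded in k.\<close>
  have weak: "weak_p_norm X p N \<phi> \<le> K0 + 4 * C"
  proof (rule weak_p_norm_le[OF p1 subspace_0[OF subspace_X]])
    fix s assume s: "s \<in> X"
    have "lp_sum p {..<N} (\<lambda>i. \<phi> i s) \<le> lp_sum p {..<N} (\<lambda>i. r * \<phi>0 s) + lp_sum p {..<N} (\<lambda>i. r * w i s)"
      unfolding \<phi>_def \<psi>_def distrib_left using p1 by (intro minkowski_sum) auto
    also have "\<dots> \<le> K0 * norm s + C * (4 * norm s)"
      unfolding lp_const using C(1)
      by (intro add_mono K0(2)[OF s] order_trans[OF lp_w[OF s]] mult_left_mono f_le[OF s]) auto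
    finally show "lp_sum p {..<N} (\<lambda>i. \<phi> i s) \<le> (K0 + 4 * C) * norm s"
      by (simp add: distrib_right)
  qed (use K0 C in auto)
  have u_hom: "u (\<phi> i) = r * u (\<psi> i)" and v_hom: "v (\<phi> i) = r * v (\<psi> i)" for i
    using u vL \<psi>[of i] \<open>r > 0\<close>
    by (auto simp: FBL_def H_wstar_p_def H_wstar_def lipschitz_functions_def \<phi>_def)
  have u_ge: "\<bar>\<phi>0 x0\<bar> \<le> u (\<psi> i)" for i
  proof -
    have own: "1 - \<bar>\<phi>0 (x k j)\<bar> \<le> \<bar>\<psi> i (x k j)\<bar>" if "j < m k" for j
      using abs_sign_of[of "h i" j] that unfolding \<psi>_def w_def sign_functional_own[OF that] by linarith
    have "real (m k) - (\<Sum>j<m k. \<bar>\<phi>0 (x k j)\<bar>) = (\<Sum>j<m k. 1 - \<bar>\<phi>0 (x k j)\<bar>)"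
      by (simp add: sum_subtractf)
    also have "\<dots> \<le> (\<Sum>j<m k. \<bar>\<psi> i (x k j)\<bar>)"
      using own by (intro sum_mono) auto
    finally have "2 ^ k * ((real (m k) - (\<Sum>j<m k. \<bar>\<phi>0 (x k j)\<bar>)) / real (m k))
        \<le> 2 ^ k * ((\<Sum>j<m k. \<bar>\<psi> i (x k j)\<bar>) / real (m k))"
      by (intro mult_left_mono divide_right_mono) auto
    moreover have "2 ^ k * ((real (m k) - (\<Sum>j<m k. \<bar>\<phi>0 (x k j)\<bar>)) / real (m k))
        = 2 ^ k - 2 ^ k * ((\<Sum>j<m k. \<bar>\<phi>0 (x k j)\<bar>) / real (m k))"
      using m_pos[of k] by (simp add: diff_divide_distrib right_diff_distrib)
    ultimately have "\<bar>\<phi>0 x0\<bar> \<le> bump X k (\<psi> i)"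
      using average_le[OF \<phi>0 K0, of k] k(2) \<psi>[of i] by (simp add: bump_def delta_def)
    moreover have "\<bar>delta X x0 (\<psi> i)\<bar> = \<bar>\<phi>0 x0\<bar>"
      using \<psi>[of i] by (simp add: delta_def \<psi>_def w_def sign_functional_x0)
    ultimately show ?thesis
      using ub[of "\<psi> i" k] by simp
  qed
  \<comment> \<open>The scaled difference of \<open>u\<close> at a perturbed functional and at
    \<phi>0 splits into three errors: \<open>e1\<close> from approximating \<open>u\<close> on the
    tuple, \<open>e2\<close> from the perturbation inside the lattice function \<open>v\<close>, and
    a constant one from approximating \<open>u\<close> at \<phi>0.\<close>
  define e1 where "e1 i = u (\<phi> i) - v (\<phi> i)" for i
  define e2 where "e2 i = r * (v (\<psi> i) - v \<phi>0)" for i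
  have "lp_sum p {..<N} (\<lambda>_. r * D) \<le> lp_sum p {..<N} (\<lambda>i. (e1 i + e2 i) + r * (v \<phi>0 - u \<phi>0))"
  proof (rule lp_sum_mono[OF p0])
    fix i
    have "r * D \<le> r * (u (\<psi> i) - u \<phi>0)"
      using u_ge[of i] \<open>r > 0\<close> by (simp add: D_def)
    also have "\<dots> = (e1 i + e2 i) + r * (v \<phi>0 - u \<phi>0)"
      by (simp add: e1_def e2_def u_hom v_hom algebra_simps)
    finally show "\<bar>r * D\<bar> \<le> \<bar>(e1 i + e2 i) + r * (v \<phi>0 - u \<phi>0)\<bar>"
      using mult_pos_pos[OF \<open>r > 0\<close> D] by linarith
  qed
  also have "\<dots> \<le> lp_sum p {..<N} (\<lambda>i. e1 i + e2 i) + lp_sum p {..<N} (\<lambda>_. r * (v \<phi>0 - u \<phi>0))"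
    using p1 by (intro minkowski_sum) auto
  also have "\<dots> \<le> lp_sum p {..<N} e1 + lp_sum p {..<N} e2 + lp_sum p {..<N} (\<lambda>_. r * (v \<phi>0 - u \<phi>0))"
    using p1 by (intro add_right_mono minkowski_sum) auto
  finally have "D \<le> lp_sum p {..<N} e1 + lp_sum p {..<N} e2 + \<bar>v \<phi>0 - u \<phi>0\<bar>"
    unfolding lp_const using D by simp
  moreover have "lp_sum p {..<N} e1 \<le> C1 * (K0 + 4 * C)"
  proof -
    have "lp_sum p {..<N} e1 \<le> C1 * weak_p_norm X p N \<phi>"
      using C1(3)[unfolded p_bounded_def, rule_format, of N \<phi>] \<phi> by (simp add: e1_def[abs_def])
    also have "\<dots> \<le> C1 * (K0 + 4 * C)"
      using weak C1(1) by (rule mult_left_mono)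
    finally show ?thesis .
  qed
  moreover have "lp_sum p {..<N} e2 < D / 3"
  proof -
    have "lp_sum p {..<N} e2 \<le> lp_sum p {..<N} (\<lambda>i. L * (\<Sum>z\<in>Z. \<bar>r * w i z\<bar>))"
    proof (rule lp_sum_mono[OF p0])
      fix i
      have "\<bar>v (\<psi> i) - v \<phi>0\<bar> \<le> L * (\<Sum>z\<in>Z. \<bar>w i z\<bar>)"
        using Z(4)[OF \<psi>[of i] \<phi>0] by (simp add: \<psi>_def)
      then have "r * \<bar>v (\<psi> i) - v \<phi>0\<bar> \<le> r * (L * (\<Sum>z\<in>Z. \<bar>w i z\<bar>))"
        using \<open>r > 0\<close> by (intro mult_left_mono) auto
      then show "\<bar>e2 i\<bar> \<le> \<bar>L * (\<Sum>z\<in>Z. \<bar>r * w i z\<bar>)\<bar>"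
        using \<open>r > 0\<close> Z(3)
        by (simp add: e2_def abs_mult sum_distrib_left[symmetric] sum_nonneg mult_ac)
    qed
    also have "\<dots> = L * lp_sum p {..<N} (\<lambda>i. \<Sum>z\<in>Z. \<bar>r * w i z\<bar>)"
      using p0 Z(3) by (simp add: lp_sum_cmult)
    also have "\<dots> \<le> L * (\<Sum>z\<in>Z. lp_sum p {..<N} (\<lambda>i. \<bar>r * w i z\<bar>))"
      using p1 Z by (intro mult_left_mono minkowski_sum_sum) auto
    also have "\<dots> \<le> L * (\<Sum>z\<in>Z. C * L2_set (\<lambda>j. f k j z) {..<m k})"
    proof (intro mult_left_mono sum_mono)
      fix z assume "z \<in> Z"
      then show "lp_sum p {..<N} (\<lambda>i. \<bar>r * w i z\<bar>) \<le> C * L2_set (\<lambda>j. f k j z) {..<m k}"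
        using lp_w[of z] Z(2) by (auto simp: lp_sum_def)
    qed (use Z in auto)
    finally show ?thesis
      using k(1) by linarith
  qed
  moreover have "\<bar>v \<phi>0 - u \<phi>0\<bar> \<le> C1 * K0"
  proof -
    have "\<bar>u \<phi>0 - v \<phi>0\<bar> \<le> C1 * dual_norm X \<phi>0"
      by (rule p_bounded_pointwise[OF p1 subspace_X C1(3,1) \<phi>0])
    also have "\<dots> \<le> C1 * K0"
      using C1(1) K0 subspace_0[OF subspace_X] by (intro mult_left_mono dual_norm_le) auto
    finally show ?thesis
      by (simp add: abs_minus_commute)
  qed
  moreover have "C1 * (K0 + 4 * C) + C1 * K0 \<le> D / 3"
  proof -
    have "C1 * (2 * K0 + 4 * C + 1) \<le> \<epsilon> * (2 * K0 + 4 * C + 1)"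
      using C1(2) den by (intro mult_right_mono) auto
    also have "\<dots> = D / 3"
      using den by (simp add: \<epsilon>_def field_simps)
    finally show ?thesis
      using C1(1) by (simp add: algebra_simps)
  qed
  ultimately show False
    using D by linarith
qed

lemma adjoint_dual:
  assumes "\<psi> \<in> dual UNIV"
  shows "adjoint_on X (\<lambda>x. x) \<psi> \<in> dual X"
proof -
  interpret bounded_linear \<psi>
    using assms by (simp add: dual_UNIV)
  obtain K where K: "\<forall>s. norm (\<psi> s) \<le> norm s * K"
    using bounded by blast
  show ?thesis
  proof (rule dualI)
    show "\<bar>adjoint_on X (\<lambda>x. x) \<psi> s\<bar> \<le> K * norm s" if "s \<in> X" for s
      using K that by (simp add: adjoint_on_def mult.commute)
  qed (simp_all add: adjoint_on_def add scaleR subspace_add[OF subspace_X] subspace_scale[OF subspace_X])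
qed

lemma not_regular: "\<not> regular_image (FBL X p) (FBL UNIV p) (induced_hom X UNIV (\<lambda>x. x))"
proof
  assume regular: "regular_image (FBL X p) (FBL UNIV p) (induced_hom X UNIV (\<lambda>x. x))"
  have p1: "p > 1"
    using p by simp
  let ?j = "induced_hom X UNIV (\<lambda>x. x)"
  define a where "a = (\<lambda>\<phi>. \<bar>delta X x0 \<phi>\<bar>)"
  define b where "b k = (\<lambda>\<phi>. min \<bar>delta X x0 \<phi>\<bar> (bump X k \<phi>))" for k
  have aF: "a \<in> FVL X"
    unfolding a_def by (intro FVL_abs delta_FVL x0_X)
  have bF: "b k \<in> FVL X" for k
    unfolding b_def by (intro FVL_min FVL_abs delta_FVL x0_X bump_FVL x_X)
  have sub: "FVL X \<subseteq> FBL X p"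
    by (rule FVL_subset_FBL[OF p1 subspace_X])
  have "isLub (FBL X p) (range b) a"
  proof (rule isLubI2)
    show "isUb (FBL X p) (range b) a"
      using aF sub by (intro isUbI setleI) (auto simp: a_def b_def le_fun_def)
    show "a <=* Collect (isUb (FBL X p) (range b))"
    proof (rule setgeI, rule ballI)
      fix u assume "u \<in> Collect (isUb (FBL X p) (range b))"
      then have u: "u \<in> FBL X p" "\<And>k. b k \<le> u"
        by (auto dest: isUbD isUbD2a)
      show "a \<le> u"
      proof (rule le_funI)
        fix \<phi>
        show "a \<phi> \<le> u \<phi>"
        proof (cases "\<phi> \<in> dual X")
          case True
          then have "\<bar>\<phi> x0\<bar> \<le> u \<phi>"
            using u by (intro upper_bound_ge) (auto simp: b_def le_fun_def)
          then show ?thesis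
            using True by (simp add: a_def delta_def)
        next
          case False
          then have "u \<phi> = 0"
            using u(1) by (simp add: FBL_def H_wstar_p_def H_wstar_def)
          then show ?thesis
            using False by (simp add: a_def delta_def)
        qed
      qed
    qed
  qed
  moreover have "range b \<noteq> {}" "range b \<subseteq> FBL X p"
    using bF sub by auto
  ultimately have lub: "isLub (FBL UNIV p) (?j ` range b) (?j a)"
    using regular unfolding regular_image_def by blast
  \<comment> \<open>On the dual the geometric bound makes the series converge, and its terms are
    nonnegative, so it dominates each of them. Off the dual all terms are 0, and so is the
    sum.\<close>
  define c where "c = (\<lambda>\<psi>. \<Sum>k. bump UNIV k \<psi>)"
  have bumpF: "bump UNIV k \<in> FVL UNIV" for k
    by (intro bump_FVL) auto
  have bump_nonneg: "bump S k \<psi> \<ge> 0" for S k \<psi>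
    by (simp add: bump_def sum_nonneg)
  have "c \<in> FBL UNIV p"
    unfolding c_def by (intro FBL_series p1 bumpF bump_p_bounded) auto
  moreover have "?j (b k) \<le> c" for k
  proof (rule le_funI)
    fix \<psi>
    show "?j (b k) \<psi> \<le> c \<psi>"
    proof (cases "\<psi> \<in> dual UNIV")
      case True
      have "\<bar>bump UNIV k \<psi>\<bar> \<le> (1 / 2) ^ k * dual_norm UNIV \<psi>" for k
        by (rule p_bounded_pointwise[OF p1 _ bump_p_bounded _ True]) auto
      then have "summable (\<lambda>k. bump UNIV k \<psi>)"
        by (intro summable_comparison_test[OF _ summable_mult2[OF summable_geometric]]) auto
      then have "bump UNIV k \<psi> \<le> c \<psi>"
        unfolding c_def using sum_le_suminf[of "\<lambda>k. bump UNIV k \<psi>" "{k}"] bump_nonneg by simp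
      moreover have "bump X k (adjoint_on X (\<lambda>x. x) \<psi>) = bump UNIV k \<psi>"
        using True adjoint_dual[OF True] x_X by (simp add: bump_def delta_def adjoint_on_def)
      ultimately show ?thesis
        using True by (simp add: induced_hom_def b_def)
    next
      case False
      then show ?thesis
        using bump_nonneg by (simp add: induced_hom_def c_def bump_def delta_def)
    qed
  qed
  ultimately have "isUb (FBL UNIV p) (?j ` range b) c"
    by (intro isUbI setleI) auto
  then have "?j a \<le> c"
    by (rule isLub_le_isUb[OF lub])
  moreover have y0d: "y0 \<in> dual UNIV"
    using y0(1) by (simp add: dual_UNIV)
  moreover have "?j a y0 = 1"
    using y0d adjoint_dual[OF y0d] x0_X y0(2) by (simp add: induced_hom_def a_def delta_def adjoint_on_def)
  moreover have "c y0 = 0"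
    using y0d y0(3) by (simp add: c_def bump_def delta_def)
  ultimately show False
    by (metis le_funD not_one_le_zero)
qed

end

theorem theorem10p6:
  fixes p :: real and q :: ereal
  assumes "p \<in> {2..}"
    and "q \<in> {\<infinity>} \<union> {1..<2}"
    and "contains_lq_uniformly (UNIV :: 'a::banach set) q"
  shows "\<exists>X :: 'a set. closed_subspace X \<and>
           \<not> regular_image (FBL X p) (FBL (UNIV :: 'a set) p) (induced_hom X UNIV (\<lambda>x. x))"
proof -
  have "p \<ge> 2"
    using assms(1) by simp
  then obtain x0 :: 'a and y0 m x f X where "biorthogonal_spread_families p x0 y0 m x f X"
    using biorthogonal_spread_families_exist[OF _ assms(2,3)] by blast
  then interpret biorthogonal_spread_families p x0 y0 m x f X .
  show ?thesis
    using closed_subspace_X not_regular by blast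
qed

end
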